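(* Let $k\ge3$ and $p_1,\dots,p_k\ge2$ be integers with $\frac{1}{p_1}+\dots+\frac{1}{p_k}<k-2$. Then the growth rate of the reflection group given by the compact Coxeter $k$-gon $(p_1,\dots,p_k)$ in $\mathbb H^2$ equals the spectral radius of the Coxeter transformation of $\mathrm{Star}(p_1,\dots,p_k)$.
   Context: Coxeter polygon: $(p_1,\dots,p_k)$ denotes a compact convex $k$-gon in the hyperbolic plane $\mathbb H^2$ with interior angles $\pi/p_1,\dots,\pi/p_k$ (in cyclic order); it exists exactly when $\frac{1}{p_1}+\dots+\frac{1}{p_k}<k-2$. Its reflection group $G$ is the group generated by the set $S$ of reflections in the $k$ lines supporting its sides; $(G,S)$ is a Coxeter system in which the two reflections in sides meeting at the vertex of angle $\pi/p_i$ have product of order $p_i$, and reflections in non-adjacent sides have product of infinite order. Growth rate: for a Coxeter system $(W,S)$ with $S$ finite, let $a_m$ be the number of elements of $W$ of word length $m$ with respect to $S$; the growth rate is $\limsup_{m\to\infty}\sqrt[m]{a_m}$, i.e. the inverse of the radius of convergence of $1+\sum_{m\ge1}a_mt^m$. Star graph: $\mathrm{Star}(p_1,\dots,p_k)$ is the tree with one vertex of valency $k$ that has $k$ outgoing paths of respective lengths (numbers of edges) $p_1-1,\dots,p_k-1$. It is regarded as a Coxeter diagram with all edge weights equal to $3$: the associated Coxeter system has one generator per vertex, with relations $s^2=1$, $(st)^3=1$ if $s,t$ are joined by an edge, and $(st)^2=1$ if $s\neq t$ are not joined. Coxeter transformation: for a Coxeter system $(W,S)$ with $S=\{s_1,\dots,s_N\}$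 and exponents $m_{ij}$, let $V$ be the real vector space with basis $e_1,\dots,e_N$ and symmetric bilinear form $B(e_i,e_j)=-\cos(\pi/m_{ij})$ if $m_{ij}<\infty$ and $B(e_i,e_j)=-1$ if $m_{ij}=\infty$. The geometric representation $\rho:W\to\mathrm{GL}(V)$ is given by $\rho(s_i)(v)=v-2B(e_i,v)e_i$. A Coxeter element $c\in W$ is a product of all generators $s_1,\dots,s_N$, each appearing exactly once, in some order; its image $C=\rho(c)$ is a Coxeter transformation. When the Coxeter diagram is a tree, all Coxeter elements are conjugate in $W$, so the spectral radius of $C$ (the maximum of the absolute values of its complex eigenvalues) does not depend on the chosen order. *)

theory Defs
  imports
    "HOL-Analysis.Analysis"
    "HOL-Algebra.Bij"
    "HOL-Algebra.Elementary_Groups"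
    "Jordan_Normal_Form.Spectral_Radius"
begin

no_notation Matrix.vec_index (infixl "$" 100)

section \<open>Growth rate with respect to a generating set\<close>

text \<open>
  Word length over the letters \<open>S\<close>, without formal inverses. This is the usual word length when
  \<open>S\<close> consists of involutions, as for Coxeter systems; it is only meaningful for elements that
  are products of letters from \<open>S\<close>.
\<close>

definition word_length :: "('a, 'b) monoid_scheme \<Rightarrow> 'a set \<Rightarrow> 'a \<Rightarrow> nat" where
  "word_length G S g =
     (LEAST n. \<exists>ws. length ws = n \<and> set ws \<subseteq> S \<and> foldr (mult G) ws (one G) = g)"

definition sphere_size :: "('a, 'b) monoid_scheme \<Rightarrow> 'a set \<Rightarrow> nat \<Rightarrow> nat" where
  "sphere_size G S m = card {g \<in> carrier G. word_length G S g = m}"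

definition growth_rate :: "('a, 'b) monoid_scheme \<Rightarrow> 'a set \<Rightarrow> ereal" where
  "growth_rate G S = limsup (\<lambda>m. ereal (root m (real (sphere_size G S m))))"

section \<open>Polygons in the hyperbolic plane and their reflection groups\<close>

text \<open>
  The hyperboloid model: \<open>\<bbbH>\<^sup>2\<close> is the upper sheet of \<open>\<langle>x, x\<rangle> = -1\<close> in Minkowski space
  \<open>\<real>\<^sup>2\<^sup>,\<^sup>1\<close>. The lines of \<open>\<bbbH>\<^sup>2\<close> are the sets \<open>{x \<in> \<bbbH>\<^sup>2. \<langle>x, e\<rangle> = 0}\<close> with
  \<open>\<langle>e, e\<rangle> = 1\<close>; the normal \<open>e\<close> of a line is unique up to sign.
\<close>

definition lorentz :: "real ^ 3 \<Rightarrow> real ^ 3 \<Rightarrow> real" where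
  "lorentz x y = x $ 1 * y $ 1 + x $ 2 * y $ 2 - x $ 3 * y $ 3"

definition hyp_plane :: "(real ^ 3) set" where
  "hyp_plane = {x. lorentz x x = -1 \<and> x $ 3 > 0}"

definition line_normal :: "real ^ 3 \<Rightarrow> real ^ 3 \<Rightarrow> real ^ 3 \<Rightarrow> bool" where
  "line_normal a b e \<longleftrightarrow> lorentz e e = 1 \<and> lorentz a e = 0 \<and> lorentz b e = 0"

definition hyp_reflection :: "real ^ 3 \<Rightarrow> real ^ 3 \<Rightarrow> real ^ 3" where
  "hyp_reflection e = (\<lambda>x\<in>hyp_plane. x - (2 * lorentz x e) *\<^sub>R e)"

text \<open>
  The tangent space at \<open>a \<in> \<bbbH>\<^sup>2\<close> is the Euclidean plane orthogonal to \<open>a\<close>. The geodesic from \<open>a\<close>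
  to \<open>b\<close> leaves \<open>a\<close> in the direction of the projection of \<open>b\<close> to this plane.
\<close>

definition direction :: "real ^ 3 \<Rightarrow> real ^ 3 \<Rightarrow> real ^ 3" where
  "direction a b = b + lorentz a b *\<^sub>R a"

definition hyp_angle :: "real ^ 3 \<Rightarrow> real ^ 3 \<Rightarrow> real ^ 3 \<Rightarrow> real" where
  "hyp_angle b a c =
     arccos (lorentz (direction a b) (direction a c) /
       (sqrt (lorentz (direction a b) (direction a b)) *
        sqrt (lorentz (direction a c) (direction a c))))"

text \<open>
  A compact convex \<open>k\<close>-gon is given by the cyclic sequence of its vertices; the polygon itself is
  their convex hull. The condition says that each segment from \<open>v i\<close> to the next vertex is a side:
  all other vertices lie strictly on one side of the line through these two points.
\<close>

definition convex_polygon :: "nat \<Rightarrow> (nat \<Rightarrow> real ^ 3) \<Rightarrow> bool" where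
  "convex_polygon k v \<longleftrightarrow>
     3 \<le> k \<and> (\<forall>i<k. v i \<in> hyp_plane) \<and>
     (\<forall>i<k. \<exists>e. line_normal (v i) (v (Suc i mod k)) e \<and>
        (\<forall>j<k. j \<noteq> i \<longrightarrow> j \<noteq> Suc i mod k \<longrightarrow> lorentz (v j) e < 0))"

definition coxeter_polygon :: "nat \<Rightarrow> (nat \<Rightarrow> nat) \<Rightarrow> (nat \<Rightarrow> real ^ 3) \<Rightarrow> bool" where
  "coxeter_polygon k p v \<longleftrightarrow>
     convex_polygon k v \<and>
     (\<forall>i<k. hyp_angle (v ((i + k - 1) mod k)) (v i) (v (Suc i mod k)) = pi / real (p i))"

definition side_reflections :: "nat \<Rightarrow> (nat \<Rightarrow> real ^ 3) \<Rightarrow> (real ^ 3 \<Rightarrow> real ^ 3) set" where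
  "side_reflections k v =
     {hyp_reflection e | e i. i < k \<and> line_normal (v i) (v (Suc i mod k)) e}"

definition polygon_group :: "nat \<Rightarrow> (nat \<Rightarrow> real ^ 3) \<Rightarrow> (real ^ 3 \<Rightarrow> real ^ 3) monoid" where
  "polygon_group k v = subgroup_generated (BijGroup hyp_plane) (side_reflections k v)"

section \<open>Coxeter transformations\<close>

text \<open>A Coxeter matrix is a function \<open>m\<close> on pairs of generators, where \<open>m s t = 0\<close> encodes \<open>\<infinity>\<close>.\<close>

definition coxeter_form :: "('s \<Rightarrow> 's \<Rightarrow> nat) \<Rightarrow> 's \<Rightarrow> 's \<Rightarrow> real" where
  "coxeter_form m s t = (if m s t = 0 then -1 else - cos (pi / real (m s t)))"

text \<open>
  Let \<open>ss\<close> enumerate the generators without repetition. \<open>geometric_reflection m ss i\<close> is the matrix,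
  in the basis \<open>e\<^bsub>ss ! 0\<^esub>, e\<^bsub>ss ! 1\<^esub>, \<dots>\<close>, of \<open>v \<mapsto> v - 2 B(e\<^sub>s, v) e\<^sub>s\<close> for \<open>s = ss ! i\<close>.
  \<open>coxeter_transformation m ss\<close> is the product of these reflections in the order of \<open>ss\<close>. So the
  choice of \<open>ss\<close> is the choice of the Coxeter element; that it also orders the basis only changes the
  matrix by conjugation.
\<close>

definition geometric_reflection :: "('s \<Rightarrow> 's \<Rightarrow> nat) \<Rightarrow> 's list \<Rightarrow> nat \<Rightarrow> real mat" where
  "geometric_reflection m ss i =
     mat (length ss) (length ss) (\<lambda>(r, c).
       (if r = c then 1 else 0) -
       (if r = i then 2 * coxeter_form m (ss ! i) (ss ! c) else 0))"

definition coxeter_transformation :: "('s \<Rightarrow> 's \<Rightarrow> nat) \<Rightarrow> 's list \<Rightarrow> real mat" where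
  "coxeter_transformation m ss =
     foldr (\<lambda>i A. geometric_reflection m ss i * A) [0..<length ss] (1\<^sub>m (length ss))"

definition simply_laced :: "'s set set \<Rightarrow> 's \<Rightarrow> 's \<Rightarrow> nat" where
  "simply_laced E s t = (if s = t then 1 else if {s, t} \<in> E then 3 else 2)"

text \<open>\<open>Arm i j\<close> is the vertex at distance \<open>j + 1\<close> from the centre on the \<open>i\<close>-th path.\<close>

datatype star_vertex = Center | Arm nat nat

definition star_vertices :: "nat \<Rightarrow> (nat \<Rightarrow> nat) \<Rightarrow> star_vertex set" where
  "star_vertices k p = insert Center {Arm i j | i j. i < k \<and> j + 1 < p i}"

definition star_edges :: "nat \<Rightarrow> (nat \<Rightarrow> nat) \<Rightarrow> star_vertex set set" where
  "star_edges k p =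
     {{Center, Arm i 0} | i. i < k \<and> 1 < p i} \<union>
     {{Arm i j, Arm i (j + 1)} | i j. i < k \<and> j + 2 < p i}"

end

theory Submission
  imports Defs "HOL-Complex_Analysis.Complex_Analysis"
begin

text \<open>
  Let \<open>[n] = 1 + t + \<dots> + t\<^bsup>n-1\<^esup>\<close> and \<open>d(t) = 1 + t - k t + \<Sum>\<^sub>i t\<^bsup>p i\<^esup> / [p i]\<close>. Both sides of the theorem
  are \<open>1 / R\<close>, where \<open>R\<close> is the smallest zero of \<open>d\<close> in \<open>(0, 1)\<close>.

  Growth rate: the reflections in the sides act on the signs of the chambers with respect to the sides as
  in a Coxeter group, and Tits' lemma shows that a chamber lies beyond the \<open>i\<close>-th wall iff multiplication by
  the \<open>i\<close>-th reflection shortens it. Walls of nonadjacent sides do not meet since the angles are acute, so a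
  chamber lies beyond no wall, one wall or two adjacent walls. Inclusion and exclusion over these sets of
  descents gives \<open>A(t) d(t) = 1 + t\<close> for the growth series \<open>A\<close>, and by a Pringsheim argument the radius of
  convergence of \<open>A\<close> is \<open>R\<close>.

  Spectral radius: on a tree, the eigenvalues of a Coxeter transformation are the numbers \<open>s\<^sup>2\<close> such
  that \<open>s + 1 / s\<close> is an eigenvalue of the adjacency matrix. As the latter are real, eigenvalues that are not on
  the unit circle are positive reals. Solving the linear recursion along the arms of the star turns the
  eigenvalue equation for \<open>1 / t\<close> into \<open>d(t) = 0\<close>.
\<close>

no_notation fps_nth (infixl "$" 75)

section \<open>Alternating words in two reflections\<close>

text \<open>One arm per vertex is right because the same fraction arises twice. In the dihedral
  group of order \<open>2 p\<close> the elements with both descents contribute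
  \<open>t^p / ((1 + t) [p])\<close> to the growth series. On an arm with \<open>p - 1\<close>
  vertices the solution of the eigenvalue equation has the quotient \<open>s (t - t^p / [p])\<close>
  of its first entry by the value at the centre, where \<open>t = 1 / s^2\<close>. Summing over
  vertices or over arms gives the same \<open>d\<close>. On the polygon side the obstacle is that
  the group is given as a set of isometries and not by a presentation. The role of the geometric
  representation is taken by the vector of signed values \<open>sg i\<close>: it transforms
  linearly, its constants \<open>\<kappa>\<close> are cosines for adjacent sides and at least 1
  otherwise, and the braid relations hold as identities of maps. On the star side the obstacle is
  the arbitrary enumeration; it only orients the edges, and on a tree an orientation can be removed
  by rescaling.\<close>

primrec alt :: "(nat \<Rightarrow> 'a \<Rightarrow> 'a) \<Rightarrow> nat \<Rightarrow> nat \<Rightarrow> nat \<Rightarrow> 'a \<Rightarrow> 'a" where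
  "alt s 0 a b x = x"
| "alt s (Suc n) a b x = s a (alt s n b a x)"

text \<open>Chebyshev polynomials of the second kind with shifted index:
  \<open>chebU \<kappa> n\<close> is \<open>U_{n-1}(\<kappa>)\<close>, which for
  \<open>\<kappa> = cos \<theta>\<close> is \<open>sin (n \<theta>) / sin \<theta>\<close>. They are
  the coefficients in the action of alternating words.\<close>

fun chebU :: "real \<Rightarrow> nat \<Rightarrow> real" where
  "chebU \<kappa> 0 = 0"
| "chebU \<kappa> (Suc 0) = 1"
| "chebU \<kappa> (Suc (Suc n)) = 2 * \<kappa> * chebU \<kappa> (Suc n) - chebU \<kappa> n"

lemma chebU_cos: "chebU (cos \<theta>) n * sin \<theta> = sin (real n * \<theta>)"
proof (induction n rule: induct_nat_012)
  case (ge2 n)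
  have a: "sin (real (Suc (Suc n)) * \<theta>) = sin (real (Suc n) * \<theta> + \<theta>)"
    "sin (real n * \<theta>) = sin (real (Suc n) * \<theta> - \<theta>)"
    by (simp_all add: algebra_simps)
  have "sin (real (Suc (Suc n)) * \<theta>) = 2 * cos \<theta> * sin (real (Suc n) * \<theta>) - sin (real n * \<theta>)"
    unfolding a sin_add sin_diff by (simp add: algebra_simps)
  then show ?case using ge2 by (simp add: algebra_simps)
qed simp_all

lemma sin_pi_div_pos: "2 \<le> m \<Longrightarrow> 0 < sin (pi / real m)"
  by (rule sin_gt_zero) (auto simp: field_simps)

lemma chebU_cos_pi_pos:
  assumes "2 \<le> m" "0 < n" "n < m"
  shows "0 < chebU (cos (pi / real m)) n"
proof -
  have "0 < sin (real n * (pi / real m))"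
    using assms by (intro sin_gt_zero) (auto simp: field_simps)
  then show ?thesis
    using sin_pi_div_pos[OF assms(1)] chebU_cos[of "pi / real m" n] by (metis zero_less_mult_pos2)
qed

text \<open>The values 1, 0, -1 at \<open>m - 1\<close>, \<open>m\<close>, \<open>m + 1\<close> are
  what makes the two alternating words of length \<open>m\<close> agree in
  \<open>mirror_braid\<close>.\<close>

lemma chebU_cos_pi_self:
  assumes "2 \<le> m"
  shows "chebU (cos (pi / real m)) m = 0"
  using chebU_cos[of "pi / real m" m] sin_pi_div_pos[OF assms] assms by simp

lemma chebU_cos_pi_Suc:
  assumes "2 \<le> m"
  shows "chebU (cos (pi / real m)) (Suc m) = -1"
proof -
  have "real (Suc m) * (pi / real m) = pi / real m + pi"
    using assms by (simp add: field_simps)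
  then show ?thesis
    using chebU_cos[of "pi / real m" "Suc m"] sin_pi_div_pos[OF assms]
    by (metis mult_minus1 mult_right_cancel order_less_irrefl sin_periodic_pi)
qed

lemma chebU_cos_pi_pred:
  assumes "2 \<le> m"
  shows "chebU (cos (pi / real m)) (m - 1) = 1"
proof -
  obtain n where n: "m = Suc n" using assms by (cases m) auto
  show ?thesis
    using chebU_cos_pi_self[OF assms] chebU_cos_pi_Suc[OF assms] unfolding n by simp
qed

text \<open>For walls that do not meet the increments never decrease, so the coefficients never
  change sign. This is the case of infinite order.\<close>

lemma chebU_ge_1:
  assumes "1 \<le> \<kappa>"
  shows "0 \<le> chebU \<kappa> n \<and> chebU \<kappa> n + 1 \<le> chebU \<kappa> (Suc n)"
proof (induction n)
  case (Suc n)
  have "1 * chebU \<kappa> (Suc n) \<le> \<kappa> * chebU \<kappa> (Suc n)"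
    using assms Suc by (intro mult_right_mono) auto
  moreover have "chebU \<kappa> (Suc (Suc n)) = 2 * (\<kappa> * chebU \<kappa> (Suc n)) - chebU \<kappa> n" by simp
  ultimately show ?case using Suc by linarith
qed simp

text \<open>Each reflection negates its own functional and adds a multiple of it to the other one,
  which is the Chebyshev recursion. The two words are treated together because the induction
  exchanges them. The set \<open>Y\<close> is abstract so that the formula serves both for the signs
  of chambers and for Lorentz products with normals.\<close>

lemma alt_form:
  assumes "\<And>y. y \<in> Y \<Longrightarrow> s i y \<in> Y" "\<And>y. y \<in> Y \<Longrightarrow> s j y \<in> Y"
    and "\<And>y. y \<in> Y \<Longrightarrow> f (s i y) = - f y" "\<And>y. y \<in> Y \<Longrightarrow> g (s j y) = - g y"
    and "\<And>y. y \<in> Y \<Longrightarrow> f (s j y) = f y + 2 * \<kappa> * g y"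
    and "\<And>y. y \<in> Y \<Longrightarrow> g (s i y) = g y + 2 * \<kappa> * f y"
    and "y \<in> Y"
  shows "alt s n i j y \<in> Y \<and> alt s n j i y \<in> Y \<and>
    f (alt s n j i y) = (if even n then chebU \<kappa> (Suc n) * f y + chebU \<kappa> n * g y
                         else chebU \<kappa> n * f y + chebU \<kappa> (Suc n) * g y) \<and>
    g (alt s n i j y) = (if even n then chebU \<kappa> (Suc n) * g y + chebU \<kappa> n * f y
                         else chebU \<kappa> n * g y + chebU \<kappa> (Suc n) * f y)"
proof (induction n rule: induct_nat_012)
  case (ge2 n)
  then show ?case using assms by (auto simp: algebra_simps)
qed (use assms in auto)

section \<open>Groups generated by mirrors\<close>

text \<open>The elements of \<open>X\<close> are the chambers, \<open>sg i x < 0\<close> says that the chamber \<open>x\<close> lies on the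
  same side of the \<open>i\<close>-th wall of the base chamber as the base chamber itself. As in Coxeter matrices,
  \<open>m i j = 0\<close> encodes \<open>\<infinity>\<close>.\<close>

locale mirror_system =
  fixes k :: nat and s :: "nat \<Rightarrow> 'a \<Rightarrow> 'a" and base :: 'a and X :: "'a set"
    and sg :: "nat \<Rightarrow> 'a \<Rightarrow> real" and \<kappa> :: "nat \<Rightarrow> nat \<Rightarrow> real" and m :: "nat \<Rightarrow> nat \<Rightarrow> nat"
  assumes base_in: "base \<in> X"
    and s_in: "\<lbrakk>x \<in> X; i < k\<rbrakk> \<Longrightarrow> s i x \<in> X"
    and reach: "x \<in> X \<Longrightarrow> \<exists>ws. set ws \<subseteq> {..<k} \<and> foldr s ws base = x"
    and s_s: "\<lbrakk>x \<in> X; i < k\<rbrakk> \<Longrightarrow> s i (s i x) = x"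
    and sg_base: "i < k \<Longrightarrow> sg i base < 0"
    and sg_s_same: "\<lbrakk>x \<in> X; i < k\<rbrakk> \<Longrightarrow> sg i (s i x) = - sg i x"
    and sg_s: "\<lbrakk>x \<in> X; i < k; j < k; i \<noteq> j\<rbrakk> \<Longrightarrow> sg i (s j x) = sg i x + 2 * \<kappa> i j * sg j x"
    and \<kappa>_sym: "\<lbrakk>i < k; j < k\<rbrakk> \<Longrightarrow> \<kappa> i j = \<kappa> j i"
    and m_sym: "\<lbrakk>i < k; j < k\<rbrakk> \<Longrightarrow> m i j = m j i"
    and m_ge: "\<lbrakk>i < k; j < k; i \<noteq> j; m i j \<noteq> 0\<rbrakk> \<Longrightarrow> 2 \<le> m i j \<and> \<kappa> i j = cos (pi / real (m i j))"
    and m_0: "\<lbrakk>i < k; j < k; i \<noteq> j; m i j = 0\<rbrakk> \<Longrightarrow> 1 \<le> \<kappa> i j"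
    and braid: "\<lbrakk>x \<in> X; i < k; j < k; i \<noteq> j\<rbrakk> \<Longrightarrow> alt s (m i j) i j x = alt s (m i j) j i x"
begin

section \<open>Length of chambers and alternating words\<close>

definition L :: "'a \<Rightarrow> nat" where
  "L x = (LEAST n. \<exists>ws. length ws = n \<and> set ws \<subseteq> {..<k} \<and> foldr s ws base = x)"

lemma L_word:
  assumes "x \<in> X"
  obtains ws where "length ws = L x" "set ws \<subseteq> {..<k}" "foldr s ws base = x"
proof -
  have "\<exists>n ws. length ws = n \<and> set ws \<subseteq> {..<k} \<and> foldr s ws base = x"
    using reach[OF assms] by auto
  from LeastI_ex[OF this] show thesis using that unfolding L_def by blast
qed

lemma L_le: "set ws \<subseteq> {..<k} \<Longrightarrow> L (foldr s ws base) \<le> length ws"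
  unfolding L_def by (rule Least_le) auto

lemma foldr_in: "set ws \<subseteq> {..<k} \<Longrightarrow> foldr s ws base \<in> X"
  by (induction ws) (auto intro: base_in s_in)

lemma L_s_le:
  assumes "x \<in> X" "i < k"
  shows "L (s i x) \<le> Suc (L x)"
proof -
  obtain ws where "length ws = L x" "set ws \<subseteq> {..<k}" "foldr s ws base = x"
    using L_word[OF assms(1)] .
  then show ?thesis using L_le[of "i # ws"] assms by auto
qed

lemma L_le_s: "\<lbrakk>x \<in> X; i < k\<rbrakk> \<Longrightarrow> L x \<le> Suc (L (s i x))"
  using L_s_le[of "s i x" i] s_s s_in by auto

lemma L_0: "x \<in> X \<Longrightarrow> L x = 0 \<longleftrightarrow> x = base"
proof
  show "x \<in> X \<Longrightarrow> L x = 0 \<Longrightarrow> x = base" using L_word[of x] by auto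
  show "x = base \<Longrightarrow> L x = 0" using L_le[of "[]"] by simp
qed

lemma L_Suc:
  assumes "x \<in> X" "L x = Suc n"
  obtains i y where "i < k" "y \<in> X" "x = s i y" "L y = n"
proof -
  obtain ws where ws: "length ws = Suc n" "set ws \<subseteq> {..<k}" "foldr s ws base = x"
    using L_word[OF assms(1)] assms(2) by metis
  then obtain i vs where i: "ws = i # vs" by (cases ws) auto
  have "foldr s vs base \<in> X" using ws i foldr_in by auto
  moreover have "L (foldr s vs base) = n"
    using L_le[of vs] L_s_le[of "foldr s vs base" i] ws i assms(2) calculation by auto
  ultimately show thesis using that[of i "foldr s vs base"] ws i by auto
qed

lemma alt_in: "\<lbrakk>x \<in> X; i < k; j < k\<rbrakk> \<Longrightarrow> alt s n i j x \<in> X"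
  by (induction n arbitrary: i j) (auto intro: s_in)

lemma L_alt_le: "\<lbrakk>x \<in> X; i < k; j < k\<rbrakk> \<Longrightarrow> L (alt s n i j x) \<le> L x + n"
proof (induction n arbitrary: i j)
  case (Suc n)
  then have "L (alt s n j i x) \<le> L x + n" by blast
  then show ?case using L_s_le[OF alt_in[of x j i n], of i] Suc.prems by simp
qed simp

lemma s_alt: "\<lbrakk>x \<in> X; i < k; j < k\<rbrakk> \<Longrightarrow> s i (alt s (Suc n) i j x) = alt s n j i x"
  by (simp add: s_s alt_in)

text \<open>By \<open>alt_form\<close> the value is a combination of \<open>sg i x\<close> and
  \<open>sg j x\<close> whose coefficients are nonnegative and not both zero. The outermost letter
  is \<open>j\<close>, so wall \<open>i\<close> is not yet crossed even at
  \<open>n = m i j - 1\<close>, where the coefficients are 1 and 0.\<close>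

lemma sg_alt_neg:
  assumes x: "x \<in> X" and ij: "i < k" "j < k" "i \<noteq> j" and n: "m i j = 0 \<or> n < m i j"
    and neg: "sg i x < 0" "sg j x < 0"
  shows "sg i (alt s n j i x) < 0"
proof -
  let ?U = "chebU (\<kappa> i j)"
  have form: "sg i (alt s n j i x) = (if even n then ?U (Suc n) * sg i x + ?U n * sg j x
                         else ?U n * sg i x + ?U (Suc n) * sg j x)"
    using alt_form[of X s i j "sg i" "sg j" "\<kappa> i j" x n] x ij
    by (auto simp: s_in sg_s_same sg_s \<kappa>_sym)
  have U: "0 \<le> ?U n \<and> 0 \<le> ?U (Suc n) \<and> (0 < ?U n \<or> 0 < ?U (Suc n))"
  proof (cases "m i j = 0")
    case True
    then show ?thesis using m_0 ij chebU_ge_1[of "\<kappa> i j" n] by force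
  next
    case False
    then have m: "2 \<le> m i j" "\<kappa> i j = cos (pi / real (m i j))" using m_ge ij by auto
    have pos: "0 < ?U l" if "0 < l" "l < m i j" for l
      using chebU_cos_pi_pos[OF m(1) that] m(2) by simp
    have "?U (m i j) = 0" using chebU_cos_pi_self[OF m(1)] m(2) by simp
    then show ?thesis
      using pos[of n] pos[of "Suc n"] n m(1)
      by (cases "n = 0"; cases "Suc n = m i j") (auto intro: less_imp_le)
  qed
  have le: "a * b \<le> 0" if "0 \<le> a" "b < 0" for a b :: real
    using that by (simp add: mult_nonneg_nonpos)
  have lt: "a * b < 0" if "0 < a" "b < 0" for a b :: real
    using that by (simp add: mult_pos_neg)
  from U show ?thesis unfolding form
    using le[of "?U n" "sg i x"] le[of "?U n" "sg j x"] le[of "?U (Suc n)" "sg i x"]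
      le[of "?U (Suc n)" "sg j x"] lt[of "?U n" "sg i x"] lt[of "?U n" "sg j x"]
      lt[of "?U (Suc n)" "sg i x"] lt[of "?U (Suc n)" "sg j x"] neg by auto
qed

section \<open>The two statements of Tits' induction\<close>

definition wall_ok :: "nat \<Rightarrow> 'a \<Rightarrow> bool" where
  "wall_ok i x \<longleftrightarrow> sg i x < 0 \<or> sg i x > 0 \<and> Suc (L (s i x)) = L x"

definition dihedral_ok :: "nat \<Rightarrow> nat \<Rightarrow> 'a \<Rightarrow> bool" where
  "dihedral_ok i j x \<longleftrightarrow> (\<exists>n a b y. y \<in> X \<and> (a, b) \<in> {(i, j), (j, i)} \<and> x = alt s n a b y \<and>
     sg i y < 0 \<and> sg j y < 0 \<and> L x = L y + n \<and> (m i j = 0 \<or> n \<le> m i j))"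

lemma dihedral_ok_sym: "\<lbrakk>i < k; j < k\<rbrakk> \<Longrightarrow> dihedral_ok i j x \<longleftrightarrow> dihedral_ok j i x"
  unfolding dihedral_ok_def using m_sym[of i j] by (auto; metis)

text \<open>The longest dihedral word can be made to begin with either letter, so either letter
  cancels against it.\<close>

lemma alt_m_swap:
  assumes "x \<in> X" "i < k" "j < k" "i \<noteq> j" "m i j \<noteq> 0"
  shows "s i (alt s (m i j) j i x) = alt s (m i j - 1) j i x"
proof -
  obtain n where "m i j = Suc n" using assms(5) by (cases "m i j") auto
  then show ?thesis using braid[OF assms(1-4)] s_alt[OF assms(1-3), of n] by (metis diff_Suc_1)
qed

text \<open>Decompose \<open>x'\<close> along \<open>i\<close> and \<open>j\<close>. The letter
  \<open>j\<close> must prolong the alternating word, since a cancellation would contradict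
  \<open>L x = Suc (L x')\<close>. A word that is still shorter than \<open>m i j\<close> leaves
  wall \<open>i\<close> uncrossed; one of length exactly \<open>m i j\<close> can be rewritten to
  begin with \<open>i\<close>, so \<open>s i\<close> shortens it.\<close>

lemma wall_step:
  assumes x: "x' \<in> X" and ij: "i < k" "j < k" and x': "x = s j x'" and L: "L x = Suc (L x')"
    and IH: "wall_ok i x'" "i \<noteq> j \<Longrightarrow> dihedral_ok i j x'"
  shows "wall_ok i x"
proof (cases "i = j")
  case True
  have "s i x = x'" using x' x ij True s_s by auto
  moreover have "sg i x = - sg i x'" using x' x ij True sg_s_same by auto
  ultimately show ?thesis using IH(1) L x' True unfolding wall_ok_def by auto
next
  case False
  obtain n a b y where y: "y \<in> X" "(a, b) \<in> {(i, j), (j, i)}" "x' = alt s n a b y"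
     "sg i y < 0" "sg j y < 0" "L x' = L y + n" "m i j = 0 \<or> n \<le> m i j"
    using IH(2)[OF False] unfolding dihedral_ok_def by blast
  show ?thesis
  proof (cases "a = i \<or> n = 0")
    case True
    then have x'': "x' = alt s n i j y" using y False by auto
    have x1: "x = alt s (Suc n) j i y" using x'' x' by simp
    consider "n = m i j" "m i j \<noteq> 0" | "Suc n = m i j" "m i j \<noteq> 0" | "m i j = 0 \<or> Suc n < m i j"
      using y(7) by linarith
    then show ?thesis
    proof cases
      case 1
      have "x = alt s (m i j - 1) i j y"
        using alt_m_swap[OF y(1) ij(2,1)] False 1 x' x'' m_sym[OF ij] by auto
      then have "L x \<le> L y + (m i j - 1)" using L_alt_le[OF y(1) ij] by simp
      then show ?thesis using L y(6) 1 by auto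
    next
      case 2
      have e: "x = alt s (Suc n) i j y" using x1 2 braid[OF y(1) ij False] by simp
      have "sg i (alt s n j i y) < 0" using sg_alt_neg[OF y(1) ij False _ y(4,5)] 2 by auto
      then have pos: "sg i x > 0" using e sg_s_same[OF alt_in[OF y(1) ij(2,1)] ij(1)] by simp
      have sx: "s i x = alt s n j i y" using e s_alt[OF y(1) ij] by simp
      have "L (s i x) \<le> L y + n" using sx L_alt_le[OF y(1) ij(2,1)] by simp
      moreover have "L x \<le> Suc (L (s i x))" using L_le_s[OF _ ij(1)] x x' ij s_in by auto
      ultimately show ?thesis using pos L y(6) unfolding wall_ok_def by auto
    next
      case 3
      have "sg i x < 0" using sg_alt_neg[OF y(1) ij False 3 y(4,5)] x1 by simp
      then show ?thesis unfolding wall_ok_def by simp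
    qed
  next
    case no: False
    then obtain n' where n': "n = Suc n'" "a = j" "b = i" using y(2) by (cases n) auto
    have "x = alt s n' i j y" using x' y(3) n' s_alt[OF y(1) ij(2,1)] by simp
    then have "L x \<le> L y + n'" using L_alt_le[OF y(1) ij] by simp
    then show ?thesis using L y(6) n' by simp
  qed
qed

text \<open>The decomposition of \<open>s i x\<close> is prolonged by the letter \<open>i\<close>.
  Neither a cancellation nor a word longer than \<open>m i j\<close> is possible, as both would make
  \<open>x\<close> shorter than it is.\<close>

lemma dihedral_step:
  assumes x: "x \<in> X" and ij: "i < k" "j < k" "i \<noteq> j" and w: "sg i x > 0" "Suc (L (s i x)) = L x"
    and IH: "dihedral_ok i j (s i x)"
  shows "dihedral_ok i j x"
proof -
  obtain n a b y where y: "y \<in> X" "(a, b) \<in> {(i, j), (j, i)}" "s i x = alt s n a b y"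
     "sg i y < 0" "sg j y < 0" "L (s i x) = L y + n" "m i j = 0 \<or> n \<le> m i j"
    using IH unfolding dihedral_ok_def by blast
  have xs: "x = s i (alt s n a b y)" using y(3) s_s[OF x ij(1)] by simp
  show ?thesis
  proof (cases "a = j \<or> n = 0")
    case True
    then have xs: "x = alt s (Suc n) i j y" "s i x = alt s n j i y" using xs y ij by auto
    have "n \<noteq> m i j" if "m i j \<noteq> 0"
    proof
      assume n: "n = m i j"
      then have "x = alt s (m i j - 1) j i y" using alt_m_swap[OF y(1) ij that] xs by simp
      then have "L x \<le> L y + (m i j - 1)" using L_alt_le[OF y(1) ij(2,1)] by simp
      then show False using w y(6) n by simp
    qed
    then have "m i j = 0 \<or> Suc n \<le> m i j" using y(7) by linarith
    moreover have "L x = L y + Suc n" using w y(6) by simp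
    ultimately show ?thesis using xs y(1,4,5) unfolding dihedral_ok_def by blast
  next
    case False
    then obtain n' where n': "n = Suc n'" "a = i" "b = j" using y(2) by (cases n) auto
    have "x = alt s n' j i y" using xs n' s_alt[OF y(1) ij(1,2)] by simp
    then have "L x \<le> L y + n'" using L_alt_le[OF y(1) ij(2,1)] by simp
    then show ?thesis using w y(6) n' by simp
  qed
qed

text \<open>Tits' lemma. The two properties of all elements of length \<open>n\<close> imply the first one for length \<open>n + 1\<close>,
  which together with the second one for length \<open>n\<close> implies the second one for length \<open>n + 1\<close>.\<close>

lemma tits:
  "x \<in> X \<Longrightarrow> L x = n \<Longrightarrow> (\<forall>i<k. wall_ok i x) \<and> (\<forall>i<k. \<forall>j<k. i \<noteq> j \<longrightarrow> dihedral_ok i j x)"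
proof (induction n arbitrary: x)
  case 0
  then have x: "x = base" using L_0 by simp
  have "dihedral_ok i j base" if "i < k" "j < k" for i j
    unfolding dihedral_ok_def
    by (rule exI[of _ 0], rule exI[of _ i], rule exI[of _ j], rule exI[of _ base])
      (use that base_in sg_base in auto)
  then show ?case using x sg_base by (auto simp: wall_ok_def)
next
  case (Suc n)
  obtain j y where y: "j < k" "y \<in> X" "x = s j y" "L y = n" using L_Suc Suc.prems by metis
  have P: "wall_ok i x" if "i < k" for i
    by (rule wall_step[OF y(2) that y(1,3)]) (use Suc y that in auto)
  have Q: "dihedral_ok i j x" if pos: "sg i x > 0" and ij: "i < k" "j < k" "i \<noteq> j" for i j
  proof -
    have L: "Suc (L (s i x)) = L x" using P[OF ij(1)] pos unfolding wall_ok_def by auto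
    have "dihedral_ok i j (s i x)" using Suc.IH[of "s i x"] s_in[OF Suc.prems(1) ij(1)] L Suc.prems ij by auto
    then show ?thesis using dihedral_step[OF Suc.prems(1) ij pos L] by blast
  qed
  have "dihedral_ok i j x" if ij: "i < k" "j < k" "i \<noteq> j" for i j
  proof (cases "sg i x > 0 \<or> sg j x > 0")
    case True
    then show ?thesis using Q[of i j] Q[of j i] ij dihedral_ok_sym by auto
  next
    case False
    then have "sg i x < 0" "sg j x < 0" using P ij unfolding wall_ok_def by auto
    then show ?thesis unfolding dihedral_ok_def using Suc.prems(1)
      by (intro exI[of _ 0] exI[of _ i] exI[of _ j] exI[of _ x]) auto
  qed
  then show ?case using P by blast
qed

text \<open>For a negative sign, \<open>wall_ok\<close> is applied to the reflected chamber
  \<open>s i x\<close>, whose sign is positive. In particular no sign is zero.\<close>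

lemma sg_cases:
  assumes "x \<in> X" "i < k"
  shows "sg i x < 0 \<and> L (s i x) = Suc (L x) \<or> sg i x > 0 \<and> L x = Suc (L (s i x))"
proof (cases "sg i x < 0")
  case True
  have "sg i (s i x) > 0" using True sg_s_same[OF assms] by simp
  then have "Suc (L (s i (s i x))) = L (s i x)"
    using tits[OF s_in[OF assms] refl] assms(2) unfolding wall_ok_def by force
  then show ?thesis using True s_s[OF assms] by simp
next
  case False
  then show ?thesis using tits[OF assms(1) refl] assms(2) unfolding wall_ok_def by force
qed

lemma dihedral_decomposition:
  assumes "x \<in> X" "i < k" "j < k" "i \<noteq> j"
  obtains n a b y where "y \<in> X" "(a, b) \<in> {(i, j), (j, i)}" "x = alt s n a b y"
     "sg i y < 0" "sg j y < 0" "L x = L y + n" "m i j = 0 \<or> n \<le> m i j"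
  using tits[OF assms(1) refl] assms unfolding dihedral_ok_def by metis

text \<open>The outermost letter of a shortest word for \<open>x\<close> is a descent.\<close>

lemma no_descent_base:
  assumes "x \<in> X"
  shows "(\<forall>i<k. sg i x < 0) \<longleftrightarrow> x = base"
proof
  assume a: "\<forall>i<k. sg i x < 0"
  show "x = base"
  proof (rule ccontr)
    assume "x \<noteq> base"
    then obtain n where "L x = Suc n" using L_0[OF assms] by (cases "L x") auto
    then obtain i y where y: "i < k" "y \<in> X" "x = s i y" "L y = n" using L_Suc[OF assms] by metis
    then have "L (s i x) = n" using s_s by simp
    then show False using sg_cases[OF assms y(1)] a y(1) \<open>L x = Suc n\<close> by auto
  qed
qed (use sg_base in auto)

end

section \<open>Generating series of sets of chambers\<close>

context mirror_system
begin

text \<open>The coefficients are complex because the radius of convergence is determined by complex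
  analysis later on.\<close>

definition series :: "('a \<Rightarrow> bool) \<Rightarrow> complex fps" where
  "series P = Abs_fps (\<lambda>n. of_nat (card {x \<in> X. L x = n \<and> P x}))"

lemma finite_level: "finite {x \<in> X. L x = n \<and> P x}"
proof (rule finite_subset)
  show "{x \<in> X. L x = n \<and> P x} \<subseteq> (\<lambda>ws. foldr s ws base) ` {ws. set ws \<subseteq> {..<k} \<and> length ws = n}"
  proof
    fix x assume "x \<in> {x \<in> X. L x = n \<and> P x}"
    then obtain ws where "length ws = n" "set ws \<subseteq> {..<k}" "foldr s ws base = x"
      using L_word by auto
    then show "x \<in> (\<lambda>ws. foldr s ws base) ` {ws. set ws \<subseteq> {..<k} \<and> length ws = n}" by auto
  qed
qed (simp add: finite_lists_length_eq)

lemma series_cong: "(\<And>x. x \<in> X \<Longrightarrow> P x = Q x) \<Longrightarrow> series P = series Q"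
  unfolding series_def by (rule arg_cong[of _ _ Abs_fps], rule ext) (metis (mono_tags, lifting))

lemma series_disj:
  assumes "\<And>x. x \<in> X \<Longrightarrow> \<not> (P x \<and> Q x)"
  shows "series (\<lambda>x. P x \<or> Q x) = series P + series Q"
proof (rule fps_ext)
  fix n
  have "{x \<in> X. L x = n \<and> (P x \<or> Q x)} = {x \<in> X. L x = n \<and> P x} \<union> {x \<in> X. L x = n \<and> Q x}" by auto
  moreover have "card ({x \<in> X. L x = n \<and> P x} \<union> {x \<in> X. L x = n \<and> Q x})
     = card {x \<in> X. L x = n \<and> P x} + card {x \<in> X. L x = n \<and> Q x}"
    using assms by (intro card_Un_disjoint finite_level) auto
  ultimately show "fps_nth (series (\<lambda>x. P x \<or> Q x)) n = fps_nth (series P + series Q) n"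
    unfolding series_def by simp
qed

lemma series_UN:
  assumes "finite I" "\<And>x i j. \<lbrakk>x \<in> X; i \<in> I; j \<in> I; P i x; P j x\<rbrakk> \<Longrightarrow> i = j"
  shows "series (\<lambda>x. \<exists>i\<in>I. P i x) = (\<Sum>i\<in>I. series (P i))"
  using assms
proof (induction I rule: finite_induct)
  case empty
  then show ?case by (simp add: series_def fps_eq_iff)
next
  case (insert a I)
  have "series (\<lambda>x. \<exists>i\<in>insert a I. P i x) = series (\<lambda>x. P a x \<or> (\<exists>i\<in>I. P i x))" by simp
  also have "\<dots> = series (P a) + series (\<lambda>x. \<exists>i\<in>I. P i x)"
  proof (rule series_disj)
    fix x assume "x \<in> X"
    then have "\<not> (P a x \<and> P i x)" if "i \<in> I" for i using insert(2) insert(4)[of x a i] that by auto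
    then show "\<not> (P a x \<and> (\<exists>i\<in>I. P i x))" by blast
  qed
  also have "series (\<lambda>x. \<exists>i\<in>I. P i x) = (\<Sum>i\<in>I. series (P i))"
    by (rule insert.IH) (rule insert(4); simp)
  finally show ?case using insert by simp
qed

lemma series_image:
  assumes "\<And>x. x \<in> X \<Longrightarrow> Q x \<Longrightarrow> f x \<in> X \<and> L (f x) = L x + l" "inj_on f X"
  shows "series (\<lambda>x. \<exists>y\<in>X. Q y \<and> x = f y) = fps_X ^ l * series Q"
proof (rule fps_ext)
  fix n
  have "{x \<in> X. L x = n \<and> (\<exists>y\<in>X. Q y \<and> x = f y)} =
    (if l \<le> n then f ` {x \<in> X. L x = n - l \<and> Q x} else {})"
    using assms(1) by auto
  moreover have "card (f ` {x \<in> X. L x = n - l \<and> Q x}) = card {x \<in> X. L x = n - l \<and> Q x}"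
    by (rule card_image) (use assms(2) in \<open>auto simp: inj_on_def\<close>)
  ultimately show "fps_nth (series (\<lambda>x. \<exists>y\<in>X. Q y \<and> x = f y)) n = fps_nth (fps_X ^ l * series Q) n"
    unfolding series_def by (auto simp: fps_X_power_mult_nth)
qed

text \<open>Reflection in wall \<open>i\<close> pairs the chambers on its two sides, and the lengths
  within a pair differ by one.\<close>

lemma series_descent:
  assumes i: "i < k"
  shows "series (\<lambda>x. sg i x > 0) * (1 + fps_X) = fps_X * series (\<lambda>_. True)"
proof -
  have "series (\<lambda>x. sg i x > 0) = series (\<lambda>x. \<exists>y\<in>X. sg i y < 0 \<and> x = s i y)"
  proof (rule series_cong)
    fix x assume x: "x \<in> X"
    show "sg i x > 0 \<longleftrightarrow> (\<exists>y\<in>X. sg i y < 0 \<and> x = s i y)"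
      using sg_s_same[OF x i] s_s[OF x i] s_in[OF x i] sg_s_same[OF _ i] i
      by (metis neg_0_less_iff_less neg_less_0_iff_less)
  qed
  also have "\<dots> = fps_X ^ 1 * series (\<lambda>x. sg i x < 0)"
  proof (rule series_image)
    show "s i x \<in> X \<and> L (s i x) = L x + 1" if "x \<in> X" "sg i x < 0" for x
      using that sg_cases[OF that(1) i] s_in[OF that(1) i] by auto
    show "inj_on (s i) X" using s_s i by (metis inj_onI)
  qed
  finally have 1: "series (\<lambda>x. sg i x > 0) = fps_X * series (\<lambda>x. sg i x < 0)" by simp
  have "series (\<lambda>_. True) = series (\<lambda>x. sg i x < 0 \<or> sg i x > 0)"
    by (rule series_cong) (use sg_cases i in blast)
  also have "\<dots> = series (\<lambda>x. sg i x < 0) + series (\<lambda>x. sg i x > 0)"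
    by (rule series_disj) auto
  finally show ?thesis using 1 by (simp add: algebra_simps)
qed

context
  fixes i j assumes ij: "i < k" "j < k" "i \<noteq> j" "m i j \<noteq> 0"
begin

text \<open>As long as the word is at most \<open>m i j\<close> letters long, each new letter meets
  its wall from the negative side and so increases the length.\<close>

lemma L_alt:
  assumes "y \<in> X" "sg i y < 0" "sg j y < 0" "l \<le> m i j"
  shows "L (alt s l i j y) = L y + l \<and> L (alt s l j i y) = L y + l"
  using assms(4)
proof (induction l)
  case (Suc l)
  have "sg i (alt s l j i y) < 0"
    using sg_alt_neg[OF assms(1) ij(1-3) _ assms(2,3), of l] Suc by auto
  moreover have "sg j (alt s l i j y) < 0"
    using sg_alt_neg[OF assms(1) ij(2,1) _ _ assms(3,2), of l] Suc ij m_sym[OF ij(1,2)] by auto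
  ultimately show ?case using sg_cases[OF alt_in] Suc ij assms(1)
    by (metis Suc_leD add_Suc_right alt.simps(2) order_less_asym)
qed simp

lemma sg_alt_pos:
  assumes "y \<in> X" "sg i y < 0" "sg j y < 0" "0 < l" "l \<le> m i j"
  shows "sg i (alt s l i j y) > 0"
proof -
  obtain n where n: "l = Suc n" using assms by (cases l) auto
  have "sg i (alt s n j i y) < 0"
    using sg_alt_neg[OF assms(1) ij(1-3) _ assms(2,3), of n] assms n by auto
  then show ?thesis using sg_s_same[OF alt_in] ij assms(1) n by auto
qed

end

text \<open>Which letter follows the first \<open>l\<close> ones depends on the parity of
  \<open>l\<close>; the existential quantifier hides this.\<close>

lemma alt_add: "\<exists>a b. (a, b) \<in> {(i, j), (j, i)} \<and> alt s (l + r) i j y = alt s l i j (alt s r a b y)"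
proof (induction l arbitrary: i j)
  case (Suc l)
  obtain a b where "(a, b) \<in> {(j, i), (i, j)}" "alt s (l + r) j i y = alt s l j i (alt s r a b y)"
    using Suc[of j i] by blast
  then show ?case by (intro exI[of _ a] exI[of _ b]) auto
qed auto

lemma inj_alt: "\<lbrakk>i < k; j < k\<rbrakk> \<Longrightarrow> inj_on (alt s l i j) X"
proof (induction l arbitrary: i j)
  case (Suc l)
  show ?case
  proof (rule inj_onI)
    fix x y assume a: "x \<in> X" "y \<in> X" "alt s (Suc l) i j x = alt s (Suc l) i j y"
    then have "alt s l j i x = alt s l j i y" using s_alt Suc.prems by metis
    then show "x = y" using Suc.IH[of j i] Suc.prems a by (auto dest: inj_onD)
  qed
qed (simp add: inj_on_def)

text \<open>Cancelling the common first \<open>l\<close> letters exhibits \<open>y\<close> as an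
  alternating word of length \<open>r\<close> applied to \<open>z\<close>. If \<open>r\<close> were
  positive, its first letter would be a descent of \<open>y\<close>.\<close>

lemma alt_unique_aux:
  assumes ij: "i < k" "j < k" "i \<noteq> j" "m i j \<noteq> 0"
    and y: "y \<in> X" "sg i y < 0" "sg j y < 0" and z: "z \<in> X" "sg i z < 0" "sg j z < 0"
    and l: "l + r \<le> m i j" and eq: "alt s l i j y = alt s (l + r) i j z"
  shows "r = 0"
proof (rule ccontr)
  assume r: "r \<noteq> 0"
  obtain a b where ab: "(a, b) \<in> {(i, j), (j, i)}" "alt s (l + r) i j z = alt s l i j (alt s r a b z)"
    using alt_add by metis
  have "alt s r a b z \<in> X" using ab z ij alt_in by auto
  then have "y = alt s r a b z" using inj_alt[OF ij(1,2), of l] eq y ab by (auto dest: inj_onD)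
  moreover have "sg a (alt s r a b z) > 0"
    using sg_alt_pos[OF ij z, of r] sg_alt_pos[OF ij(2,1) _ _ z(1,3,2), of r] ab ij r l m_sym[OF ij(1,2)] by auto
  ultimately show False using ab y by auto
qed

lemma alt_unique:
  assumes ij: "i < k" "j < k" "i \<noteq> j" "m i j \<noteq> 0"
    and y: "y \<in> X" "sg i y < 0" "sg j y < 0" and z: "z \<in> X" "sg i z < 0" "sg j z < 0"
    and l: "l \<le> m i j" "l' \<le> m i j" and eq: "alt s l i j y = alt s l' i j z"
  shows "l = l'"
  using alt_unique_aux[OF ij y z, of l "l' - l"] alt_unique_aux[OF ij z y, of l' "l - l'"] l eq
  by (cases "l \<le> l'") auto

text \<open>Every element is obtained from a unique element without descents \<open>i\<close>, \<open>j\<close> by a unique element of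
  the dihedral group generated by \<open>s i\<close> and \<open>s j\<close>; it has both descents iff the latter is the longest one.\<close>

lemma series_dihedral:
  assumes ij: "i < k" "j < k" "i \<noteq> j" "m i j \<noteq> 0"
  shows "series (\<lambda>x. sg i x > 0 \<and> sg j x > 0) * ((1 + fps_X) * (\<Sum>l<m i j. fps_X ^ l)) =
    fps_X ^ m i j * series (\<lambda>_. True)"
proof -
  let ?M = "m i j" and ?N = "\<lambda>y. sg i y < 0 \<and> sg j y < 0"
  define T where "T = (\<lambda>l i j x. \<exists>y\<in>X. ?N y \<and> x = alt s l i j y)"
  have M: "2 \<le> ?M" using m_ge ij by blast
  have ji: "j < k" "i < k" "j \<noteq> i" "m j i \<noteq> 0" and mji: "m j i = ?M" using ij m_sym[of i j] by auto
  have pos1: "sg i x > 0" if "T l i j x" "0 < l" "l \<le> ?M" for l x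
    using that sg_alt_pos[OF ij] unfolding T_def by auto
  have pos2: "sg j x > 0" if "T l j i x" "0 < l" "l \<le> ?M" for l x
    using that sg_alt_pos[OF ji] mji unfolding T_def by auto
  have neg1: "sg j x < 0" if "T l i j x" "l < ?M" for l x
    using that sg_alt_neg[OF _ ji(1-3), of _ l] mji unfolding T_def by auto
  have neg2: "sg i x < 0" if "T l j i x" "l < ?M" for l x
    using that sg_alt_neg[OF _ ij(1-3), of _ l] unfolding T_def by auto
  have TM: "T ?M i j x \<longleftrightarrow> T ?M j i x" for x
    unfolding T_def using braid[OF _ ij(1-3)] by auto
  \<comment> \<open>The words of lengths 0 and \<open>?M\<close> coincide for both orders of the
    letters, so these lengths are listed only for the words that begin with
    \<open>i\<close>.\<close>
  have cover: "(\<exists>l\<in>{..?M}. T l i j x) \<or> (\<exists>l\<in>{1..<?M}. T l j i x)" if x: "x \<in> X" for x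
  proof -
    obtain n a b y where y: "y \<in> X" "(a, b) \<in> {(i, j), (j, i)}" "x = alt s n a b y"
     "sg i y < 0" "sg j y < 0" "L x = L y + n" "m i j = 0 \<or> n \<le> m i j"
      using dihedral_decomposition[OF x ij(1-3)] .
    have n: "n \<le> ?M" using y(7) M by auto
    have T: "T n a b x" unfolding T_def using y by auto
    show ?thesis
    proof (cases "(a, b) = (i, j)")
      case True
      then show ?thesis using T n by auto
    next
      case False
      then have ab: "a = j" "b = i" using y(2) by auto
      consider "n = 0" | "n = ?M" | "n \<in> {1..<?M}" using n by fastforce
      then show ?thesis
      proof cases
        case 1
        then have "T 0 i j x" using T unfolding T_def by simp
        then show ?thesis by blast
      next
        case 2
        then show ?thesis using T TM ab by auto
      qed (use T ab in auto)
    qed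
  qed
  have serT: "series (T l a b) = fps_X ^ l * series ?N" if "l \<le> ?M" "(a, b) \<in> {(i, j), (j, i)}" for l a b
    unfolding T_def
  proof (rule series_image)
    show "alt s l a b x \<in> X \<and> L (alt s l a b x) = L x + l" if "x \<in> X" "?N x" for x
      using that \<open>l \<le> ?M\<close> \<open>(a, b) \<in> _\<close> alt_in ij L_alt[OF ij that(1), of l] by auto
    show "inj_on (alt s l a b) X" using inj_alt that ij by auto
  qed
  have "series (\<lambda>_. True) = series (\<lambda>x. (\<exists>l\<in>{..?M}. T l i j x) \<or> (\<exists>l\<in>{1..<?M}. T l j i x))"
    by (rule series_cong) (use cover in blast)
  also have "\<dots> = series (\<lambda>x. \<exists>l\<in>{..?M}. T l i j x) + series (\<lambda>x. \<exists>l\<in>{1..<?M}. T l j i x)"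
  proof (rule series_disj)
    fix x assume "x \<in> X"
    have False if "l \<le> ?M" "T l i j x" "1 \<le> l'" "l' < ?M" "T l' j i x" for l l'
      using pos1[OF that(2)] neg1[OF that(2)] pos2[OF that(5)] neg2[OF that(5)] that
      by (cases "l = 0"; cases "l = ?M") auto
    then show "\<not> ((\<exists>l\<in>{..?M}. T l i j x) \<and> (\<exists>l\<in>{1..<?M}. T l j i x))" by auto
  qed
  also have "series (\<lambda>x. \<exists>l\<in>{..?M}. T l i j x) = (\<Sum>l\<in>{..?M}. series (T l i j))"
    by (rule series_UN) (use alt_unique[OF ij] in \<open>auto simp: T_def\<close>)
  also have "series (\<lambda>x. \<exists>l\<in>{1..<?M}. T l j i x) = (\<Sum>l\<in>{1..<?M}. series (T l j i))"
    by (rule series_UN) (use alt_unique[OF ji] mji in \<open>auto simp: T_def\<close>)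
  also have "(\<Sum>l\<in>{..?M}. series (T l i j)) = (\<Sum>l\<in>{..?M}. fps_X ^ l) * series ?N"
    unfolding sum_distrib_right by (rule sum.cong) (use serT in auto)
  also have "(\<Sum>l\<in>{1..<?M}. series (T l j i)) = (\<Sum>l\<in>{1..<?M}. fps_X ^ l) * series ?N"
    unfolding sum_distrib_right by (rule sum.cong) (use serT in auto)
  \<comment> \<open>This factor is the growth polynomial \<open>(1 + t) [m]\<close> of the dihedral
    group of order \<open>2 m\<close>.\<close>
  also have "(\<Sum>l\<in>{..?M}. fps_X ^ l) * series ?N + (\<Sum>l\<in>{1..<?M}. fps_X ^ l) * series ?N =
      (1 + fps_X) * (\<Sum>l<?M. fps_X ^ l) * series ?N"
  proof -
    have "(\<Sum>l\<in>{..?M}. fps_X ^ l) = (\<Sum>l<?M. fps_X ^ l :: complex fps) + fps_X ^ ?M"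
      by (simp add: lessThan_Suc_atMost[symmetric])
    moreover have "(\<Sum>l<?M. fps_X ^ l :: complex fps) = 1 + (\<Sum>l\<in>{1..<?M}. fps_X ^ l)"
      using M by (simp add: lessThan_atLeast0 sum.atLeast_Suc_lessThan)
    moreover have X: "fps_X * (\<Sum>l<?M. fps_X ^ l :: complex fps) = (\<Sum>l\<in>{1..<?M}. fps_X ^ l) + fps_X ^ ?M"
    proof -
      have "fps_X * (\<Sum>l<n. fps_X ^ l :: complex fps) = (\<Sum>l\<in>{1..<Suc n}. fps_X ^ l)" for n
        by (induction n) (simp_all add: distrib_left)
      then show ?thesis using M by simp
    qed
    ultimately show ?thesis unfolding ring_distribs X by (simp add: algebra_simps)
  qed
  finally have A: "series (\<lambda>_. True) = (1 + fps_X) * (\<Sum>l<?M. fps_X ^ l) * series ?N" .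
  have "series (\<lambda>x. sg i x > 0 \<and> sg j x > 0) = series (T ?M i j)"
  proof (rule series_cong)
    fix x assume x: "x \<in> X"
    show "sg i x > 0 \<and> sg j x > 0 \<longleftrightarrow> T ?M i j x"
    proof
      assume p: "sg i x > 0 \<and> sg j x > 0"
      from cover[OF x] show "T ?M i j x"
      proof
        assume "\<exists>l\<in>{..?M}. T l i j x"
        then obtain l where "l \<le> ?M" "T l i j x" by auto
        then show ?thesis using neg1[of l x] p by (cases "l = ?M") auto
      next
        assume "\<exists>l\<in>{1..<?M}. T l j i x"
        then show ?thesis using neg2 p by force
      qed
    next
      assume "T ?M i j x"
      then show "sg i x > 0 \<and> sg j x > 0" using pos1[of ?M x] pos2[of ?M x] TM M by auto
    qed
  qed
  also have "\<dots> = fps_X ^ ?M * series ?N" using serT by auto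
  finally show ?thesis using A by (simp add: ac_simps)
qed

end

section \<open>The growth series of a polygon group\<close>

text \<open>The number \<open>q i\<close> belongs to the vertex between the sides \<open>i\<close>
  and \<open>Suc i mod k\<close>. In a triangle any two sides are adjacent and
  \<open>walls_disjoint\<close> says nothing; there \<open>walls_triple\<close> excludes that all
  three are descents.\<close>

locale mirror_polygon = mirror_system +
  fixes q :: "nat \<Rightarrow> nat"
  assumes k3: "3 \<le> k"
    and q_ge: "i < k \<Longrightarrow> 2 \<le> q i"
    and m_eq: "m i j = (if j = Suc i mod k then q i else if i = Suc j mod k then q j else 0)"
    and walls_disjoint: "\<lbrakk>x \<in> X; i < k; j < k; i \<noteq> j; j \<noteq> Suc i mod k; i \<noteq> Suc j mod k\<rbrakk> \<Longrightarrow>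
       \<not> (sg i x > 0 \<and> sg j x > 0)"
    and walls_triple: "\<lbrakk>x \<in> X; i < k\<rbrakk> \<Longrightarrow>
       \<not> (sg i x > 0 \<and> sg (Suc i mod k) x > 0 \<and> sg (Suc (Suc i mod k) mod k) x > 0)"
begin

lemma Suc_mod_neq:
  assumes "i < k"
  shows "Suc i mod k \<noteq> i" "Suc (Suc i mod k) mod k \<noteq> i" "Suc i mod k < k"
  using assms k3 by (cases "Suc i = k"; cases "Suc (Suc i) = k"; auto)+

text \<open>An Euler characteristic: no descent gives 1, one descent gives \<open>1 - 1\<close>, two
  adjacent ones give \<open>1 - 2 + 1\<close>.\<close>

lemma descent_count:
  assumes x: "x \<in> X"
  shows "(if x = base then 1 else 0 :: complex) =
    1 - (\<Sum>i<k. if sg i x > 0 then 1 else 0) +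
        (\<Sum>i<k. if sg i x > 0 \<and> sg (Suc i mod k) x > 0 then 1 else 0)"
proof -
  let ?n = "\<lambda>i. Suc i mod k"
  define D where "D = {i. i < k \<and> sg i x > 0}"
  have fin: "finite D" unfolding D_def by simp
  have c1: "(\<Sum>i<k. if sg i x > 0 then 1 else 0 :: complex) = of_nat (card D)"
    unfolding D_def by (subst sum.inter_filter[symmetric]) (auto simp: lessThan_def)
  have c2: "(\<Sum>i<k. if sg i x > 0 \<and> sg (?n i) x > 0 then 1 else 0 :: complex) = of_nat (card {i\<in>D. ?n i \<in> D})"
    unfolding D_def using Suc_mod_neq
    by (subst sum.inter_filter[symmetric]) (auto simp: lessThan_def intro!: arg_cong[of _ _ card])
  show ?thesis
  proof (cases "D = {}")
    case True
    then have "\<forall>i<k. sg i x < 0" using sg_cases[OF x] unfolding D_def by auto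
    then have "x = base" using no_descent_base[OF x] by simp
    then show ?thesis using c1 c2 True by simp
  next
    case False
    then have nb: "x \<noteq> base" using sg_base unfolding D_def by force
    have adj: "i = j \<or> j = ?n i \<or> i = ?n j" if "i \<in> D" "j \<in> D" for i j
      using walls_disjoint[OF x, of i j] that unfolding D_def by auto
    have tri: "\<not> (i \<in> D \<and> ?n i \<in> D \<and> ?n (?n i) \<in> D)" for i
      using walls_triple[OF x, of i] unfolding D_def by auto
    have ne: "?n i \<noteq> i \<and> ?n (?n i) \<noteq> i" if "i \<in> D" for i
      using Suc_mod_neq that unfolding D_def by auto
    show ?thesis
    proof (cases "\<exists>a\<in>D. ?n a \<in> D")
      case True
      then obtain a where a: "a \<in> D" "?n a \<in> D" by auto
      \<comment> \<open>If \<open>a\<close> were the successor of \<open>b\<close>, then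
        \<open>b\<close>, \<open>a\<close> and \<open>?n a\<close> would be three consecutive
        descents.\<close>
      have "b = a \<or> b = ?n a" if b: "b \<in> D" for b
        using adj[OF a(1) b] tri[of b] a b by auto
      then have D: "D = {a, ?n a}" using a by auto
      moreover have "{i\<in>D. ?n i \<in> D} = {a}"
        using a tri[of a] unfolding D by auto
      ultimately show ?thesis using c1 c2 nb ne[OF a(1)] by simp
    next
      case no: False
      obtain a where a: "a \<in> D" using False by auto
      have "b = a" if "b \<in> D" for b using adj[OF a that] no a that by auto
      then have "D = {a}" using a by blast
      moreover have "{i\<in>D. ?n i \<in> D} = {}" using no by auto
      ultimately show ?thesis using c1 c2 nb by simp
    qed
  qed
qed

lemma series_card: "fps_nth (series P) n = (\<Sum>x\<in>{x\<in>X. L x = n}. if P x then 1 else 0)"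
proof -
  have "finite {x\<in>X. L x = n}" using finite_level[of n "\<lambda>_. True"] by simp
  then have "(\<Sum>x\<in>{x\<in>X. L x = n}. if P x then 1 else 0 :: complex) = of_nat (card {x \<in> {x\<in>X. L x = n}. P x})"
    by (subst sum.inter_filter[symmetric]) auto
  then show ?thesis unfolding series_def by (simp add: conj_assoc)
qed

lemma inclusion_exclusion:
  "1 = series (\<lambda>_. True) - (\<Sum>i<k. series (\<lambda>x. sg i x > 0)) +
     (\<Sum>i<k. series (\<lambda>x. sg i x > 0 \<and> sg (Suc i mod k) x > 0))"
proof (rule fps_ext)
  fix n
  let ?Ln = "{x\<in>X. L x = n}"
  have fin: "finite ?Ln" using finite_level[of n "\<lambda>_. True"] by simp
  have 1: "(\<Sum>x\<in>?Ln. if x = base then 1 else 0 :: complex) = (if n = 0 then 1 else 0)"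
    using L_0[OF base_in] base_in fin by (auto simp: sum.delta)
  have 2: "(\<Sum>x\<in>?Ln. if x = base then 1 else 0 :: complex) =
     (\<Sum>x\<in>?Ln. 1 - (\<Sum>i<k. if sg i x > 0 then 1 else 0) +
        (\<Sum>i<k. if sg i x > 0 \<and> sg (Suc i mod k) x > 0 then 1 else 0))"
    by (rule sum.cong[OF refl], rule descent_count) simp
  have 3: "\<dots> = (\<Sum>x\<in>?Ln. 1) - (\<Sum>i<k. \<Sum>x\<in>?Ln. if sg i x > 0 then 1 else 0) +
        (\<Sum>i<k. \<Sum>x\<in>?Ln. if sg i x > 0 \<and> sg (Suc i mod k) x > 0 then 1 else 0)"
    unfolding sum.distrib sum_subtractf by (simp only: sum.swap[where A = ?Ln and B = "{..<k}"])
  have 4: "\<dots> = fps_nth (series (\<lambda>_. True) - (\<Sum>i<k. series (\<lambda>x. sg i x > 0)) +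
     (\<Sum>i<k. series (\<lambda>x. sg i x > 0 \<and> sg (Suc i mod k) x > 0))) n"
    by (simp only: fps_add_nth fps_sub_nth fps_sum_nth series_card if_True)
  show "fps_nth 1 n = fps_nth (series (\<lambda>_. True) - (\<Sum>i<k. series (\<lambda>x. sg i x > 0)) +
     (\<Sum>i<k. series (\<lambda>x. sg i x > 0 \<and> sg (Suc i mod k) x > 0))) n"
    unfolding fps_one_nth by (rule trans[OF trans[OF trans[OF 1[symmetric] 2] 3] 4])
qed

text \<open>Multiplication by \<open>1 + fps_X\<close> turns every sum in
  \<open>inclusion_exclusion\<close> into a multiple of the full series, by
  \<open>series_descent\<close> and \<open>series_dihedral\<close>.\<close>

theorem growth_series:
  "series (\<lambda>_. True) * (1 + fps_X - of_nat k * fps_X +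
     (\<Sum>i<k. fps_X ^ q i * inverse (\<Sum>l<q i. fps_X ^ l))) = 1 + fps_X"
proof -
  let ?A = "series (\<lambda>_. True)"
  have D: "series (\<lambda>x. sg i x > 0 \<and> sg (Suc i mod k) x > 0) * (1 + fps_X) =
      ?A * (fps_X ^ q i * inverse (\<Sum>l<q i. fps_X ^ l))" if i: "i < k" for i
  proof -
    let ?Q = "\<Sum>l<q i. fps_X ^ l :: complex fps"
    let ?S = "series (\<lambda>x. sg i x > 0 \<and> sg (Suc i mod k) x > 0)"
    have m: "m i (Suc i mod k) = q i" by (simp add: m_eq)
    have "fps_nth ?Q 0 = (\<Sum>l<q i. if l = 0 then 1 else 0)"
      unfolding fps_sum_nth by (rule sum.cong) auto
    also have "\<dots> = 1" using q_ge[OF i] by (simp add: sum.delta)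
    finally have "?Q * inverse ?Q = 1" by (intro inverse_mult_eq_1') simp
    then have "?S * (1 + fps_X) = ?S * (1 + fps_X) * (?Q * inverse ?Q)" by (simp only: mult_1_right)
    also have "\<dots> = ?S * ((1 + fps_X) * ?Q) * inverse ?Q" by (simp only: mult.assoc)
    also have "?S * ((1 + fps_X) * ?Q) = fps_X ^ q i * ?A"
      using series_dihedral[of i "Suc i mod k"] i Suc_mod_neq[OF i] m q_ge[OF i] by auto
    finally show ?thesis by (simp only: ac_simps)
  qed
  have "1 + fps_X = (?A - (\<Sum>i<k. series (\<lambda>x. sg i x > 0)) +
     (\<Sum>i<k. series (\<lambda>x. sg i x > 0 \<and> sg (Suc i mod k) x > 0))) * (1 + fps_X)"
    by (simp only: inclusion_exclusion[symmetric] mult_1_left)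
  also have "\<dots> = ?A * (1 + fps_X) - (\<Sum>i<k. series (\<lambda>x. sg i x > 0) * (1 + fps_X)) +
     (\<Sum>i<k. series (\<lambda>x. sg i x > 0 \<and> sg (Suc i mod k) x > 0) * (1 + fps_X))"
    by (simp only: distrib_right[where c = "1 + fps_X"] left_diff_distrib[where c = "1 + fps_X"]
        sum_distrib_right)
  also have "(\<Sum>i<k. series (\<lambda>x. sg i x > 0) * (1 + fps_X)) = (\<Sum>i<k. fps_X * ?A)"
    by (rule sum.cong[OF refl], rule series_descent) simp
  also have "(\<Sum>i<k. series (\<lambda>x. sg i x > 0 \<and> sg (Suc i mod k) x > 0) * (1 + fps_X)) =
     (\<Sum>i<k. ?A * (fps_X ^ q i * inverse (\<Sum>l<q i. fps_X ^ l)))"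
    by (rule sum.cong[OF refl], rule D) simp
  also have "?A * (1 + fps_X) - (\<Sum>i<k. fps_X * ?A) +
      (\<Sum>i<k. ?A * (fps_X ^ q i * inverse (\<Sum>l<q i. fps_X ^ l))) =
      ?A * (1 + fps_X - of_nat k * fps_X + (\<Sum>i<k. fps_X ^ q i * inverse (\<Sum>l<q i. fps_X ^ l)))"
  proof -
    have "A * (1 + t) - t * (c * A) + A * S = A * (1 + t - c * t + S)" for A t c S :: "complex fps"
      by (simp add: algebra_simps)
    then show ?thesis by (simp only: sum_distrib_left[symmetric] sum_constant card_lessThan)
  qed
  finally show ?thesis by (rule sym)
qed

end

section \<open>Minkowski space\<close>

lemma lorentz_sym: "lorentz x y = lorentz y x"
  by (simp add: lorentz_def mult.commute)

lemma lorentz_add: "lorentz (x + y) z = lorentz x z + lorentz y z"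
  "lorentz z (x + y) = lorentz z x + lorentz z y"
  by (simp_all add: lorentz_def algebra_simps)

lemma lorentz_diff: "lorentz (x - y) z = lorentz x z - lorentz y z"
  "lorentz z (x - y) = lorentz z x - lorentz z y"
  by (simp_all add: lorentz_def algebra_simps)

lemma lorentz_scale: "lorentz (r *\<^sub>R x) z = r * lorentz x z" "lorentz z (r *\<^sub>R x) = r * lorentz z x"
  by (simp_all add: lorentz_def algebra_simps)

lemma lorentz_minus: "lorentz (- x) z = - lorentz x z" "lorentz z (- x) = - lorentz z x"
  by (simp_all add: lorentz_def)

lemmas lorentz_simps = lorentz_add lorentz_diff lorentz_scale lorentz_minus

lemma lorentz_sum: "lorentz (\<Sum>i\<in>I. f i) z = (\<Sum>i\<in>I. lorentz (f i) z)"
  by (simp add: lorentz_def sum.distrib sum_subtractf sum_distrib_right)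

text \<open>Cauchy-Schwarz for the two spatial coordinates; strictness comes from the timelike
  vector \<open>x\<close>.\<close>

lemma timelike_future_neg:
  assumes "lorentz x x < 0" "x $ 3 > 0" "lorentz y y \<le> 0" "y $ 3 > 0"
  shows "lorentz x y < 0"
proof -
  have "(x $ 1 * y $ 1 + x $ 2 * y $ 2)\<^sup>2 \<le> ((x $ 1)\<^sup>2 + (x $ 2)\<^sup>2) * ((y $ 1)\<^sup>2 + (y $ 2)\<^sup>2)"
    using zero_le_power2[of "x $ 1 * y $ 2 - x $ 2 * y $ 1"]
    by (simp add: power2_eq_square algebra_simps)
  also have "\<dots> \<le> ((x $ 1)\<^sup>2 + (x $ 2)\<^sup>2) * (y $ 3)\<^sup>2"
    using assms(3) by (intro mult_left_mono) (auto simp: lorentz_def power2_eq_square)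
  also have "\<dots> < (x $ 3)\<^sup>2 * (y $ 3)\<^sup>2"
    using assms(1,4) by (intro mult_strict_right_mono) (auto simp: lorentz_def power2_eq_square)
  finally have "(x $ 1 * y $ 1 + x $ 2 * y $ 2)\<^sup>2 < (x $ 3 * y $ 3)\<^sup>2"
    by (simp add: power_mult_distrib)
  then have "x $ 1 * y $ 1 + x $ 2 * y $ 2 < x $ 3 * y $ 3"
    by (rule power2_less_imp_less) (use assms(2,4) in simp)
  then show ?thesis by (simp add: lorentz_def)
qed

lemma causal_future:
  assumes x: "lorentz x x < 0" "x $ 3 > 0" and n: "lorentz n n \<le> 0" "lorentz x n < 0"
  shows "n $ 3 > 0"
proof (rule ccontr)
  assume "\<not> n $ 3 > 0"
  then consider "n $ 3 < 0" | "n $ 3 = 0" by linarith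
  then show False
  proof cases
    case 1
    then show False using timelike_future_neg[OF x, of "- n"] n by (simp add: lorentz_simps)
  next
    case 2
    then have "(n $ 1)\<^sup>2 + (n $ 2)\<^sup>2 \<le> 0" using n(1) by (simp add: lorentz_def power2_eq_square)
    then have "n $ 1 = 0" "n $ 2 = 0" by (simp_all add: sum_power2_le_zero_iff)
    then show False using n(2) 2 by (simp add: lorentz_def)
  qed
qed

text \<open>A timelike or lightlike vector has a constant sign on the hyperbolic plane, so it
  suffices to test one point.\<close>

lemma hyp_plane_causal:
  assumes "x \<in> hyp_plane" "y \<in> hyp_plane" "lorentz n n \<le> 0" "lorentz x n < 0"
  shows "lorentz y n < 0"
  using timelike_future_neg[of y n] causal_future[of x n] assms by (auto simp: hyp_plane_def)

lemma hyp_plane_neg: "x \<in> hyp_plane \<Longrightarrow> y \<in> hyp_plane \<Longrightarrow> lorentz x y < 0"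
  using timelike_future_neg[of x y] by (auto simp: hyp_plane_def)

lemma hyp_planeI: "x \<in> hyp_plane \<Longrightarrow> lorentz y y = -1 \<Longrightarrow> lorentz x y < 0 \<Longrightarrow> y \<in> hyp_plane"
  using causal_future[of x y] by (auto simp: hyp_plane_def)

section \<open>Determinants, Gram matrices and nondegeneracy\<close>

definition det3 :: "real ^ 3 \<Rightarrow> real ^ 3 \<Rightarrow> real ^ 3 \<Rightarrow> real" where
  "det3 a b c = a $ 1 * (b $ 2 * c $ 3 - b $ 3 * c $ 2) - a $ 2 * (b $ 1 * c $ 3 - b $ 3 * c $ 1)
     + a $ 3 * (b $ 1 * c $ 2 - b $ 2 * c $ 1)"

lemma det3_cramer: "det3 a b c *\<^sub>R y = det3 y b c *\<^sub>R a + det3 a y c *\<^sub>R b + det3 a b y *\<^sub>R c"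
  unfolding Finite_Cartesian_Product.vec_eq_iff forall_3 by (auto simp: det3_def algebra_simps)

text \<open>The minus sign is the determinant of the form \<open>diag(1, 1, -1)\<close>. With
  suitable second triples the formula shows linear independence from Lorentz products alone.\<close>

lemma det3_gram:
  "det3 a b c * det3 x y z =
    - (lorentz a x * (lorentz b y * lorentz c z - lorentz b z * lorentz c y)
       - lorentz a y * (lorentz b x * lorentz c z - lorentz b z * lorentz c x)
       + lorentz a z * (lorentz b x * lorentz c y - lorentz b y * lorentz c x))"
  unfolding det3_def lorentz_def by (simp add: algebra_simps)

lemma lorentz_nondegenerate:
  assumes "det3 a b c \<noteq> 0" "lorentz d a = 0" "lorentz d b = 0" "lorentz d c = 0"
  shows "d = 0"
proof -
  have "det3 a b c * d $ 1 = lorentz d a * (b $ 2 * c $ 3 - b $ 3 * c $ 2)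
      - lorentz d b * (a $ 2 * c $ 3 - a $ 3 * c $ 2) + lorentz d c * (a $ 2 * b $ 3 - a $ 3 * b $ 2)"
    "det3 a b c * d $ 2 = - lorentz d a * (b $ 1 * c $ 3 - b $ 3 * c $ 1)
      + lorentz d b * (a $ 1 * c $ 3 - a $ 3 * c $ 1) - lorentz d c * (a $ 1 * b $ 3 - a $ 3 * b $ 1)"
    "det3 a b c * d $ 3 = - lorentz d a * (b $ 1 * c $ 2 - b $ 2 * c $ 1)
      + lorentz d b * (a $ 1 * c $ 2 - a $ 2 * c $ 1) - lorentz d c * (a $ 1 * b $ 2 - a $ 2 * b $ 1)"
    unfolding det3_def lorentz_def by (simp_all add: algebra_simps)
  then have "det3 a b c * d $ 1 = 0 \<and> det3 a b c * d $ 2 = 0 \<and> det3 a b c * d $ 3 = 0"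
    using assms(2-4) by simp
  then show ?thesis using assms(1) by (simp add: Finite_Cartesian_Product.vec_eq_iff forall_3)
qed

section \<open>Reflections\<close>

text \<open>The linear extension of \<open>hyp_reflection\<close> to Minkowski space. The latter is
  restricted to \<open>hyp_plane\<close> so that it can be an element of
  \<open>BijGroup hyp_plane\<close>.\<close>

definition mirror :: "real ^ 3 \<Rightarrow> real ^ 3 \<Rightarrow> real ^ 3" where
  "mirror e x = x - (2 * lorentz x e) *\<^sub>R e"

lemma mirror_mirror: "lorentz e e = 1 \<Longrightarrow> mirror e (mirror e x) = x"
  by (simp add: mirror_def lorentz_simps algebra_simps)

lemma lorentz_mirror: "lorentz (mirror e x) y = lorentz x y - 2 * lorentz x e * lorentz e y"
  by (simp add: mirror_def lorentz_simps)

lemma mirror_in_hyp_plane: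
  assumes "lorentz e e = 1" "x \<in> hyp_plane"
  shows "mirror e x \<in> hyp_plane"
proof (rule hyp_planeI[OF assms(2)])
  show "lorentz (mirror e x) (mirror e x) = -1"
    using assms by (simp add: mirror_def hyp_plane_def lorentz_simps lorentz_sym[of e x] algebra_simps)
  have "lorentz x (mirror e x) = -1 - 2 * (lorentz x e)\<^sup>2"
    using assms by (simp add: mirror_def hyp_plane_def lorentz_simps power2_eq_square)
  then show "lorentz x (mirror e x) < 0" using zero_le_power2[of "lorentz x e"] by linarith
qed

lemma hyp_reflection_mirror: "hyp_reflection e = restrict (mirror e) hyp_plane"
  unfolding hyp_reflection_def mirror_def by simp

lemma hyp_reflection_Bij:
  assumes "lorentz e e = 1"
  shows "hyp_reflection e \<in> Bij hyp_plane"
proof -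
  have "bij_betw (mirror e) hyp_plane hyp_plane"
    by (rule bij_betw_byWitness[of _ "mirror e"]) (use assms mirror_mirror mirror_in_hyp_plane in auto)
  then show ?thesis unfolding hyp_reflection_mirror Bij_def by auto
qed

text \<open>The two images of \<open>x\<close> are compared by their products with
  \<open>E i\<close>, \<open>E j\<close> and the common point \<open>v\<close> of the two lines. The
  reflections fix \<open>v\<close>, so the product with \<open>v\<close> does not change; the other
  two follow from the Chebyshev values near \<open>m\<close>.\<close>

lemma mirror_braid:
  assumes e: "lorentz (E i) (E i) = 1" "lorentz (E j) (E j) = 1"
    and c: "lorentz (E i) (E j) = - cos (pi / real m)" "2 \<le> m"
    and v: "lorentz v v = -1" "lorentz v (E i) = 0" "lorentz v (E j) = 0"
  shows "alt (\<lambda>i. mirror (E i)) m i j x = alt (\<lambda>i. mirror (E i)) m j i x"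
proof -
  let ?s = "\<lambda>i. mirror (E i)" and ?\<kappa> = "cos (pi / real m)"
  obtain n where n: "m = Suc n" using c(2) by (cases m) auto
  note U = chebU_cos_pi_self[OF c(2)] chebU_cos_pi_Suc[OF c(2)] chebU_cos_pi_pred[OF c(2)]
  have form: "lorentz (alt ?s l j i x) (E i) = (if even l
      then chebU ?\<kappa> (Suc l) * lorentz x (E i) + chebU ?\<kappa> l * lorentz x (E j)
      else chebU ?\<kappa> l * lorentz x (E i) + chebU ?\<kappa> (Suc l) * lorentz x (E j)) \<and>
    lorentz (alt ?s l i j x) (E j) = (if even l
      then chebU ?\<kappa> (Suc l) * lorentz x (E j) + chebU ?\<kappa> l * lorentz x (E i)
      else chebU ?\<kappa> l * lorentz x (E j) + chebU ?\<kappa> (Suc l) * lorentz x (E i))" for l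
    using alt_form[of UNIV ?s i j "\<lambda>x. lorentz x (E i)" "\<lambda>x. lorentz x (E j)" ?\<kappa> x l]
    by (simp add: lorentz_mirror e c lorentz_sym[of "E j" "E i"])
  have sym: "lorentz (E i) v = 0" "lorentz (E j) v = 0" "lorentz (E j) (E i) = - ?\<kappa>"
    using v c lorentz_sym by metis+
  have vert: "lorentz (alt ?s l a b x) v = lorentz x v" if "(a, b) \<in> {(i, j), (j, i)}" for a b l
    using that
  proof (induction l arbitrary: a b)
    case (Suc l)
    then show ?case using v Suc.IH[of b a] by (auto simp: lorentz_mirror sym)
  qed simp
  define d where "d = alt ?s m i j x - alt ?s m j i x"
  \<comment> \<open>The Gram determinant is \<open>sin\<^sup>2 (\<pi> / m)\<close>, so the three
    vectors form a basis.\<close>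
  have "det3 (E i) (E j) v * det3 (E i) (E j) v = 1 - ?\<kappa>\<^sup>2"
    unfolding det3_gram using e c v by (simp add: sym power2_eq_square)
  also have "\<dots> = (sin (pi / real m))\<^sup>2" by (simp add: sin_squared_eq)
  finally have "det3 (E i) (E j) v \<noteq> 0" using sin_pi_div_pos[OF c(2)] by auto
  moreover have "lorentz d v = 0" unfolding d_def using vert by (simp add: lorentz_simps)
  moreover have "lorentz d (E i) = 0"
    using form[of n] form[of m] U e unfolding d_def n
    by (auto simp: lorentz_simps lorentz_mirror simp del: chebU.simps)
  moreover have "lorentz d (E j) = 0"
    using form[of n] form[of m] U e unfolding d_def n
    by (auto simp: lorentz_simps lorentz_mirror simp del: chebU.simps)
  ultimately have "d = 0" using lorentz_nondegenerate by blast
  then show ?thesis unfolding d_def by simp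
qed

section \<open>Angles and disjoint sides\<close>

text \<open>The direction from \<open>b\<close> to \<open>a\<close> is orthogonal to
  \<open>b\<close> and \<open>f\<close>, hence a multiple of \<open>e + \<kappa> f\<close>; likewise
  for \<open>c\<close> with the normals exchanged. Both factors are negative because
  \<open>a\<close> and \<open>c\<close> lie on the inner sides, and so the cosine is
  \<open>\<kappa>\<close> and not \<open>- \<kappa>\<close>.\<close>

lemma hyp_angle_normals:
  assumes b: "b \<in> hyp_plane" and f: "lorentz f f = 1" "lorentz a f = 0" "lorentz b f = 0"
    and e: "lorentz e e = 1" "lorentz b e = 0" "lorentz c e = 0"
    and neg: "lorentz a e < 0" "lorentz c f < 0"
  shows "cos (hyp_angle a b c) = - lorentz f e"
proof -
  define \<kappa> where "\<kappa> = - lorentz f e"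
  have fe: "lorentz f e = - \<kappa>" "lorentz e f = - \<kappa>" unfolding \<kappa>_def by (simp_all add: lorentz_sym)
  have bb: "lorentz b b = -1" using b by (simp add: hyp_plane_def)
  have comm: "lorentz e a = lorentz a e" "lorentz f c = lorentz c f" "lorentz e b = 0" "lorentz f b = 0"
    "lorentz f a = 0" "lorentz e c = 0"
    using e f by (simp_all add: lorentz_sym[of e a] lorentz_sym[of f c] lorentz_sym[of e b]
        lorentz_sym[of f b] lorentz_sym[of f a] lorentz_sym[of e c])
  have "det3 b e f * det3 b a c = lorentz a e * lorentz c f"
    unfolding det3_gram using comm bb e f by simp
  then have det: "det3 b e f \<noteq> 0" using neg by auto
  have "det3 b e f * det3 b e f = 1 - \<kappa>\<^sup>2"
    unfolding det3_gram using comm bb e f fe by (simp add: power2_eq_square)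
  moreover have "det3 b e f * det3 b e f > 0" using det by (metis not_real_square_gt_zero)
  ultimately have \<kappa>: "\<kappa>\<^sup>2 < 1" by simp
  \<comment> \<open>The factor is found by pairing with \<open>e\<close>: the direction has product
    \<open>lorentz a e\<close> with it, and \<open>e + \<kappa> f\<close> has product
    \<open>1 - \<kappa>\<^sup>2\<close>.\<close>
  define t where "t = lorentz a e / (1 - \<kappa>\<^sup>2)"
  define t' where "t' = lorentz c f / (1 - \<kappa>\<^sup>2)"
  have t: "t < 0" "t' < 0" using \<kappa> neg unfolding t_def t'_def by (auto simp: divide_neg_pos)
  have te: "t * (1 - \<kappa>\<^sup>2) = lorentz a e" "t' * (1 - \<kappa>\<^sup>2) = lorentz c f"
    using \<kappa> unfolding t_def t'_def by auto
  have "direction b a - t *\<^sub>R (e + \<kappa> *\<^sub>R f) = 0"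
    by (rule lorentz_nondegenerate[OF det])
      (use comm bb e f fe te in \<open>auto simp: direction_def lorentz_simps lorentz_sym[of a b] power2_eq_square algebra_simps\<close>)
  then have D: "direction b a = t *\<^sub>R (e + \<kappa> *\<^sub>R f)" by simp
  have "direction b c - t' *\<^sub>R (f + \<kappa> *\<^sub>R e) = 0"
    by (rule lorentz_nondegenerate[OF det])
      (use comm bb e f fe te in \<open>auto simp: direction_def lorentz_simps lorentz_sym[of c b] power2_eq_square algebra_simps\<close>)
  then have D': "direction b c = t' *\<^sub>R (f + \<kappa> *\<^sub>R e)" by simp
  have 1: "lorentz (direction b a) (direction b a) = t\<^sup>2 * (1 - \<kappa>\<^sup>2)"
    "lorentz (direction b c) (direction b c) = t'\<^sup>2 * (1 - \<kappa>\<^sup>2)"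
    "lorentz (direction b a) (direction b c) = t * t' * \<kappa> * (1 - \<kappa>\<^sup>2)"
    unfolding D D' using e f fe by (simp_all add: lorentz_simps power2_eq_square algebra_simps)
  have 2: "sqrt (t\<^sup>2 * (1 - \<kappa>\<^sup>2)) * sqrt (t'\<^sup>2 * (1 - \<kappa>\<^sup>2)) = t * t' * (1 - \<kappa>\<^sup>2)"
    using t \<kappa> by (simp add: real_sqrt_mult)
  have "hyp_angle a b c = arccos \<kappa>"
    unfolding hyp_angle_def 1 2 using t \<kappa> by simp
  moreover have "\<bar>\<kappa>\<bar> \<le> 1" using \<kappa> by (simp add: abs_square_less_1 less_imp_le)
  ultimately show ?thesis unfolding \<kappa>_def[symmetric] by (simp add: cos_arccos_abs)
qed

lemma det3_side:
  assumes a: "lorentz a e = 0" "lorentz a g = 0" "lorentz a f < 0"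
    and b: "lorentz b e = 0" "lorentz b f = 0" "lorentz b g < 0"
    and e: "lorentz e e = 1"
  shows "det3 a b e \<noteq> 0"
proof -
  have "det3 a b e * det3 f g e = - (lorentz a f * lorentz b g)"
    unfolding det3_gram using a b e by simp
  then show ?thesis using a b by auto
qed

text \<open>Here \<open>a\<close> and \<open>b\<close> are the ends of a side with normal
  \<open>e\<close>, while \<open>g\<close> and \<open>f\<close> are the normals of the neighbouring
  sides through \<open>a\<close> and \<open>b\<close>. As \<open>f\<close> kills \<open>b\<close>
  and \<open>g\<close> kills \<open>a\<close>, pairing with them isolates the coefficients.\<close>

lemma project_to_side:
  assumes a: "lorentz a e = 0" "lorentz a g = 0" "lorentz a f < 0"
    and b: "lorentz b e = 0" "lorentz b f = 0" "lorentz b g < 0"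
    and e: "lorentz e e = 1"
  obtains \<alpha> \<beta> where "y = \<alpha> *\<^sub>R a + \<beta> *\<^sub>R b + lorentz y e *\<^sub>R e"
    "\<alpha> * lorentz a f = lorentz y f - lorentz y e * lorentz e f"
    "\<beta> * lorentz b g = lorentz y g - lorentz y e * lorentz e g"
proof -
  have det: "det3 a b e \<noteq> 0" using det3_side[OF assms] .
  define \<alpha> where "\<alpha> = det3 y b e / det3 a b e"
  define \<beta> where "\<beta> = det3 a y e / det3 a b e"
  define \<gamma> where "\<gamma> = det3 a b y / det3 a b e"
  have "y = (1 / det3 a b e) *\<^sub>R (det3 a b e *\<^sub>R y)" using det by simp
  also have "\<dots> = \<alpha> *\<^sub>R a + \<beta> *\<^sub>R b + \<gamma> *\<^sub>R e"
    by (subst det3_cramer) (simp add: scaleR_add_right \<alpha>_def \<beta>_def \<gamma>_def)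
  finally have y: "y = \<alpha> *\<^sub>R a + \<beta> *\<^sub>R b + \<gamma> *\<^sub>R e" .
  have "lorentz y e = \<gamma>" "lorentz y f = \<alpha> * lorentz a f + \<gamma> * lorentz e f"
    "lorentz y g = \<beta> * lorentz b g + \<gamma> * lorentz e g"
    by (subst y, simp add: lorentz_simps a b e)+
  then show thesis using that[of \<alpha> \<beta>] y by simp
qed

text \<open>The assumption says that the two lines meet, and \<open>q\<close> is a multiple of the
  intersection point. It is the Lorentzian cross product of the normals, with the sign chosen such
  that it points to the future.\<close>

lemma common_perpendicular:
  assumes "lorentz e e = 1" "lorentz f f = 1" "(lorentz e f)\<^sup>2 < 1"
  obtains q where "lorentz q e = 0" "lorentz q f = 0" "\<And>x. x \<in> hyp_plane \<Longrightarrow> lorentz x q < 0"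
proof -
  define q :: "real ^ 3" where "q = vector [e $ 2 * f $ 3 - e $ 3 * f $ 2,
     e $ 3 * f $ 1 - e $ 1 * f $ 3, - (e $ 1 * f $ 2 - e $ 2 * f $ 1)]"
  have q: "lorentz q e = 0" "lorentz q f = 0"
    unfolding q_def lorentz_def by (simp_all add: algebra_simps)
  have "lorentz q q = (lorentz e f)\<^sup>2 - lorentz e e * lorentz f f"
    unfolding q_def lorentz_def by (simp add: power2_eq_square algebra_simps)
  then have qq: "lorentz q q < 0" using assms by simp
  have "q $ 3 \<noteq> 0"
  proof
    assume "q $ 3 = 0"
    then have "(q $ 1)\<^sup>2 + (q $ 2)\<^sup>2 < 0" using qq by (simp add: lorentz_def power2_eq_square)
    then show False using sum_power2_ge_zero[of "q $ 1" "q $ 2"] by linarith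
  qed
  then consider "q $ 3 > 0" | "(- q) $ 3 > 0" by force
  then show thesis
  proof cases
    case 1
    then show thesis using that[of q] q qq timelike_future_neg[of _ q] by (auto simp: hyp_plane_def)
  next
    case 2
    then show thesis using that[of "- q"] q qq timelike_future_neg[of _ "- q"]
      by (auto simp: hyp_plane_def lorentz_simps)
  qed
qed

text \<open>For the next two lemmas: two lines meeting in \<open>q\<close> at an angle \<open>\<theta>\<close> carry segments that project orthogonally into each
  other. Projecting multiplies the slope with respect to \<open>q\<close> by at most \<open>cos \<theta>\<close>, and the smallest slopes on
  the two segments would have to bound each other.\<close>

lemma ratio_bound:
  fixes c :: real
  assumes "r \<le> A / P" "r \<le> B / Q" "P < 0" "Q < 0" "0 \<le> \<alpha>" "0 \<le> \<beta>"
    and "\<alpha> * A + \<beta> * B + s * c = 0" "\<alpha> * P + \<beta> * Q = z" "z < 0"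
  shows "r \<le> - c * (s / z)"
proof -
  have "\<alpha> * A \<le> \<alpha> * (r * P)" "\<beta> * B \<le> \<beta> * (r * Q)"
    using assms by (auto intro!: mult_left_mono simp: neg_le_divide_eq)
  then have "- (s * c) \<le> r * z" using assms(7) unfolding assms(8)[symmetric] by (simp add: algebra_simps)
  then have "r \<le> (- (s * c)) / z" by (simp only: neg_le_divide_eq[OF assms(9)])
  then show ?thesis by (simp add: ac_simps)
qed

lemma disjoint_sides:
  assumes H: "a \<in> hyp_plane" "b \<in> hyp_plane" "a' \<in> hyp_plane" "b' \<in> hyp_plane"
    and e: "lorentz e e = 1" "lorentz e' e' = 1"
    and ab: "lorentz a e = 0" "lorentz b e = 0" "lorentz a e' < 0" "lorentz b e' < 0"
    and ab': "lorentz a' e' = 0" "lorentz b' e' = 0" "lorentz a' e < 0" "lorentz b' e < 0"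
    and proj: "\<And>y. y \<in> {a', b'} \<Longrightarrow> \<exists>\<alpha>\<ge>0. \<exists>\<beta>\<ge>0. y = \<alpha> *\<^sub>R a + \<beta> *\<^sub>R b + lorentz y e *\<^sub>R e"
    and proj': "\<And>y. y \<in> {a, b} \<Longrightarrow> \<exists>\<alpha>\<ge>0. \<exists>\<beta>\<ge>0. y = \<alpha> *\<^sub>R a' + \<beta> *\<^sub>R b' + lorentz y e' *\<^sub>R e'"
  shows "lorentz e e' \<le> -1"
proof -
  define c where "c = lorentz e e'"
  have c': "lorentz e' e = c" unfolding c_def by (rule lorentz_sym)
  \<comment> \<open>Otherwise \<open>lorentz a' e' = 0\<close> is a sum of nonpositive terms. This
    kills \<open>\<alpha>\<close> and \<open>\<beta>\<close> and makes the timelike vector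
    \<open>a'\<close> a multiple of the spacelike vector \<open>e\<close>.\<close>
  have neg: "c < 0"
  proof (rule ccontr)
    assume nn: "\<not> c < 0"
    obtain \<alpha> \<beta> where ge: "0 \<le> \<alpha>" "0 \<le> \<beta>" and y: "a' = \<alpha> *\<^sub>R a + \<beta> *\<^sub>R b + lorentz a' e *\<^sub>R e"
      using proj[OF insertI1] by blast
    have "lorentz a' e' = \<alpha> * lorentz a e' + \<beta> * lorentz b e' + lorentz a' e * c"
      by (subst y) (simp add: lorentz_simps c_def)
    moreover have "lorentz a' e * c \<le> 0" using nn ab' by (simp add: mult_nonpos_nonneg)
    moreover have "\<alpha> * lorentz a e' \<le> 0" "\<beta> * lorentz b e' \<le> 0"
      using ge ab by (simp_all add: mult_nonneg_nonpos)
    ultimately have "\<alpha> * lorentz a e' = 0" "\<beta> * lorentz b e' = 0" using ab' by linarith+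
    then have "\<alpha> = 0" "\<beta> = 0" using ab by auto
    then have "a' = lorentz a' e *\<^sub>R e" using y by simp
    then have "lorentz a' a' = (lorentz a' e)\<^sup>2 * lorentz e e"
      by (metis lorentz_scale mult.assoc power2_eq_square)
    then show False using H(3) e zero_le_power2[of "lorentz a' e"] by (simp add: hyp_plane_def)
  qed
  have "\<not> c\<^sup>2 < 1"
  proof
    assume "c\<^sup>2 < 1"
    then obtain q where q: "lorentz q e = 0" "lorentz q e' = 0" and qH: "\<And>x. x \<in> hyp_plane \<Longrightarrow> lorentz x q < 0"
      using common_perpendicular[OF e] unfolding c_def by metis
    define r where "r = min (lorentz a e' / lorentz a q) (lorentz b e' / lorentz b q)"
    define r' where "r' = min (lorentz a' e / lorentz a' q) (lorentz b' e / lorentz b' q)"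
    have r0: "0 < r" unfolding r_def using ab qH H by (simp add: divide_neg_neg)
    have "r \<le> - c * (lorentz y e / lorentz y q)" if y: "y \<in> {a', b'}" for y
    proof -
      obtain \<alpha> \<beta> where ge: "0 \<le> \<alpha>" "0 \<le> \<beta>" and eq: "y = \<alpha> *\<^sub>R a + \<beta> *\<^sub>R b + lorentz y e *\<^sub>R e" using proj[OF y] by auto
      have "lorentz y e' = \<alpha> * lorentz a e' + \<beta> * lorentz b e' + lorentz y e * c"
        by (subst eq) (simp add: lorentz_simps c_def)
      then have 1: "\<alpha> * lorentz a e' + \<beta> * lorentz b e' + lorentz y e * c = 0" using y ab' by auto
      have 2: "\<alpha> * lorentz a q + \<beta> * lorentz b q = lorentz y q"
        by (subst eq) (simp add: lorentz_simps lorentz_sym[of e q] q)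
      show ?thesis
        by (rule ratio_bound[OF _ _ _ _ ge 1 2]) (use r_def qH H y in auto)
    qed
    then have 1: "r \<le> - c * r'" unfolding r'_def by (simp add: min_def)
    have "r' \<le> - c * (lorentz y e' / lorentz y q)" if y: "y \<in> {a, b}" for y
    proof -
      obtain \<alpha> \<beta> where ge: "0 \<le> \<alpha>" "0 \<le> \<beta>" and eq: "y = \<alpha> *\<^sub>R a' + \<beta> *\<^sub>R b' + lorentz y e' *\<^sub>R e'" using proj'[OF y] by auto
      have "lorentz y e = \<alpha> * lorentz a' e + \<beta> * lorentz b' e + lorentz y e' * c"
        by (subst eq) (simp add: lorentz_simps c')
      then have 1: "\<alpha> * lorentz a' e + \<beta> * lorentz b' e + lorentz y e' * c = 0" using y ab by auto
      have 2: "\<alpha> * lorentz a' q + \<beta> * lorentz b' q = lorentz y q"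
        by (subst eq) (simp add: lorentz_simps lorentz_sym[of e' q] q)
      show ?thesis
        by (rule ratio_bound[OF _ _ _ _ ge 1 2]) (use r'_def qH H y in auto)
    qed
    then have 2: "r' \<le> - c * r" unfolding r_def by (simp add: min_def)
    \<comment> \<open>Chaining the two bounds gives \<open>r \<le> c\<^sup>2 r\<close> with positive
      \<open>r\<close>.\<close>
    have "- c * r' \<le> - c * (- c * r)" using 2 neg by (intro mult_left_mono) auto
    then have "r \<le> c\<^sup>2 * r" using 1 by (simp add: power2_eq_square)
    then show False using r0 \<open>c\<^sup>2 < 1\<close> by simp
  qed
  then have "c \<le> -1" using neg abs_square_less_1[of c] by auto
  then show ?thesis unfolding c_def .
qed

section \<open>The reflection group of a Coxeter polygon\<close>

lemma foldr_mult_assoc: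
  assumes "group G" "\<And>i. i \<in> I \<Longrightarrow> R i \<in> carrier G" "set ws \<subseteq> I" "h \<in> carrier G"
  shows "foldr (\<lambda>i. mult G (R i)) ws h = mult G (foldr (\<lambda>i. mult G (R i)) ws (one G)) h \<and>
    foldr (\<lambda>i. mult G (R i)) ws (one G) \<in> carrier G"
proof -
  interpret group G by fact
  show ?thesis using assms(3)
    by (induction ws) (use assms(2,4) in \<open>auto simp: m_assoc\<close>)
qed

text \<open>The letters are their own inverses, so words without formal inverses already form a
  subgroup.\<close>

lemma generate_involutions:
  assumes "group G" "\<And>i. i \<in> I \<Longrightarrow> R i \<in> carrier G" "\<And>i. i \<in> I \<Longrightarrow> mult G (R i) (R i) = one G"
  shows "generate G (R ` I) = {foldr (\<lambda>i. mult G (R i)) ws (one G) | ws. set ws \<subseteq> I}" (is "_ = ?W")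
proof -
  interpret group G by fact
  have inv: "inv\<^bsub>G\<^esub> (R i) = R i" if "i \<in> I" for i using assms(2,3) that inv_equality by blast
  show ?thesis
  proof
    show "generate G (R ` I) \<subseteq> ?W"
    proof
      fix g assume "g \<in> generate G (R ` I)"
      then show "g \<in> ?W"
      proof (induction rule: generate.induct)
        case one
        show ?case by (rule CollectI, rule exI[of _ "[]"]) simp
      next
        case (incl h)
        then obtain i where "i \<in> I" "h = R i" by auto
        then show ?case using assms(2) by (intro CollectI exI[of _ "[i]"]) auto
      next
        case (inv h)
        then obtain i where "i \<in> I" "h = R i" by auto
        then show ?case using assms(2) \<open>\<And>i. i \<in> I \<Longrightarrow> inv\<^bsub>G\<^esub> (R i) = R i\<close>
          by (intro CollectI exI[of _ "[i]"]) auto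
      next
        case (eng g h)
        then obtain ws vs where ws: "set ws \<subseteq> I" "g = foldr (\<lambda>i. mult G (R i)) ws (one G)"
          "set vs \<subseteq> I" "h = foldr (\<lambda>i. mult G (R i)) vs (one G)" by blast
        have "h \<in> carrier G" using foldr_mult_assoc[of G I R vs, OF assms(1,2) ws(3)] ws(4) one_closed by blast
        then have "mult G g h = foldr (\<lambda>i. mult G (R i)) (ws @ vs) (one G)"
          using foldr_mult_assoc[of G I R ws h, OF assms(1,2) ws(1)] ws(2,4) by simp
        then show ?case using ws by (intro CollectI exI[of _ "ws @ vs"]) auto
      qed
    qed
    have "foldr (\<lambda>i. mult G (R i)) ws (one G) \<in> generate G (R ` I)" if "set ws \<subseteq> I" for ws
      using that by (induction ws) (auto intro: generate.intros)
    then show "?W \<subseteq> generate G (R ` I)" by auto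
  qed
qed

text \<open>Words in the indices reach the same elements at the same lengths as words in the
  reflections, even if two indices have the same reflection.\<close>

lemma word_length_image:
  "word_length G (R ` I) g =
    (LEAST n. \<exists>ws. length ws = n \<and> set ws \<subseteq> I \<and> foldr (\<lambda>i. mult G (R i)) ws (one G) = g)"
proof -
  have "(\<exists>ws. length ws = n \<and> set ws \<subseteq> R ` I \<and> foldr (mult G) ws (one G) = g) \<longleftrightarrow>
    (\<exists>ws. length ws = n \<and> set ws \<subseteq> I \<and> foldr (\<lambda>i. mult G (R i)) ws (one G) = g)" for n
  proof
    assume "\<exists>ws. length ws = n \<and> set ws \<subseteq> R ` I \<and> foldr (mult G) ws (one G) = g"
    then obtain ws where ws: "length ws = n" "ws \<in> lists (R ` I)" "foldr (mult G) ws (one G) = g" by auto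
    then obtain vs where "vs \<in> lists I" "ws = map R vs" unfolding lists_image by auto
    then show "\<exists>ws. length ws = n \<and> set ws \<subseteq> I \<and> foldr (\<lambda>i. mult G (R i)) ws (one G) = g"
      using ws by (intro exI[of _ vs]) (auto simp: foldr_map o_def)
  next
    assume "\<exists>ws. length ws = n \<and> set ws \<subseteq> I \<and> foldr (\<lambda>i. mult G (R i)) ws (one G) = g"
    then obtain vs where "length vs = n" "set vs \<subseteq> I" "foldr (\<lambda>i. mult G (R i)) vs (one G) = g" by auto
    then show "\<exists>ws. length ws = n \<and> set ws \<subseteq> R ` I \<and> foldr (mult G) ws (one G) = g"
      by (intro exI[of _ "map R vs"]) (auto simp: foldr_map o_def)
  qed
  then show ?thesis unfolding word_length_def by simp
qed

locale cox_polygon =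
  fixes k :: nat and p :: "nat \<Rightarrow> nat" and v :: "nat \<Rightarrow> real ^ 3"
  assumes k3: "3 \<le> k" and p2: "i < k \<Longrightarrow> 2 \<le> p i" and cox: "coxeter_polygon k p v"
begin

section \<open>Outer normals of the sides and their mutual position\<close>

abbreviation nx :: "nat \<Rightarrow> nat" where "nx i \<equiv> Suc i mod k"
abbreviation pv :: "nat \<Rightarrow> nat" where "pv i \<equiv> (i + k - 1) mod k"

lemma nx_less: "nx i < k" and pv_less: "pv i < k"
  using k3 by auto

lemma nx_cases: "i < k \<Longrightarrow> nx i = (if Suc i = k then 0 else Suc i)"
  by auto

lemma pv_cases: "i < k \<Longrightarrow> pv i = (if i = 0 then k - 1 else i - 1)"
proof (cases i)
  case (Suc j)
  assume "i < k"
  then have "(i + k - 1) mod k = (j + k) mod k" using Suc by simp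
  then show ?thesis using Suc \<open>i < k\<close> by simp
qed (use k3 in auto)

lemma nx_pv: "i < k \<Longrightarrow> nx (pv i) = i"
  using k3 pv_less[of i] by (simp only: nx_cases pv_cases) (auto split: if_splits)

lemma pv_nx: "i < k \<Longrightarrow> pv (nx i) = i"
  using k3 nx_less[of i] by (simp only: nx_cases pv_cases) (auto split: if_splits)

lemma nx_neq: "i < k \<Longrightarrow> nx i \<noteq> i" "i < k \<Longrightarrow> nx (nx i) \<noteq> i"
  using k3 nx_less[of i] by (simp_all only: nx_cases) (auto split: if_splits)

lemma nx_inj: "i < k \<Longrightarrow> j < k \<Longrightarrow> nx i = nx j \<Longrightarrow> i = j"
  by (metis pv_nx)

definition E :: "nat \<Rightarrow> real ^ 3" where
  "E i = (SOME e. line_normal (v i) (v (nx i)) e \<and> (\<forall>j<k. j \<noteq> i \<longrightarrow> j \<noteq> nx i \<longrightarrow> lorentz (v j) e < 0))"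

lemma v_in: "i < k \<Longrightarrow> v i \<in> hyp_plane"
  using cox unfolding coxeter_polygon_def convex_polygon_def by blast

lemma E_spec:
  assumes "i < k"
  shows "line_normal (v i) (v (nx i)) (E i) \<and> (\<forall>j<k. j \<noteq> i \<longrightarrow> j \<noteq> nx i \<longrightarrow> lorentz (v j) (E i) < 0)"
  unfolding E_def
  by (rule someI_ex) (use cox assms in \<open>unfold coxeter_polygon_def convex_polygon_def, blast\<close>)

lemma E_unit: "i < k \<Longrightarrow> lorentz (E i) (E i) = 1"
  and E_v: "i < k \<Longrightarrow> lorentz (v i) (E i) = 0"
  and E_nx: "i < k \<Longrightarrow> lorentz (v (nx i)) (E i) = 0"
  and E_neg: "\<lbrakk>i < k; j < k; j \<noteq> i; j \<noteq> nx i\<rbrakk> \<Longrightarrow> lorentz (v j) (E i) < 0"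
  using E_spec unfolding line_normal_def by blast+

lemma E_nonpos: "i < k \<Longrightarrow> j < k \<Longrightarrow> lorentz (v j) (E i) \<le> 0"
  using E_v E_nx E_neg by (metis less_eq_real_def)

text \<open>Side \<open>i\<close> joins \<open>v i\<close> to \<open>v (nx i)\<close>, so the sides
  \<open>i\<close> and \<open>nx i\<close> meet at \<open>v (nx i)\<close>. This is the origin of
  the index shift in \<open>p (nx i)\<close>.\<close>

lemma E_adjacent:
  assumes "i < k"
  shows "lorentz (E i) (E (nx i)) = - cos (pi / real (p (nx i)))"
proof -
  have "hyp_angle (v i) (v (nx i)) (v (nx (nx i))) = pi / real (p (nx i))"
    using cox nx_less[of i] pv_nx[OF assms] unfolding coxeter_polygon_def by metis
  moreover have "cos (hyp_angle (v i) (v (nx i)) (v (nx (nx i)))) = - lorentz (E i) (E (nx i))"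
    using assms nx_less nx_neq
    by (intro hyp_angle_normals v_in E_unit E_v E_nx E_neg) (metis nx_inj)+
  ultimately show ?thesis by simp
qed

lemma E_adjacent_nonpos:
  assumes "i < k"
  shows "lorentz (E i) (E (nx i)) \<le> 0"
proof -
  have "pi / real (p (nx i)) \<le> pi / 2"
    using p2[OF nx_less[of i]] by (intro divide_left_mono) auto
  moreover have "- (pi / 2) \<le> pi / real (p (nx i))"
    by (rule order_trans[of _ 0]) auto
  ultimately have "0 \<le> cos (pi / real (p (nx i)))" by (intro cos_ge_zero)
  then show ?thesis using E_adjacent[OF assms] by simp
qed

lemma side_facts:
  assumes "i < k"
  shows "lorentz (v i) (E i) = 0" "lorentz (v i) (E (pv i)) = 0" "lorentz (v i) (E (nx i)) < 0"
    "lorentz (v (nx i)) (E i) = 0" "lorentz (v (nx i)) (E (nx i)) = 0" "lorentz (v (nx i)) (E (pv i)) < 0"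
    "lorentz (E i) (E i) = 1"
proof -
  have "nx i \<noteq> pv i" using nx_neq(2)[OF assms] nx_pv[OF assms] nx_less pv_less nx_pv by metis
  then show "lorentz (v (nx i)) (E (pv i)) < 0"
    using E_neg[OF pv_less nx_less] nx_pv[OF assms] nx_neq[OF assms] by metis
  show "lorentz (v i) (E (pv i)) = 0" using E_nx[OF pv_less, of i] nx_pv[OF assms] by simp
  show "lorentz (v i) (E (nx i)) < 0" using E_neg[OF nx_less assms] nx_neq[OF assms] by metis
qed (use assms E_unit E_v E_nx nx_less in auto)

lemma project_side:
  assumes "i < k"
  obtains \<alpha> \<beta> where "y = \<alpha> *\<^sub>R v i + \<beta> *\<^sub>R v (nx i) + lorentz y (E i) *\<^sub>R E i"
    "\<alpha> * lorentz (v i) (E (nx i)) = lorentz y (E (nx i)) - lorentz y (E i) * lorentz (E i) (E (nx i))"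
    "\<beta> * lorentz (v (nx i)) (E (pv i)) = lorentz y (E (pv i)) - lorentz y (E i) * lorentz (E i) (E (pv i))"
  by (rule project_to_side[OF side_facts[OF assms]])

lemma E_pv_nonpos:
  assumes "i < k"
  shows "lorentz (E i) (E (pv i)) \<le> 0"
  using E_adjacent_nonpos[OF pv_less, of i] nx_pv[OF assms] by (simp add: lorentz_sym)

text \<open>The angles at both ends of a side are acute, so the polygon projects into that side.\<close>

lemma vertex_projection:
  assumes "i < k" "j < k"
  shows "\<exists>\<alpha>\<ge>0. \<exists>\<beta>\<ge>0. v j = \<alpha> *\<^sub>R v i + \<beta> *\<^sub>R v (nx i) + lorentz (v j) (E i) *\<^sub>R E i"
proof -
  obtain \<alpha> \<beta> where y: "v j = \<alpha> *\<^sub>R v i + \<beta> *\<^sub>R v (nx i) + lorentz (v j) (E i) *\<^sub>R E i"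
    and \<alpha>: "\<alpha> * lorentz (v i) (E (nx i)) = lorentz (v j) (E (nx i)) - lorentz (v j) (E i) * lorentz (E i) (E (nx i))"
    and \<beta>: "\<beta> * lorentz (v (nx i)) (E (pv i)) = lorentz (v j) (E (pv i)) - lorentz (v j) (E i) * lorentz (E i) (E (pv i))"
    using project_side[OF assms(1)] .
  have "0 \<le> lorentz (v j) (E i) * lorentz (E i) (E (nx i))"
    "0 \<le> lorentz (v j) (E i) * lorentz (E i) (E (pv i))"
    using E_nonpos[OF assms] E_adjacent_nonpos[OF assms(1)] E_pv_nonpos[OF assms(1)]
    by (auto intro: mult_nonpos_nonpos)
  then have "\<alpha> * lorentz (v i) (E (nx i)) \<le> 0" "\<beta> * lorentz (v (nx i)) (E (pv i)) \<le> 0"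
    unfolding \<alpha> \<beta> using E_nonpos[OF nx_less assms(2), of i] E_nonpos[OF pv_less assms(2), of i] by linarith+
  then have "0 \<le> \<alpha>" "0 \<le> \<beta>" using side_facts[OF assms(1)]
    by (smt (verit) mult_neg_neg)+
  then show ?thesis using y by blast
qed

lemma E_nonadjacent:
  assumes "i < k" "j < k" "i \<noteq> j" "j \<noteq> nx i" "i \<noteq> nx j"
  shows "lorentz (E i) (E j) \<le> -1"
proof (rule disjoint_sides)
  show "v i \<in> hyp_plane" "v (nx i) \<in> hyp_plane" "v j \<in> hyp_plane" "v (nx j) \<in> hyp_plane"
    using v_in assms nx_less by auto
  show "lorentz (v i) (E j) < 0" "lorentz (v (nx i)) (E j) < 0" "lorentz (v j) (E i) < 0"
    "lorentz (v (nx j)) (E i) < 0"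
    using assms nx_less nx_inj[OF assms(1,2)] by (auto intro!: E_neg)
qed (use assms E_unit E_v E_nx vertex_projection nx_less in auto)

text \<open>Since the normals have product at most -1, their sum is not spacelike, so its sign is
  the same at all points of the plane; at \<open>v i\<close> it is negative.\<close>

lemma outer_halfplanes_disjoint:
  assumes ij: "i < k" "j < k" "i \<noteq> j" "j \<noteq> nx i" "i \<noteq> nx j" and y: "y \<in> hyp_plane"
  shows "lorentz y (E i) + lorentz y (E j) < 0"
proof -
  have "lorentz (E i + E j) (E i + E j) \<le> 0"
    using E_nonadjacent[OF ij] E_unit ij by (simp add: lorentz_simps lorentz_sym[of "E j" "E i"])
  moreover have "lorentz (v i) (E i + E j) < 0"
    using E_v[OF ij(1)] E_neg[OF ij(2,1)] ij by (simp add: lorentz_simps)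
  ultimately have "lorentz y (E i + E j) < 0" using hyp_plane_causal v_in ij y by blast
  then show ?thesis by (simp add: lorentz_simps)
qed

text \<open>Expand \<open>y\<close> along the middle side. As the angles there are not obtuse, both
  vertex coefficients would be negative, and then the product of \<open>y\<close> with
  \<open>v i\<close> would be positive. Only this product is restricted, because \<open>y\<close>
  will be a sum of points of the plane.\<close>

lemma three_outer_halfplanes:
  assumes i: "i < k" and y: "lorentz (v i) y < 0"
  shows "\<not> (lorentz y (E (pv i)) > 0 \<and> lorentz y (E i) > 0 \<and> lorentz y (E (nx i)) > 0)"
proof
  assume pos: "lorentz y (E (pv i)) > 0 \<and> lorentz y (E i) > 0 \<and> lorentz y (E (nx i)) > 0"
  obtain \<alpha> \<beta> where eq: "y = \<alpha> *\<^sub>R v i + \<beta> *\<^sub>R v (nx i) + lorentz y (E i) *\<^sub>R E i"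
    and \<alpha>: "\<alpha> * lorentz (v i) (E (nx i)) = lorentz y (E (nx i)) - lorentz y (E i) * lorentz (E i) (E (nx i))"
    and \<beta>: "\<beta> * lorentz (v (nx i)) (E (pv i)) = lorentz y (E (pv i)) - lorentz y (E i) * lorentz (E i) (E (pv i))"
    using project_side[OF assms(1)] .
  have "lorentz y (E i) * lorentz (E i) (E (nx i)) \<le> 0" "lorentz y (E i) * lorentz (E i) (E (pv i)) \<le> 0"
    using pos E_adjacent_nonpos[OF i] E_pv_nonpos[OF i] by (auto intro: mult_nonneg_nonpos)
  then have "\<alpha> * lorentz (v i) (E (nx i)) > 0" "\<beta> * lorentz (v (nx i)) (E (pv i)) > 0"
    unfolding \<alpha> \<beta> using pos by linarith+
  then have ab: "\<alpha> < 0" "\<beta> < 0" using side_facts[OF i] by (auto simp: zero_less_mult_iff)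
  have "lorentz (v i) y = - \<alpha> + \<beta> * lorentz (v i) (v (nx i))"
    using v_in[OF i] by (subst eq) (simp add: lorentz_simps E_v[OF i] hyp_plane_def)
  moreover have "\<beta> * lorentz (v i) (v (nx i)) > 0"
    using ab hyp_plane_neg[OF v_in[OF i] v_in[OF nx_less]] by (simp add: mult_neg_neg)
  ultimately show False using ab y by linarith
qed

section \<open>The polygon group as a mirror system\<close>

abbreviation R :: "nat \<Rightarrow> real ^ 3 \<Rightarrow> real ^ 3" where "R i \<equiv> hyp_reflection (E i)"
abbreviation s :: "nat \<Rightarrow> (real ^ 3 \<Rightarrow> real ^ 3) \<Rightarrow> real ^ 3 \<Rightarrow> real ^ 3" where
  "s i \<equiv> mult (BijGroup hyp_plane) (R i)"

text \<open>Any unit normal of the line of side \<open>i\<close> is \<open>c *\<^sub>R E i\<close>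
  with \<open>c * c = 1\<close>, and a reflection is quadratic in its normal.\<close>

lemma side_reflections_eq: "side_reflections k v = R ` {..<k}"
proof
  show "R ` {..<k} \<subseteq> side_reflections k v" unfolding side_reflections_def using E_spec by blast
  have "hyp_reflection e = R i" if i: "i < k" and e: "line_normal (v i) (v (nx i)) e" for e i
  proof -
    define c where "c = lorentz e (E i)"
    have "e - c *\<^sub>R E i = 0"
      by (rule lorentz_nondegenerate[OF det3_side[OF side_facts[OF i]]])
        (use e side_facts[OF i] in \<open>auto simp: c_def line_normal_def lorentz_simps lorentz_sym[of e "v i"]
           lorentz_sym[of e "v (nx i)"] lorentz_sym[of "E i" "v i"] lorentz_sym[of "E i" "v (nx i)"]\<close>)
    then have ec: "e = c *\<^sub>R E i" by simp
    then have "c * c = 1" using e E_unit[OF i] by (simp add: line_normal_def lorentz_simps)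
    moreover have "(2 * lorentz x e) *\<^sub>R e = (c * c) *\<^sub>R ((2 * lorentz x (E i)) *\<^sub>R E i)" for x
      unfolding ec by (simp add: lorentz_simps ac_simps)
    ultimately show ?thesis unfolding hyp_reflection_def by (simp del: scaleR_scaleR)
  qed
  then show "side_reflections k v \<subseteq> R ` {..<k}" unfolding side_reflections_def by auto
qed

lemma carrier_BijGroup: "carrier (BijGroup S) = Bij S"
  by (simp add: BijGroup_def)

lemma R_Bij: "i < k \<Longrightarrow> R i \<in> Bij hyp_plane"
  using hyp_reflection_Bij E_unit by blast

lemma s_apply:
  assumes "g \<in> Bij hyp_plane" "x \<in> hyp_plane" "i < k"
  shows "s i g x = mirror (E i) (g x)"
proof -
  have "g x \<in> hyp_plane" using assms(1,2) by (auto simp: Bij_def bij_betw_def)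
  then show ?thesis using assms R_Bij[OF assms(3)]
    by (simp add: BijGroup_def compose_def hyp_reflection_mirror)
qed

lemma Bij_in: "g \<in> Bij hyp_plane \<Longrightarrow> x \<in> hyp_plane \<Longrightarrow> g x \<in> hyp_plane"
  by (auto simp: Bij_def bij_betw_def)

lemma Bij_eqI:
  assumes "g \<in> Bij hyp_plane" "h \<in> Bij hyp_plane" "\<And>x. x \<in> hyp_plane \<Longrightarrow> g x = h x"
  shows "g = h"
  using assms by (intro extensionalityI[of g hyp_plane]) (auto simp: Bij_def)

lemma s_Bij: "g \<in> Bij hyp_plane \<Longrightarrow> i < k \<Longrightarrow> s i g \<in> Bij hyp_plane"
  using monoid.m_closed[OF group.is_monoid[OF group_BijGroup]] R_Bij
  by (metis carrier_BijGroup)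

lemma s_involution: "g \<in> Bij hyp_plane \<Longrightarrow> i < k \<Longrightarrow> s i (s i g) = g"
  by (intro Bij_eqI s_Bij) (auto simp: s_apply s_Bij mirror_mirror E_unit)

lemma carrier_polygon_group:
  "carrier (polygon_group k v) = {foldr s ws (one (BijGroup hyp_plane)) | ws. set ws \<subseteq> {..<k}}"
proof -
  let ?G = "BijGroup hyp_plane"
  note car = carrier_BijGroup[of hyp_plane]
  have one: "one ?G \<in> Bij hyp_plane"
    using monoid.one_closed[OF group.is_monoid[OF group_BijGroup, of hyp_plane]] car by simp
  have RR: "s i (R i) = one ?G" if "i < k" for i
  proof -
    have "s i (one ?G) = R i" using monoid.r_one[OF group.is_monoid[OF group_BijGroup]] R_Bij[OF that] car by metis
    then show ?thesis using s_involution[OF one that] by simp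
  qed
  have "carrier (polygon_group k v) = generate ?G (R ` {..<k})"
    unfolding polygon_group_def carrier_subgroup_generated side_reflections_eq
    by (rule arg_cong[of _ _ "generate ?G"]) (use R_Bij car in auto)
  also have "\<dots> = {foldr s ws (one ?G) | ws. set ws \<subseteq> {..<k}}"
    by (rule generate_involutions[OF group_BijGroup]) (use R_Bij car RR in auto)
  finally show ?thesis .
qed

lemma carrier_Bij: "g \<in> carrier (polygon_group k v) \<Longrightarrow> g \<in> Bij hyp_plane"
proof -
  have "foldr s ws (one (BijGroup hyp_plane)) \<in> Bij hyp_plane" if "set ws \<subseteq> {..<k}" for ws
    using that
  proof (induction ws)
    case Nil
    then show ?case using monoid.one_closed[OF group.is_monoid[OF group_BijGroup, of hyp_plane]]
      unfolding carrier_BijGroup by simp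
  qed (use s_Bij in auto)
  then show "g \<in> carrier (polygon_group k v) \<Longrightarrow> g \<in> Bij hyp_plane"
    unfolding carrier_polygon_group by auto
qed

lemma s_carrier:
  assumes "g \<in> carrier (polygon_group k v)" "i < k"
  shows "s i g \<in> carrier (polygon_group k v)"
proof -
  obtain ws where "set ws \<subseteq> {..<k}" "g = foldr s ws (one (BijGroup hyp_plane))"
    using assms(1) unfolding carrier_polygon_group by auto
  then show ?thesis unfolding carrier_polygon_group using assms(2)
    by (intro CollectI exI[of _ "i # ws"]) auto
qed

text \<open>The sum of the vertices takes the role of an interior point of the polygon.\<close>

definition sg :: "nat \<Rightarrow> (real ^ 3 \<Rightarrow> real ^ 3) \<Rightarrow> real" where
  "sg i g = (\<Sum>l<k. lorentz (g (v l)) (E i))"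

definition mm :: "nat \<Rightarrow> nat \<Rightarrow> nat" where
  "mm i j = (if j = nx i then p (nx i) else if i = nx j then p (nx j) else 0)"

lemma sg_s:
  assumes "g \<in> Bij hyp_plane" "i < k"
  shows "sg j (s i g) = sg j g - 2 * lorentz (E i) (E j) * sg i g"
proof -
  have "sg j (s i g) = (\<Sum>l<k. lorentz (g (v l)) (E j) - 2 * lorentz (E i) (E j) * lorentz (g (v l)) (E i))"
    unfolding sg_def by (rule sum.cong) (use assms v_in in \<open>auto simp: s_apply lorentz_mirror\<close>)
  then show ?thesis unfolding sg_def by (simp add: sum_subtractf sum_distrib_left)
qed

lemma alt_apply:
  assumes "g \<in> Bij hyp_plane" "i < k" "j < k"
  shows "alt s n i j g \<in> Bij hyp_plane \<and>
    (\<forall>x\<in>hyp_plane. alt s n i j g x = alt (\<lambda>i. mirror (E i)) n i j (g x))"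
  using assms(2,3)
proof (induction n arbitrary: i j)
  case (Suc n)
  then show ?case using Suc.IH[of j i] by (auto simp: s_apply s_Bij)
qed (use assms in auto)

lemma braid_adjacent:
  assumes "g \<in> Bij hyp_plane" "i < k"
  shows "alt s (p (nx i)) i (nx i) g = alt s (p (nx i)) (nx i) i g"
proof (rule Bij_eqI)
  fix x assume x: "x \<in> hyp_plane"
  have "alt (\<lambda>i. mirror (E i)) (p (nx i)) i (nx i) (g x) = alt (\<lambda>i. mirror (E i)) (p (nx i)) (nx i) i (g x)"
    by (rule mirror_braid[of E i "nx i", OF _ _ E_adjacent[OF assms(2)] p2[OF nx_less], of "v (nx i)"])
      (use assms E_unit nx_less E_v E_nx v_in[OF nx_less] in \<open>auto simp: hyp_plane_def\<close>)
  then show "alt s (p (nx i)) i (nx i) g x = alt s (p (nx i)) (nx i) i g x"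
    using alt_apply[OF assms(1)] assms(2) nx_less x by simp
qed (use alt_apply assms nx_less in blast)+

text \<open>The element \<open>g\<close> stands for the image of the polygon under \<open>g\<close>.
  Left multiplication by \<open>R i\<close> reflects this image in the fixed line of side
  \<open>i\<close>.\<close>

sublocale mirror: mirror_polygon k s "one (BijGroup hyp_plane)" "carrier (polygon_group k v)" sg
  "\<lambda>i j. - lorentz (E i) (E j)" mm "\<lambda>i. p (nx i)"
proof
  let ?X = "carrier (polygon_group k v)"
  have gv: "g (v l) \<in> hyp_plane" if "g \<in> ?X" "l < k" for g l
    using Bij_in carrier_Bij v_in that by auto
  show "one (BijGroup hyp_plane) \<in> ?X" unfolding carrier_polygon_group
    by (intro CollectI exI[of _ "[]"]) simp
  show "s i g \<in> ?X" if "g \<in> ?X" "i < k" for g i using that s_carrier by simp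
  show "\<exists>ws. set ws \<subseteq> {..<k} \<and> foldr s ws (one (BijGroup hyp_plane)) = g" if "g \<in> ?X" for g
    using that unfolding carrier_polygon_group by auto
  show "s i (s i g) = g" if "g \<in> ?X" "i < k" for g i using that s_involution carrier_Bij by simp
  show "sg i (one (BijGroup hyp_plane)) < 0" if "i < k" for i
  proof -
    have "sg i (one (BijGroup hyp_plane)) = (\<Sum>l<k. lorentz (v l) (E i))"
      unfolding sg_def by (rule sum.cong) (auto simp: BijGroup_def v_in)
    also have "\<dots> < (\<Sum>l<k. 0)"
    proof (rule sum_strict_mono_ex1)
      show "\<exists>l\<in>{..<k}. lorentz (v l) (E i) < 0"
        using side_facts(6)[OF nx_less, of i] pv_nx[OF that] nx_less[of "nx i"] by auto
    qed (use E_nonpos that in auto)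
    finally show ?thesis by simp
  qed
  show "sg i (s i g) = - sg i g" if "g \<in> ?X" "i < k" for g i
    using sg_s[OF carrier_Bij[OF that(1)] that(2), of i] E_unit[OF that(2)] by simp
  show "sg i (s j g) = sg i g + 2 * - lorentz (E i) (E j) * sg j g"
    if "g \<in> ?X" "i < k" "j < k" "i \<noteq> j" for g i j
    using sg_s[OF carrier_Bij[OF that(1)] that(3), of i] by (simp add: lorentz_sym[of "E j" "E i"])
  show "- lorentz (E i) (E j) = - lorentz (E j) (E i)" for i j by (simp add: lorentz_sym)
  have nn: "\<not> (j = nx i \<and> i = nx j)" if "i < k" for i j using nx_neq[OF that] by auto
  show "mm i j = mm j i" if "i < k" "j < k" for i j using nn[OF that(1), of j] unfolding mm_def by auto
  show "2 \<le> mm i j \<and> - lorentz (E i) (E j) = cos (pi / real (mm i j))"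
    if "i < k" "j < k" "i \<noteq> j" "mm i j \<noteq> 0" for i j
  proof (cases "j = nx i")
    case True
    then show ?thesis using E_adjacent[OF that(1)] p2[OF nx_less, of i] by (simp add: mm_def)
  next
    case False
    then have "i = nx j" using that(4) unfolding mm_def by (auto split: if_splits)
    then show ?thesis using E_adjacent[OF that(2)] p2[OF nx_less, of j] False
      by (simp add: mm_def lorentz_sym[of "E (nx j)" "E j"])
  qed
  show "1 \<le> - lorentz (E i) (E j)" if "i < k" "j < k" "i \<noteq> j" "mm i j = 0" for i j
  proof -
    have "j \<noteq> nx i" "i \<noteq> nx j" using that(4) p2[OF nx_less, of i] p2[OF nx_less, of j]
      unfolding mm_def by (auto split: if_splits)
    then show ?thesis using E_nonadjacent[OF that(1-3)] by simp
  qed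
  show "alt s (mm i j) i j g = alt s (mm i j) j i g"
    if "g \<in> ?X" "i < k" "j < k" "i \<noteq> j" for g i j
    using braid_adjacent[OF carrier_Bij[OF that(1)]] that unfolding mm_def by auto
  show "3 \<le> k" by (rule k3)
  show "2 \<le> p (nx i)" if "i < k" for i using p2 nx_less by simp
  show "mm i j = (if j = nx i then p (nx i) else if i = nx j then p (nx j) else 0)" for i j
    by (rule mm_def)
  show "\<not> (sg i g > 0 \<and> sg j g > 0)"
    if "g \<in> ?X" "i < k" "j < k" "i \<noteq> j" "j \<noteq> nx i" "i \<noteq> nx j" for g i j
  proof -
    have "sg i g + sg j g = (\<Sum>l<k. lorentz (g (v l)) (E i) + lorentz (g (v l)) (E j))"
      unfolding sg_def by (simp add: sum.distrib)
    also have "\<dots> < (\<Sum>l<k. 0)"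
      using k3 by (intro sum_strict_mono) (auto intro!: outer_halfplanes_disjoint that gv)
    finally show ?thesis by simp
  qed
  show "\<not> (sg i g > 0 \<and> sg (nx i) g > 0 \<and> sg (nx (nx i)) g > 0)" if "g \<in> ?X" "i < k" for g i
  proof -
    \<comment> \<open>The products of this vector with the normals are the signs, and it remains in
      the future cone as a sum of points of the plane.\<close>
    define y where "y = (\<Sum>l<k. g (v l))"
    have y: "lorentz y (E j) = sg j g" for j unfolding y_def sg_def by (rule lorentz_sum)
    have "lorentz y (v (nx i)) = (\<Sum>l<k. lorentz (g (v l)) (v (nx i)))" unfolding y_def by (rule lorentz_sum)
    also have "\<dots> < (\<Sum>l<k. 0)"
      using k3 by (intro sum_strict_mono) (auto intro!: hyp_plane_neg that gv v_in nx_less)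
    finally have "lorentz (v (nx i)) y < 0" by (simp add: lorentz_sym)
    then show ?thesis using three_outer_halfplanes[OF nx_less, of i y] pv_nx[OF that(2)] y by simp
  qed
qed

theorem polygon_growth_series:
  "Abs_fps (\<lambda>n. of_nat (sphere_size (polygon_group k v) (side_reflections k v) n)) *
     (1 + fps_X - of_nat k * fps_X + (\<Sum>i<k. fps_X ^ p i * inverse (\<Sum>l<p i. fps_X ^ l))) = (1 + fps_X :: complex fps)"
proof -
  have "word_length (polygon_group k v) (side_reflections k v) g = mirror.L g" for g
    unfolding side_reflections_eq word_length_image mirror.L_def polygon_group_def by simp
  then have "Abs_fps (\<lambda>n. of_nat (sphere_size (polygon_group k v) (side_reflections k v) n)) =
      mirror.series (\<lambda>_. True)"
    unfolding sphere_size_def mirror.series_def by simp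
  moreover have "(\<Sum>i<k. fps_X ^ p (nx i) * inverse (\<Sum>l<p (nx i). fps_X ^ l)) =
      (\<Sum>i<k. fps_X ^ p i * inverse (\<Sum>l<p i. fps_X ^ l) :: complex fps)"
  proof (rule sum.reindex_bij_betw[of nx])
    show "bij_betw nx {..<k} {..<k}"
      by (rule bij_betw_byWitness[of _ pv]) (use nx_less pv_less nx_pv pv_nx in auto)
  qed
  ultimately show ?thesis using mirror.growth_series by simp
qed

end

section \<open>Power series with nonnegative coefficients\<close>

text \<open>A variant of Pringsheim's theorem: on a circle of radius \<open>r < R\<close> the series is dominated by its value
  at the positive real point, which stays bounded since \<open>\<phi>\<close> has no zero below \<open>R\<close>. So \<open>f\<close> has no zero
  on the closed disc of radius \<open>r\<close>.\<close>

lemma conv_radius_nonneg_quotient: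
  fixes a :: "nat \<Rightarrow> nat" and F :: "complex fps" and f :: "complex \<Rightarrow> complex"
  defines "A \<equiv> Abs_fps (\<lambda>n. of_nat (a n))"
  assumes AF: "A * F = 1 + fps_X" and f: "f has_fps_expansion F" "fps_nth F 0 \<noteq> 0"
    and holo: "f holomorphic_on ball 0 1"
    and \<phi>: "\<And>t. 0 \<le> t \<Longrightarrow> t < 1 \<Longrightarrow> f (of_real t) = of_real (\<phi> t)"
    and R: "0 < R" "R < 1" "\<phi> R = 0" "\<And>t. 0 \<le> t \<Longrightarrow> t < R \<Longrightarrow> \<phi> t > 0"
    and cont: "continuous_on {0..R} \<phi>"
  shows "fps_conv_radius A = ereal R"
proof -
  have "A = (1 + fps_X) * inverse F"
    using AF inverse_mult_eq_1'[OF f(2)] by (metis mult.assoc mult.right_neutral)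
  then have hA: "(\<lambda>z. (1 + z) * inverse (f z)) has_fps_expansion A"
    using f by (auto intro!: fps_expansion_intros)
  then have rpos: "fps_conv_radius A > 0" by (simp add: has_fps_expansion_def)
  have prod: "eval_fps A z * f z = 1 + z" if z: "ereal (norm z) < fps_conv_radius A" "norm z < 1" for z
  proof -
    obtain r where r: "norm z < r" "r < 1" "ereal r < fps_conv_radius A"
    proof -
      from z have "ereal (norm z) < min 1 (fps_conv_radius A)" by auto
      then obtain r where "ereal (norm z) < ereal r" "ereal r < min 1 (fps_conv_radius A)"
        using ereal_dense2 by blast
      then show thesis using that by auto
    qed
    have "(\<lambda>z. eval_fps A z * f z) has_fps_expansion (1 + fps_X)"
      unfolding AF[symmetric] by (intro fps_expansion_intros eval_fps_has_fps_expansion rpos f)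
    moreover have "(\<lambda>z. eval_fps A z * f z) holomorphic_on ball 0 r"
    proof (intro holomorphic_intros)
      show "(ball 0 r :: complex set) \<subseteq> eball 0 (fps_conv_radius A)"
      proof (rule subsetI)
        fix x :: complex assume "x \<in> ball 0 r"
        then have "ereal (dist 0 x) < ereal r" by simp
        then have "ereal (dist 0 x) < fps_conv_radius A" using r(3) by (rule less_trans)
        then show "x \<in> eball 0 (fps_conv_radius A)" by simp
      qed
      show "f holomorphic_on ball 0 r" using holo r by (auto intro: holomorphic_on_subset)
    qed
    ultimately have "eval_fps (1 + fps_X) z = eval_fps A z * f z"
      using has_fps_expansion_imp_eval_fps_eq r(1) by blast
    then show ?thesis by (simp add: eval_fps_add)
  qed
  \<comment> \<open>If the series converged at \<open>R\<close>, the product identity would read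
    \<open>0 = 1 + R\<close> there.\<close>
  have "\<not> ereal R < fps_conv_radius A"
  proof
    assume "ereal R < fps_conv_radius A"
    then have "eval_fps A (of_real R) * f (of_real R) = 1 + of_real R"
      using prod[of "of_real R"] R by simp
    then have "1 + complex_of_real R = 0" using \<phi>[of R] R by simp
    then have "1 + R = 0" by (metis of_real_1 of_real_add of_real_eq_0_iff)
    then show False using R by simp
  qed
  moreover have "\<not> fps_conv_radius A < ereal R"
  proof
    assume less: "fps_conv_radius A < ereal R"
    then obtain r where r: "fps_conv_radius A = ereal r" using rpos by (cases "fps_conv_radius A") auto
    have r0: "0 < r" "r < R" using rpos less r by auto
    have "compact (\<phi> ` {0..r})" using cont r0 by (intro compact_continuous_image) (auto elim: continuous_on_subset)
    moreover have "\<phi> ` {0..r} \<noteq> {}" using r0 by auto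
    ultimately obtain \<mu> where \<mu>: "\<mu> \<in> \<phi> ` {0..r}" "\<And>x. x \<in> \<phi> ` {0..r} \<Longrightarrow> \<mu> \<le> x"
      using compact_attains_inf by metis
    have \<mu>0: "\<mu> > 0" using \<mu>(1) R(4) r0 by auto
    \<comment> \<open>Nonnegative coefficients bound the value at \<open>z\<close> by that at
      \<open>norm z\<close>, which is \<open>(1 + norm z) / \<phi> (norm z)\<close>; the constant 2
      bounds the numerator.\<close>
    have bound: "norm (eval_fps A z) \<le> 2 / \<mu>" if z: "norm z < r" for z
    proof -
      have sm: "summable (\<lambda>n. norm (fps_nth A n * z ^ n))"
        by (rule norm_summable_fps) (use z r in auto)
      have "summable (\<lambda>n. fps_nth A n * of_real (norm z) ^ n)"
        by (rule summable_fps) (use z r in auto)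
      then have "complex_of_real (\<Sum>n. norm (fps_nth A n * z ^ n)) = eval_fps A (of_real (norm z))"
        unfolding eval_fps_def using sm by (simp add: suminf_of_real A_def norm_mult norm_power)
      moreover have "norm (eval_fps A z) \<le> (\<Sum>n. norm (fps_nth A n * z ^ n))"
        unfolding eval_fps_def by (rule summable_norm[OF sm])
      moreover have "eval_fps A (of_real (norm z)) * of_real (\<phi> (norm z)) = 1 + of_real (norm z)"
        using prod[of "of_real (norm z)"] \<phi>[of "norm z"] z r0 R r by simp
      ultimately have le: "norm (eval_fps A z) \<le> (\<Sum>n. norm (fps_nth A n * z ^ n))"
        and eq: "complex_of_real ((\<Sum>n. norm (fps_nth A n * z ^ n)) * \<phi> (norm z)) = of_real (1 + norm z)"
        by auto
      have "(\<Sum>n. norm (fps_nth A n * z ^ n)) * \<phi> (norm z) = 1 + norm z"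
        using eq by (simp only: of_real_eq_iff)
      moreover have ge: "\<mu> \<le> \<phi> (norm z)" using \<mu>(2) z by auto
      ultimately have "(\<Sum>n. norm (fps_nth A n * z ^ n)) = (1 + norm z) / \<phi> (norm z)"
        using \<mu>0 by (simp add: field_simps)
      also have "\<dots> \<le> 2 / \<mu>" using z r0 R ge \<mu>0 by (intro frac_le) auto
      finally show ?thesis using le by linarith
    qed
    \<comment> \<open>Inside the disc a zero of \<open>f\<close> would give
      \<open>1 + z = 0\<close>. On the circle the bound is carried over along the radius, so that a
      zero would again force \<open>z = -1\<close>, whose norm exceeds \<open>r\<close>.\<close>
    have nz: "f z \<noteq> 0" if z: "norm z \<le> r" for z
    proof (cases "norm z < r")
      case True
      have "1 + z \<noteq> 0"
      proof
        assume "1 + z = 0"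
        then have "z = -1" by (simp add: add_eq_0_iff)
        then show False using z r0 R by simp
      qed
      then show ?thesis using prod[of z] True r r0 R by auto
    next
      case False
      then have zr: "norm z = r" using z by simp
      show ?thesis
      proof
        assume fz: "f z = 0"
        have "norm (of_real t * z) < 1" if "t \<in> {0..1}" for t
        proof -
          have "t * r \<le> 1 * r" using that r0 by (intro mult_right_mono) auto
          then have "t * r < 1" using r0 R by linarith
          then show ?thesis using that zr by (simp add: norm_mult)
        qed
        then have "continuous_on {0..1} (\<lambda>t. f (of_real t * z))"
          by (intro continuous_on_compose2[OF holomorphic_on_imp_continuous_on[OF holo]])
            (auto intro!: continuous_intros)
        then have c: "continuous_on (closure {0..<1}) (\<lambda>t. 2 / \<mu> * norm (f (of_real t * z)) - norm (1 + of_real t * z))"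
          using \<mu>0 by (auto intro!: continuous_intros)
        have "0 \<le> 2 / \<mu> * norm (f (of_real t * z)) - norm (1 + of_real t * z)" if t: "t \<in> {0..<1}" for t
        proof -
          have nt: "norm (of_real t * z) < r" using t zr r0 by (simp add: norm_mult)
          then have "norm (1 + of_real t * z) = norm (eval_fps A (of_real t * z)) * norm (f (of_real t * z))"
            using prod[of "of_real t * z"] r r0 R by (simp add: norm_mult[symmetric])
          also have "\<dots> \<le> 2 / \<mu> * norm (f (of_real t * z))"
            by (rule mult_right_mono[OF bound[OF nt]]) simp
          finally show ?thesis by simp
        qed
        from continuous_ge_on_closure[OF c _ this, of 1] have "norm (1 + z) \<le> 0" using fz by simp
        then have "z = -1" by (simp add: add_eq_0_iff)
        then show False using zr r0 R by simp
      qed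
    qed
    \<comment> \<open>The zeros in a slightly larger closed disc form a compact set and stay away
      from the disc of radius \<open>r\<close>. Hence the quotient is holomorphic beyond
      \<open>r\<close>, contrary to the choice of \<open>r\<close> as radius of convergence.\<close>
    have "\<exists>\<rho>>r. \<rho> < 1 \<and> (\<forall>z\<in>ball 0 \<rho>. f z \<noteq> 0)"
    proof -
      let ?d = "(r + 1) / 2"
      define Z where "Z = {z \<in> cball 0 ?d. f z = 0}"
      have d: "r < ?d" "?d < 1" using r0 R by auto
      have cf: "continuous_on (cball 0 ?d) f"
        using holomorphic_on_imp_continuous_on[OF holo] d by (auto elim!: continuous_on_subset)
      have "closed Z" unfolding Z_def by (rule continuous_closed_preimage_constant[OF cf closed_cball])
      moreover have "bounded Z" by (rule bounded_subset[OF bounded_cball[of 0 ?d]]) (auto simp: Z_def)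
      ultimately have "compact Z" by (simp add: compact_eq_bounded_closed)
      show ?thesis
      proof (cases "Z = {}")
        case True
        then show ?thesis using d unfolding Z_def by (intro exI[of _ ?d]) auto
      next
        case False
        have "compact (norm ` Z)" using \<open>compact Z\<close> by (intro compact_continuous_image continuous_intros)
        then obtain z where z: "z \<in> Z" "\<And>w. w \<in> Z \<Longrightarrow> norm z \<le> norm w"
          using compact_attains_inf[of "norm ` Z"] False by auto
        have zd: "norm z \<le> ?d" "f z = 0" using z(1) unfolding Z_def by auto
        then have "r < norm z" using nz[of z] by force
        moreover have "f w \<noteq> 0" if "w \<in> ball 0 (norm z)" for w
        proof
          assume "f w = 0"
          then have "w \<in> Z" using that zd unfolding Z_def by auto
          then show False using z(2)[of w] that by auto
        qed
        ultimately show ?thesis using zd d by (intro exI[of _ "norm z"]) auto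
      qed
    qed
    then obtain \<rho> where \<rho>: "r < \<rho>" "\<rho> < 1" "\<And>z. z \<in> ball 0 \<rho> \<Longrightarrow> f z \<noteq> 0" by auto
    have "(\<lambda>z. (1 + z) * inverse (f z)) holomorphic_on eball 0 (ereal \<rho>)"
      using \<rho> by (intro holomorphic_intros holomorphic_on_subset[OF holo]) auto
    from holomorphic_on_imp_fps_conv_radius_ge[OF hA this] show False using r \<rho> by simp
  qed
  ultimately show ?thesis by simp
qed

section \<open>The denominator\<close>

text \<open>Polymorphic, because the real function locates \<open>R\<close> and the complex one has
  the power series expansion.\<close>

definition denom :: "nat \<Rightarrow> (nat \<Rightarrow> nat) \<Rightarrow> 'a :: real_normed_field \<Rightarrow> 'a" where
  "denom k p t = 1 + t - of_nat k * t + (\<Sum>i<k. t ^ p i * inverse (\<Sum>l<p i. t ^ l))"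

lemma geometric_nonzero:
  fixes z :: "'a :: real_normed_field"
  assumes "norm z < 1" "0 < n"
  shows "(\<Sum>l<n. z ^ l) \<noteq> 0"
proof
  assume "(\<Sum>l<n. z ^ l) = 0"
  then have "1 - z ^ n = 0" using one_diff_power_eq[of z n] by simp
  then have "norm z ^ n = 1" by (metis eq_iff_diff_eq_0 norm_one norm_power)
  then show False using assms power_less_one_iff[of "norm z" n] by simp
qed

lemma geometric_pos:
  fixes t :: real
  assumes "0 \<le> t" "0 < n"
  shows "(\<Sum>l<n. t ^ l) > 0"
  using assms by (intro sum_pos2[of _ 0]) auto

lemma polygon_growth_radius:
  assumes k: "3 \<le> k" and p: "\<And>i. i < k \<Longrightarrow> 2 \<le> p i"
    and hyp: "(\<Sum>i<k. 1 / real (p i)) < real k - 2"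
    and ser: "Abs_fps (\<lambda>n. of_nat (a n)) * (1 + fps_X - of_nat k * fps_X +
      (\<Sum>i<k. fps_X ^ p i * inverse (\<Sum>l<p i. fps_X ^ l))) = (1 + fps_X :: complex fps)"
  obtains R where "0 < R" "R < 1" "denom k p R = (0 :: real)" "\<And>t. 0 < t \<Longrightarrow> t < R \<Longrightarrow> denom k p t \<noteq> 0"
    "limsup (\<lambda>n. ereal (root n (real (a n)))) = ereal (1 / R)"
proof -
  let ?\<phi> = "denom k p :: real \<Rightarrow> real"
  let ?f = "denom k p :: complex \<Rightarrow> complex"
  define F :: "complex fps" where
    "F = 1 + fps_X - of_nat k * fps_X + (\<Sum>i<k. fps_X ^ p i * inverse (\<Sum>l<p i. fps_X ^ l))"
  have pos: "(\<Sum>l<p i. t ^ l) > 0" if "i < k" "0 \<le> t" for i and t :: real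
    using geometric_pos[of t "p i"] p[OF that(1)] that by auto
  have cont: "continuous_on {0..1} ?\<phi>"
    unfolding denom_def by (intro continuous_intros) (use pos in \<open>force\<close>)
  have "(\<Sum>i<k. 0 ^ p i * inverse (\<Sum>l<p i. 0 ^ l)) = (0 :: real)"
    using p by (intro sum.neutral) (auto simp: power_0_left)
  then have \<phi>0: "?\<phi> 0 = 1" unfolding denom_def by simp
  \<comment> \<open>The value at 1 is \<open>2 - k\<close> plus the sum of the
    \<open>1 / p i\<close>. Here the condition for a hyperbolic polygon enters, and with the value 1
    at 0 it forces a zero in between.\<close>
  have \<phi>1: "?\<phi> 1 < 0" using hyp unfolding denom_def by (simp add: field_simps)
  define Z where "Z = {t \<in> {0..1}. ?\<phi> t = 0}"
  have "closed Z" unfolding Z_def by (rule continuous_closed_preimage_constant[OF cont closed_atLeastAtMost])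
  moreover have "bounded Z" by (rule bounded_subset[OF bounded_closed_interval[of 0 1]]) (auto simp: Z_def)
  ultimately have "compact Z" by (simp add: compact_eq_bounded_closed)
  moreover have "Z \<noteq> {}"
    using IVT2'[of ?\<phi> 1 0 0] cont \<phi>0 \<phi>1 unfolding Z_def by force
  ultimately obtain R where RZ: "R \<in> Z" and Rmin: "\<And>t. t \<in> Z \<Longrightarrow> R \<le> t"
    using compact_attains_inf by metis
  have R: "0 < R" "R < 1" "?\<phi> R = 0"
    using RZ \<phi>0 \<phi>1 unfolding Z_def by (auto simp: order_less_le)
  have nz: "?\<phi> t \<noteq> 0" if "0 \<le> t" "t < R" for t
    using Rmin[of t] that R unfolding Z_def by auto
  have \<phi>pos: "?\<phi> t > 0" if t: "0 \<le> t" "t < R" for t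
  proof (rule ccontr)
    assume "\<not> ?\<phi> t > 0"
    then obtain u where "0 \<le> u" "u \<le> t" "?\<phi> u = 0"
      using IVT2'[of ?\<phi> t 0 0] \<phi>0 t R continuous_on_subset[OF cont, of "{0..t}"] by auto
    then show False using nz[of u] t by simp
  qed
  have gz: "(\<Sum>l<p i. z ^ l) \<noteq> 0" if "i < k" "norm z < 1" for i and z :: complex
    using geometric_nonzero[OF that(2), of "p i"] p[OF that(1)] by simp
  have nth0: "fps_nth (\<Sum>l<p i. fps_X ^ l) 0 = (1 :: complex)" if "i < k" for i
  proof -
    have "fps_nth (\<Sum>l<p i. fps_X ^ l) 0 = (\<Sum>l<p i. if l = 0 then 1 else 0 :: complex)"
      unfolding fps_sum_nth by (rule sum.cong) auto
    then show ?thesis using p[OF that] by (simp add: sum.delta)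
  qed
  have exp: "?f has_fps_expansion F"
    unfolding denom_def[abs_def] F_def
  proof (intro has_fps_expansion_add has_fps_expansion_sum has_fps_expansion_mult has_fps_expansion_inverse
      has_fps_expansion_fps_X_power has_fps_expansion_diff has_fps_expansion_1 has_fps_expansion_fps_X)
    show "(\<lambda>x. of_nat k :: complex) has_fps_expansion of_nat k"
      using has_fps_expansion_const[of "of_nat k :: complex"] by (simp add: fps_of_nat)
  qed (use nth0 in auto)
  have "fps_conv_radius (Abs_fps (\<lambda>n. of_nat (a n) :: complex)) = ereal R"
  proof (rule conv_radius_nonneg_quotient[of a F ?f ?\<phi> R])
    show "Abs_fps (\<lambda>n. of_nat (a n)) * F = 1 + fps_X" unfolding F_def by (rule ser)
    show "?f has_fps_expansion F" by (rule exp)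
    have "fps_nth F 0 = ?f 0" using has_fps_expansion_imp_0_eq_fps_nth_0[OF exp] by simp
    also have "?f 0 = 1"
    proof -
      have "(\<Sum>i<k. 0 ^ p i * inverse (\<Sum>l<p i. 0 ^ l)) = (0 :: complex)"
        using p by (intro sum.neutral) (auto simp: power_0_left)
      then show ?thesis unfolding denom_def by simp
    qed
    finally show "fps_nth F 0 \<noteq> 0" by simp
    show "?f holomorphic_on ball 0 1"
      unfolding denom_def by (intro holomorphic_intros) (use gz in auto)
    show "?f (of_real t) = of_real (?\<phi> t)" for t unfolding denom_def by simp
    show "continuous_on {0..R} ?\<phi>" by (rule continuous_on_subset[OF cont]) (use R in auto)
  qed (use R \<phi>pos in auto)
  then have "inverse (limsup (\<lambda>n. ereal (root n (real (a n))))) = ereal R"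
    unfolding fps_conv_radius_def conv_radius_def by simp
  then have "limsup (\<lambda>n. ereal (root n (real (a n)))) = ereal (1 / R)"
    using R by (cases "limsup (\<lambda>n. ereal (root n (real (a n))))") (auto simp: field_simps split: if_splits)
  then show thesis using that[of R] R nz by simp
qed

section \<open>Eigenvectors of Coxeter transformations\<close>

text \<open>A reflection changes a single coordinate, so a product of the generators is a sequence
  of updates in place.\<close>

definition sweep :: "nat \<Rightarrow> (nat \<Rightarrow> nat \<Rightarrow> complex) \<Rightarrow> nat \<Rightarrow> (nat \<Rightarrow> complex) \<Rightarrow> nat \<Rightarrow> complex" where
  "sweep N B j z = (\<lambda>r. if r = j then z j - (\<Sum>c<N. B j c * z c) else z r)"

definition gram2 :: "('s \<Rightarrow> 's \<Rightarrow> nat) \<Rightarrow> 's list \<Rightarrow> nat \<Rightarrow> nat \<Rightarrow> complex" where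
  "gram2 m ss i c = of_real (2 * coxeter_form m (ss ! i) (ss ! c))"

lemma geometric_reflection_apply:
  assumes "i < length ss"
  shows "map_mat complex_of_real (geometric_reflection m ss i) *\<^sub>v Matrix.vec (length ss) x =
    Matrix.vec (length ss) (sweep (length ss) (gram2 m ss) i x)"
proof (rule eq_vecI)
  let ?N = "length ss"
  fix r assume "r < dim_vec (Matrix.vec ?N (sweep ?N (gram2 m ss) i x))"
  then have r: "r < ?N" by simp
  have "vec_index (map_mat complex_of_real (geometric_reflection m ss i) *\<^sub>v Matrix.vec ?N x) r =
    (\<Sum>c\<in>{0..<?N}. (of_real ((if r = c then 1 else 0) -
       (if r = i then 2 * coxeter_form m (ss ! i) (ss ! c) else 0)) :: complex) * x c)"
    using r by (simp add: scalar_prod_def geometric_reflection_def)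
  also have "\<dots> = (\<Sum>c\<in>{0..<?N}. (if r = c then x c else 0) - (if r = i then gram2 m ss i c * x c else 0))"
    by (rule sum.cong) (auto simp: gram2_def algebra_simps)
  also have "\<dots> = sweep ?N (gram2 m ss) i x r"
    using r by (simp add: sum_subtractf sum.delta sweep_def lessThan_atLeast0)
  finally show "vec_index (map_mat complex_of_real (geometric_reflection m ss i) *\<^sub>v Matrix.vec ?N x) r =
    vec_index (Matrix.vec ?N (sweep ?N (gram2 m ss) i x)) r" using r by simp
qed (simp add: geometric_reflection_def)

lemma coxeter_fold_apply:
  fixes ss :: "'s list" and m :: "'s \<Rightarrow> 's \<Rightarrow> nat" and x :: "nat \<Rightarrow> complex"
  assumes "set is \<subseteq> {..<length ss}"
  defines "A \<equiv> foldr (\<lambda>i A. geometric_reflection m ss i * A) is (1\<^sub>m (length ss))"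
  shows "A \<in> carrier_mat (length ss) (length ss) \<and>
    map_mat complex_of_real A *\<^sub>v Matrix.vec (length ss) x =
      Matrix.vec (length ss) (foldr (sweep (length ss) (gram2 m ss)) is x)"
  using assms(1) unfolding A_def
proof (induction "is")
  case Nil
  have "map_mat complex_of_real (1\<^sub>m (length ss)) = 1\<^sub>m (length ss)" by auto
  then show ?case by simp
next
  case (Cons i "is")
  let ?N = "length ss"
  let ?A = "foldr (\<lambda>i A. geometric_reflection m ss i * A) is (1\<^sub>m ?N)"
  have i: "i < ?N" and IH: "?A \<in> carrier_mat ?N ?N"
    "map_mat complex_of_real ?A *\<^sub>v Matrix.vec ?N x = Matrix.vec ?N (foldr (sweep ?N (gram2 m ss)) is x)"
    using Cons by auto
  have G: "geometric_reflection m ss i \<in> carrier_mat ?N ?N" by (simp add: geometric_reflection_def)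
  have "map_mat complex_of_real (geometric_reflection m ss i * ?A) *\<^sub>v Matrix.vec ?N x =
      (map_mat complex_of_real (geometric_reflection m ss i) * map_mat complex_of_real ?A) *\<^sub>v Matrix.vec ?N x"
    by (simp add: of_real_hom.mat_hom_mult[OF G IH(1)])
  also have "\<dots> = map_mat complex_of_real (geometric_reflection m ss i) *\<^sub>v (map_mat complex_of_real ?A *\<^sub>v Matrix.vec ?N x)"
    by (rule assoc_mult_mat_vec[of _ ?N ?N _ ?N]) (use G IH in auto)
  also have "\<dots> = Matrix.vec ?N (sweep ?N (gram2 m ss) i (foldr (sweep ?N (gram2 m ss)) is x))"
    unfolding IH(2) by (rule geometric_reflection_apply[OF i])
  finally show ?case using G IH(1) by simp
qed

lemma neg_sum_eq: "q + r + t + u = 0 \<Longrightarrow> - r - t - u = (q :: complex)"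
proof -
  assume "q + r + t + u = 0"
  moreover have "- r - t - u = q - (q + r + t + u)" by simp
  ultimately show ?thesis by simp
qed

lemma sum_zero_iff: "l * q + q + t + u = 0 \<longleftrightarrow> (l + 1) * q = - t + 0 + - (u :: complex)"
proof -
  have "l * q + q + t + u = (l + 1) * q - (- t + 0 + - u)" by (simp add: algebra_simps)
  then show ?thesis by (simp only: right_minus_eq)
qed

lemma sum_split_at:
  fixes f :: "nat \<Rightarrow> complex"
  assumes "j < N"
  shows "(\<Sum>c<N. f c) = (\<Sum>c<j. f c) + f j + (\<Sum>c\<in>{j<..<N}. f c)"
proof -
  have "{..<N} = {..<j} \<union> {j} \<union> {j<..<N}" using assms by auto
  then have "(\<Sum>c<N. f c) = sum f ({..<j} \<union> {j} \<union> {j<..<N})" by simp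
  also have "\<dots> = (\<Sum>c<j. f c) + f j + (\<Sum>c\<in>{j<..<N}. f c)"
    by (subst sum.union_disjoint; auto)+
  finally show ?thesis .
qed

text \<open>The updates run from the last coordinate down. When \<open>i\<close> is updated, the
  entries above it are already new and those below it are still old; the diagonal entry 2 turns
  \<open>x i\<close> into \<open>- x i\<close>. This is a Gauss-Seidel step.\<close>

lemma sweep_fold:
  fixes x :: "nat \<Rightarrow> complex"
  assumes "\<And>i. i < N \<Longrightarrow> B i i = 2" "j \<le> N"
  defines "y \<equiv> foldr (sweep N B) [j..<N] x"
  shows "(\<forall>i<j. y i = x i) \<and> (\<forall>i. j \<le> i \<longrightarrow> i < N \<longrightarrow>
    y i = - x i - (\<Sum>c<i. B i c * x c) - (\<Sum>c\<in>{i<..<N}. B i c * y c))"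
  using assms(2) unfolding y_def
proof (induction rule: inc_induct)
  case (step j)
  define z where "z = foldr (sweep N B) [Suc j..<N] x"
  have y: "foldr (sweep N B) [j..<N] x = sweep N B j z"
    using step(2) by (simp add: upt_conv_Cons z_def)
  have lt: "z i = x i" if "i \<le> j" for i using step(3) that unfolding z_def by auto
  have IH: "z i = - x i - (\<Sum>c<i. B i c * x c) - (\<Sum>c\<in>{i<..<N}. B i c * z c)"
    if "Suc j \<le> i" "i < N" for i using step(3) that unfolding z_def[symmetric] by blast
  have ne: "sweep N B j z i = z i" if "i \<noteq> j" for i using that by (simp add: sweep_def)
  have "sweep N B j z j = - x j - (\<Sum>c<j. B j c * x c) - (\<Sum>c\<in>{j<..<N}. B j c * z c)"
  proof -
    have "(\<Sum>c<N. B j c * z c) = (\<Sum>c<j. B j c * x c) + 2 * x j + (\<Sum>c\<in>{j<..<N}. B j c * z c)"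
      unfolding sum_split_at[OF step(2)] using lt assms(1)[OF step(2)] by simp
    then show ?thesis using lt by (simp add: sweep_def)
  qed
  then have jj: "sweep N B j z j = - x j - (\<Sum>c<j. B j c * x c) - (\<Sum>c\<in>{j<..<N}. B j c * sweep N B j z c)"
    using ne by simp
  have "sweep N B j z i = - x i - (\<Sum>c<i. B i c * x c) - (\<Sum>c\<in>{i<..<N}. B i c * sweep N B j z c)"
    if "j \<le> i" "i < N" for i
  proof (cases "i = j")
    case False
    have "(\<Sum>c\<in>{i<..<N}. B i c * sweep N B j z c) = (\<Sum>c\<in>{i<..<N}. B i c * z c)"
      by (rule sum.cong) (use ne \<open>j \<le> i\<close> in auto)
    then show ?thesis unfolding ne[OF False] using IH[of i] that False by simp
  qed (use jj in blast)
  moreover have "\<forall>i<j. sweep N B j z i = x i" using lt ne by simp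
  ultimately show ?case unfolding y by blast
qed simp

text \<open>Up to the sign, the Coxeter transformation is the quotient of the lower and the upper
  triangular half of the doubled Gram matrix.\<close>

lemma coxeter_eigenvalue_iff:
  fixes ss :: "'s list" and m :: "'s \<Rightarrow> 's \<Rightarrow> nat"
  assumes "\<And>s. coxeter_form m s s = 1"
  defines "N \<equiv> length ss" and "B \<equiv> gram2 m ss"
  shows "eigenvalue (map_mat complex_of_real (coxeter_transformation m ss)) l \<longleftrightarrow>
    (\<exists>x. (\<exists>i<N. x i \<noteq> 0) \<and>
      (\<forall>i<N. l * x i + x i + (\<Sum>c<i. B i c * x c) + l * (\<Sum>c\<in>{i<..<N}. B i c * x c) = 0))"
proof -
  let ?C = "map_mat complex_of_real (coxeter_transformation m ss)"
  have C: "?C \<in> carrier_mat N N"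
    and app: "?C *\<^sub>v Matrix.vec N x = Matrix.vec N (foldr (sweep N B) [0..<N] x)" for x
    using coxeter_fold_apply[of "[0..<N]" ss m x] unfolding coxeter_transformation_def N_def B_def
    by (auto simp: lessThan_atLeast0)
  have Bii: "B i i = 2" for i unfolding B_def gram2_def using assms(1) by simp
  have fold: "foldr (sweep N B) [0..<N] x i = - x i - (\<Sum>c<i. B i c * x c)
     - (\<Sum>c\<in>{i<..<N}. B i c * foldr (sweep N B) [0..<N] x c)" if "i < N" for i x
    using sweep_fold[of N B 0 x] Bii that by blast
  have ev: "eigenvalue ?C l \<longleftrightarrow> (\<exists>x. (\<exists>i<N. x i \<noteq> 0) \<and> (\<forall>i<N. foldr (sweep N B) [0..<N] x i = l * x i))"
  proof
    assume "eigenvalue ?C l"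
    then obtain w where w: "w \<in> carrier_vec N" "w \<noteq> 0\<^sub>v N" "?C *\<^sub>v w = l \<cdot>\<^sub>v w"
      unfolding eigenvalue_def eigenvector_def using C by auto
    define x where "x = vec_index w"
    have wx: "w = Matrix.vec N x" using w(1) unfolding x_def by auto
    have "\<exists>i<N. x i \<noteq> 0"
    proof (rule ccontr)
      assume "\<not> (\<exists>i<N. x i \<noteq> 0)"
      then have "w = 0\<^sub>v N" unfolding wx by auto
      then show False using w(2) by simp
    qed
    moreover have "foldr (sweep N B) [0..<N] x i = l * x i" if "i < N" for i
    proof -
      have "vec_index (Matrix.vec N (foldr (sweep N B) [0..<N] x)) i = vec_index (l \<cdot>\<^sub>v Matrix.vec N x) i"
        using w(3) unfolding wx app by simp
      then show ?thesis using that by simp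
    qed
    ultimately show "\<exists>x. (\<exists>i<N. x i \<noteq> 0) \<and> (\<forall>i<N. foldr (sweep N B) [0..<N] x i = l * x i)" by blast
  next
    assume "\<exists>x. (\<exists>i<N. x i \<noteq> 0) \<and> (\<forall>i<N. foldr (sweep N B) [0..<N] x i = l * x i)"
    then obtain x i where x: "i < N" "x i \<noteq> 0" "\<forall>i<N. foldr (sweep N B) [0..<N] x i = l * x i" by blast
    have "Matrix.vec N x \<noteq> 0\<^sub>v N"
    proof
      assume "Matrix.vec N x = 0\<^sub>v N"
      then have "vec_index (Matrix.vec N x) i = vec_index (0\<^sub>v N) i" by simp
      then show False using x by simp
    qed
    moreover have "?C *\<^sub>v Matrix.vec N x = l \<cdot>\<^sub>v Matrix.vec N x" unfolding app using x(3) by auto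
    ultimately show "eigenvalue ?C l" unfolding eigenvalue_def eigenvector_def
      using C by (intro exI[of _ "Matrix.vec N x"]) auto
  qed
  have "(\<forall>i<N. foldr (sweep N B) [0..<N] x i = l * x i) \<longleftrightarrow>
    (\<forall>i<N. l * x i + x i + (\<Sum>c<i. B i c * x c) + l * (\<Sum>c\<in>{i<..<N}. B i c * x c) = 0)" for x
  proof
    assume a: "\<forall>i<N. foldr (sweep N B) [0..<N] x i = l * x i"
    show "\<forall>i<N. l * x i + x i + (\<Sum>c<i. B i c * x c) + l * (\<Sum>c\<in>{i<..<N}. B i c * x c) = 0"
    proof (intro allI impI)
      fix i assume i: "i < N"
      have "(\<Sum>c\<in>{i<..<N}. B i c * foldr (sweep N B) [0..<N] x c) = l * (\<Sum>c\<in>{i<..<N}. B i c * x c)"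
        unfolding sum_distrib_left by (rule sum.cong) (use a in auto)
      then have "l * x i = - x i - (\<Sum>c<i. B i c * x c) - l * (\<Sum>c\<in>{i<..<N}. B i c * x c)"
        using fold[OF i, of x] a i by simp
      then show "l * x i + x i + (\<Sum>c<i. B i c * x c) + l * (\<Sum>c\<in>{i<..<N}. B i c * x c) = 0" by simp
    qed
  next
    assume a: "\<forall>i<N. l * x i + x i + (\<Sum>c<i. B i c * x c) + l * (\<Sum>c\<in>{i<..<N}. B i c * x c) = 0"
    \<comment> \<open>The induction starts at the last coordinate, since each new value depends on
      the new values at larger indices.\<close>
    have "foldr (sweep N B) [0..<N] x i = l * x i" if "i < N" for i
      using that
    proof (induction "N - i" arbitrary: i rule: less_induct)
      case less
      have "(\<Sum>c\<in>{i<..<N}. B i c * foldr (sweep N B) [0..<N] x c) = l * (\<Sum>c\<in>{i<..<N}. B i c * x c)"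
        unfolding sum_distrib_left by (rule sum.cong) (use less in auto)
      then have "foldr (sweep N B) [0..<N] x i =
          - x i - (\<Sum>c<i. B i c * x c) - l * (\<Sum>c\<in>{i<..<N}. B i c * x c)"
        using fold[OF less(2), of x] by simp
      also have "\<dots> = l * x i"
        by (rule neg_sum_eq) (use a less(2) in blast)
      finally show ?case .
    qed
    then show "\<forall>i<N. foldr (sweep N B) [0..<N] x i = l * x i" by blast
  qed
  then show ?thesis unfolding ev by simp
qed

section \<open>Eigenvalue equations on the vertices of a graph\<close>

definition pos :: "'s list \<Rightarrow> 's \<Rightarrow> nat" where
  "pos ss u = (THE i. i < length ss \<and> ss ! i = u)"

lemma pos_nth: "distinct ss \<Longrightarrow> i < length ss \<Longrightarrow> pos ss (ss ! i) = i"
  unfolding pos_def by (rule the_equality) (auto simp: nth_eq_iff_index_eq)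

lemma pos_inj: "distinct ss \<Longrightarrow> u \<in> set ss \<Longrightarrow> w \<in> set ss \<Longrightarrow> pos ss u = pos ss w \<Longrightarrow> u = w"
  by (metis in_set_conv_nth pos_nth)

lemma coxeter_form_simply_laced:
  "coxeter_form (simply_laced E) u w = (if u = w then 1 else if {u, w} \<in> E then - 1 / 2 else 0)"
  by (simp add: coxeter_form_def simply_laced_def cos_60)

lemma graph_eigenvalue_iff:
  assumes ss: "distinct ss" and E: "\<And>u. {u} \<notin> E"
  shows "eigenvalue (map_mat complex_of_real (coxeter_transformation (simply_laced E) ss)) l \<longleftrightarrow>
    (\<exists>x. (\<exists>u\<in>set ss. x u \<noteq> 0) \<and> (\<forall>u\<in>set ss. (l + 1) * x u =
      (\<Sum>w\<in>set ss. if {u, w} \<in> E then (if pos ss w < pos ss u then 1 else l) * x w else 0)))"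
proof -
  let ?N = "length ss" and ?B = "gram2 (simply_laced E) ss"
  let ?eq1 = "\<lambda>x i. l * x i + x i + (\<Sum>c<i. ?B i c * x c) + l * (\<Sum>c\<in>{i<..<?N}. ?B i c * x c) = 0"
  let ?eq2 = "\<lambda>x u. (l + 1) * x u =
      (\<Sum>w\<in>set ss. if {u, w} \<in> E then (if pos ss w < pos ss u then 1 else l) * x w else 0)"
  have key: "?eq1 (\<lambda>i. x (ss ! i)) i \<longleftrightarrow> ?eq2 x (ss ! i)" if i: "i < ?N" for x i
  proof -
    have B: "?B i c = (if {ss ! i, ss ! c} \<in> E then -1 else 0)" if "c < ?N" "c \<noteq> i" for c
      using that i ss unfolding gram2_def coxeter_form_simply_laced by (auto simp: nth_eq_iff_index_eq)
    let ?g = "\<lambda>w. if {ss ! i, w} \<in> E then (if pos ss w < pos ss (ss ! i) then 1 else l) * x w else 0"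
    have "(\<Sum>w\<in>set ss. ?g w) = (\<Sum>c<?N. ?g (ss ! c))"
      by (rule sum.reindex_bij_betw[symmetric, OF bij_betw_nth]) (use ss in auto)
    also have "\<dots> = (\<Sum>c<i. ?g (ss ! c)) + ?g (ss ! i) + (\<Sum>c\<in>{i<..<?N}. ?g (ss ! c))"
      by (rule sum_split_at[OF i])
    also have "?g (ss ! i) = 0" using E by simp
    also have "(\<Sum>c<i. ?g (ss ! c)) = - (\<Sum>c<i. ?B i c * x (ss ! c))"
      unfolding sum_negf[symmetric] by (rule sum.cong) (use B i pos_nth[OF ss] in auto)
    also have "(\<Sum>c\<in>{i<..<?N}. ?g (ss ! c)) = - (l * (\<Sum>c\<in>{i<..<?N}. ?B i c * x (ss ! c)))"
      unfolding sum_negf[symmetric] sum_distrib_left by (rule sum.cong) (use B i pos_nth[OF ss] in auto)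
    finally have S: "(\<Sum>w\<in>set ss. ?g w) = - (\<Sum>c<i. ?B i c * x (ss ! c)) + 0
      + - (l * (\<Sum>c\<in>{i<..<?N}. ?B i c * x (ss ! c)))" .
    show ?thesis unfolding S by (rule sum_zero_iff)
  qed
  have "eigenvalue (map_mat complex_of_real (coxeter_transformation (simply_laced E) ss)) l \<longleftrightarrow>
    (\<exists>x. (\<exists>i<?N. x i \<noteq> 0) \<and> (\<forall>i<?N. ?eq1 x i))"
    by (rule coxeter_eigenvalue_iff) (simp add: coxeter_form_simply_laced)
  also have "\<dots> \<longleftrightarrow> (\<exists>x. (\<exists>u\<in>set ss. x u \<noteq> 0) \<and> (\<forall>u\<in>set ss. ?eq2 x u))"
  proof
    assume "\<exists>x. (\<exists>i<?N. x i \<noteq> 0) \<and> (\<forall>i<?N. ?eq1 x i)"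
    then obtain x j where x: "j < ?N" "x j \<noteq> 0" "\<And>i. i < ?N \<Longrightarrow> ?eq1 x i" by blast
    define y where "y = x \<circ> pos ss"
    have yx: "y (ss ! i) = x i" if "i < ?N" for i unfolding y_def using pos_nth[OF ss that] by simp
    have y1: "?eq1 (\<lambda>i. y (ss ! i)) i" if i: "i < ?N" for i
    proof -
      have "(\<Sum>c<i. ?B i c * y (ss ! c)) = (\<Sum>c<i. ?B i c * x c)"
        "(\<Sum>c\<in>{i<..<?N}. ?B i c * y (ss ! c)) = (\<Sum>c\<in>{i<..<?N}. ?B i c * x c)"
        by (rule sum.cong; use yx i in auto)+
      then show ?thesis using x(3)[OF i] yx[OF i] by simp
    qed
    have y2: "?eq2 y (ss ! i)" if "i < ?N" for i by (rule iffD1[OF key[OF that, of y] y1[OF that]])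
    have "\<forall>u\<in>set ss. ?eq2 y u"
    proof
      fix u assume "u \<in> set ss"
      then obtain i where "i < ?N" "ss ! i = u" unfolding in_set_conv_nth by blast
      then show "?eq2 y u" using y2[of i] by blast
    qed
    moreover have "\<exists>u\<in>set ss. y u \<noteq> 0"
      using x(1,2) yx[OF x(1)] by (intro bexI[of _ "ss ! j"]) auto
    ultimately show "\<exists>x. (\<exists>u\<in>set ss. x u \<noteq> 0) \<and> (\<forall>u\<in>set ss. ?eq2 x u)"
      by (intro exI[of _ y] conjI)
  next
    assume "\<exists>x. (\<exists>u\<in>set ss. x u \<noteq> 0) \<and> (\<forall>u\<in>set ss. ?eq2 x u)"
    then obtain x where x: "\<exists>u\<in>set ss. x u \<noteq> 0" "\<forall>u\<in>set ss. ?eq2 x u" by blast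
    obtain u where u: "u \<in> set ss" "x u \<noteq> 0" using x(1) by (rule bexE)
    then obtain j where "j < ?N" "ss ! j = u" unfolding in_set_conv_nth by blast
    then have "\<exists>i<?N. x (ss ! i) \<noteq> 0" using u by (intro exI[of _ j]) simp
    moreover have "\<forall>i<?N. ?eq1 (\<lambda>i. x (ss ! i)) i"
    proof (intro allI impI)
      fix i assume i: "i < ?N"
      then have "?eq2 x (ss ! i)" using x(2) nth_mem by blast
      then show "?eq1 (\<lambda>i. x (ss ! i)) i" by (rule iffD2[OF key[OF i, of x]])
    qed
    ultimately show "\<exists>x. (\<exists>i<?N. x i \<noteq> 0) \<and> (\<forall>i<?N. ?eq1 x i)"
      by (intro exI[of _ "\<lambda>i. x (ss ! i)"] conjI)
  qed
  finally show ?thesis .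
qed

text \<open>On a tree there is an integer potential \<open>h\<close> that drops by one along every edge in the direction
  of the enumeration. Rescaling by powers of a square root of the eigenvalue turns the eigenvector into an
  eigenvector of the adjacency matrix, whatever the enumeration is.\<close>

lemma graph_eigenvalue_potential:
  fixes s :: complex
  assumes ss: "distinct ss" and E: "\<And>u. {u} \<notin> E"
    and h: "\<And>u w. \<lbrakk>u \<in> set ss; w \<in> set ss; {u, w} \<in> E\<rbrakk> \<Longrightarrow>
       h w = (if pos ss w < pos ss u then h u + 1 else h u - (1 :: int))"
    and s: "s \<noteq> 0"
  shows "eigenvalue (map_mat complex_of_real (coxeter_transformation (simply_laced E) ss)) (s\<^sup>2) \<longleftrightarrow>
    (\<exists>y. (\<exists>u\<in>set ss. y u \<noteq> 0) \<and> (\<forall>u\<in>set ss. (s + 1 / s) * y u =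
      (\<Sum>w\<in>set ss. if {u, w} \<in> E then y w else 0)))"
proof -
  let ?eq2 = "\<lambda>x u. (s\<^sup>2 + 1) * x u =
      (\<Sum>w\<in>set ss. if {u, w} \<in> E then (if pos ss w < pos ss u then 1 else s\<^sup>2) * x w else 0)"
  let ?eq3 = "\<lambda>y u. (s + 1 / s) * y u = (\<Sum>w\<in>set ss. if {u, w} \<in> E then y w else 0)"
  \<comment> \<open>An earlier neighbour contributes \<open>s^(h + 1)\<close>, a later one
    \<open>s^2 * s^(h - 1)\<close>, where \<open>h = h u\<close>. The common factor
    \<open>s^(h + 1)\<close> cancels.\<close>
  have key: "?eq2 (\<lambda>u. s powi h u * y u) u \<longleftrightarrow> ?eq3 y u" if u: "u \<in> set ss" for y u
  proof -
    have "(\<Sum>w\<in>set ss. if {u, w} \<in> E then (if pos ss w < pos ss u then 1 else s\<^sup>2) * (s powi h w * y w) else 0)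
      = (\<Sum>w\<in>set ss. s powi h u * s * (if {u, w} \<in> E then y w else 0))"
    proof (rule sum.cong[OF refl])
      fix w assume w: "w \<in> set ss"
      show "(if {u, w} \<in> E then (if pos ss w < pos ss u then 1 else s\<^sup>2) * (s powi h w * y w) else 0) =
        s powi h u * s * (if {u, w} \<in> E then y w else 0)"
        using h[OF u w] s by (auto simp: power_int_add power_int_diff power2_eq_square)
    qed
    then have S: "(\<Sum>w\<in>set ss. if {u, w} \<in> E then (if pos ss w < pos ss u then 1 else s\<^sup>2) * (s powi h w * y w) else 0)
      = s powi h u * s * (\<Sum>w\<in>set ss. if {u, w} \<in> E then y w else 0)" by (simp add: sum_distrib_left)
    have T: "(s\<^sup>2 + 1) * (s powi h u * y u) = s powi h u * s * ((s + 1 / s) * y u)"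
      using s by (simp add: field_simps power2_eq_square)
    have "s powi h u * s \<noteq> 0" using s by simp
    then show ?thesis unfolding S T by (simp only: mult_cancel_left simp_thms)
  qed
  have "eigenvalue (map_mat complex_of_real (coxeter_transformation (simply_laced E) ss)) (s\<^sup>2) \<longleftrightarrow>
    (\<exists>x. (\<exists>u\<in>set ss. x u \<noteq> 0) \<and> (\<forall>u\<in>set ss. ?eq2 x u))"
    by (rule graph_eigenvalue_iff[OF ss E])
  also have "\<dots> \<longleftrightarrow> (\<exists>y. (\<exists>u\<in>set ss. y u \<noteq> 0) \<and> (\<forall>u\<in>set ss. ?eq3 y u))"
  proof
    assume "\<exists>x. (\<exists>u\<in>set ss. x u \<noteq> 0) \<and> (\<forall>u\<in>set ss. ?eq2 x u)"
    then obtain x where x: "\<exists>u\<in>set ss. x u \<noteq> 0" "\<forall>u\<in>set ss. ?eq2 x u" by blast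
    define y where "y = (\<lambda>u. s powi (- h u) * x u)"
    have xy: "x = (\<lambda>u. s powi h u * y u)"
      unfolding y_def using s by (auto simp: power_int_minus)
    have "?eq3 y u" if u: "u \<in> set ss" for u
      by (rule iffD1[OF key[OF u, of y]]) (use x(2) u in \<open>unfold xy, blast\<close>)
    then have "\<forall>u\<in>set ss. ?eq3 y u" by blast
    moreover have "\<exists>u\<in>set ss. y u \<noteq> 0" using x(1) unfolding xy by auto
    ultimately show "\<exists>y. (\<exists>u\<in>set ss. y u \<noteq> 0) \<and> (\<forall>u\<in>set ss. ?eq3 y u)" by blast
  next
    assume "\<exists>y. (\<exists>u\<in>set ss. y u \<noteq> 0) \<and> (\<forall>u\<in>set ss. ?eq3 y u)"
    then obtain y where y: "\<exists>u\<in>set ss. y u \<noteq> 0" "\<forall>u\<in>set ss. ?eq3 y u" by blast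
    have "?eq2 (\<lambda>u. s powi h u * y u) u" if u: "u \<in> set ss" for u
      by (rule iffD2[OF key[OF u, of y]]) (use y(2) u in blast)
    then have "\<forall>u\<in>set ss. ?eq2 (\<lambda>u. s powi h u * y u) u" by blast
    moreover have "\<exists>u\<in>set ss. s powi h u * y u \<noteq> 0" using y(1) s by auto
    ultimately show "\<exists>x. (\<exists>u\<in>set ss. x u \<noteq> 0) \<and> (\<forall>u\<in>set ss. ?eq2 x u)"
      by (intro exI[of _ "\<lambda>u. s powi h u * y u"] conjI)
  qed
  finally show ?thesis .
qed

text \<open>The value \<open>S\<close> of the Hermitian form of a real symmetric matrix is real, and
  it equals \<open>\<mu>\<close> times the positive number \<open>q\<close>.\<close>

lemma adjacency_eigenvalue_real:
  fixes y :: "'s \<Rightarrow> complex"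
  assumes "finite V" "u0 \<in> V" "y u0 \<noteq> 0"
    and eq: "\<And>u. u \<in> V \<Longrightarrow> \<mu> * y u = (\<Sum>w\<in>V. if {u, w} \<in> E then y w else 0)"
  shows "\<mu> \<in> \<real>"
proof -
  define q where "q = (\<Sum>u\<in>V. (norm (y u))\<^sup>2)"
  have "q > 0" unfolding q_def using assms by (intro sum_pos2[of _ u0]) auto
  define S where "S = (\<Sum>u\<in>V. \<Sum>w\<in>V. if {u, w} \<in> E then cnj (y u) * y w else 0)"
  have "S = (\<Sum>u\<in>V. cnj (y u) * (\<Sum>w\<in>V. if {u, w} \<in> E then y w else 0))"
    unfolding S_def sum_distrib_left by (intro sum.cong refl) auto
  also have "\<dots> = (\<Sum>u\<in>V. cnj (y u) * (\<mu> * y u))" by (rule sum.cong) (use eq in auto)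
  also have "\<dots> = (\<Sum>u\<in>V. \<mu> * of_real ((norm (y u))\<^sup>2))"
    by (rule sum.cong[OF refl]) (subst complex_norm_square, simp add: ac_simps)
  finally have S: "S = \<mu> * of_real q" unfolding q_def by (simp add: sum_distrib_left)
  have "cnj S = (\<Sum>u\<in>V. \<Sum>w\<in>V. if {u, w} \<in> E then cnj (y w) * y u else 0)"
    unfolding S_def cnj_sum by (intro sum.cong refl) auto
  also have "\<dots> = (\<Sum>w\<in>V. \<Sum>u\<in>V. if {u, w} \<in> E then cnj (y w) * y u else 0)" by (rule sum.swap)
  also have "\<dots> = S" unfolding S_def by (intro sum.cong refl) (simp add: insert_commute)
  finally have "cnj \<mu> * of_real q = \<mu> * of_real q" unfolding S by simp
  then have "cnj \<mu> = \<mu>" using \<open>q > 0\<close> by simp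
  then show ?thesis by (simp add: Reals_cnj_iff)
qed

text \<open>The imaginary part of \<open>s + 1 / s\<close> is
  \<open>Im s * (1 - 1 / (norm s)\<^sup>2)\<close>.\<close>

lemma add_inverse_real:
  fixes s :: complex
  assumes "s \<noteq> 0" "s + 1 / s \<in> \<real>" "norm s \<noteq> 1"
  shows "s \<in> \<real>"
proof -
  have "Im (1 / s) = - Im s / (norm s)\<^sup>2"
    by (simp add: Im_divide cmod_power2)
  moreover have "Im s + Im (1 / s) = 0" using assms(2) by (simp add: complex_is_Real_iff)
  ultimately have "Im s - Im s / (norm s)\<^sup>2 = 0" by simp
  then have "Im s * ((norm s)\<^sup>2 - 1) = 0" using assms(1) by (simp add: field_simps)
  moreover have "(norm s)\<^sup>2 \<noteq> 1" using assms(3) by (simp add: power2_eq_1_iff) (smt (verit) norm_ge_zero)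
  ultimately show ?thesis by (simp add: complex_is_Real_iff)
qed

section \<open>Stars\<close>

lemma star_no_loop: "{u} \<notin> star_edges k p"
  by (auto simp: star_edges_def)

text \<open>Starting from 0 at the centre, each edge adds 1 or -1 according to the order of its ends
  in the enumeration. This is consistent because a vertex is reached by only one path.\<close>

primrec arm_potential :: "star_vertex list \<Rightarrow> nat \<Rightarrow> nat \<Rightarrow> int" where
  "arm_potential ss i 0 = (if pos ss (Arm i 0) < pos ss Center then 1 else -1)"
| "arm_potential ss i (Suc j) = arm_potential ss i j +
     (if pos ss (Arm i (Suc j)) < pos ss (Arm i j) then 1 else -1)"

definition star_potential :: "star_vertex list \<Rightarrow> star_vertex \<Rightarrow> int" where
  "star_potential ss u = (case u of Center \<Rightarrow> 0 | Arm i j \<Rightarrow> arm_potential ss i j)"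

lemma star_potential_edge:
  assumes ss: "distinct ss" and uw: "u \<in> set ss" "w \<in> set ss" "{u, w} \<in> star_edges k p"
  shows "star_potential ss w =
    (if pos ss w < pos ss u then star_potential ss u + 1 else star_potential ss u - 1)"
proof -
  have "u \<noteq> w" using uw(3) star_no_loop by auto
  then have "pos ss u \<noteq> pos ss w" using pos_inj[OF ss uw(1,2)] by blast
  then show ?thesis using uw(3) unfolding star_edges_def
    by (auto simp: doubleton_eq_iff star_potential_def)
qed

lemma star_finite: "finite (star_vertices k p)"
proof -
  have "star_vertices k p = insert Center (\<Union>i<k. (\<lambda>j. Arm i j) ` {j. j + 1 < p i})"
    unfolding star_vertices_def by auto
  moreover have "finite {j. j + 1 < p i}" for i by (rule finite_subset[of _ "{..<p i}"]) auto
  ultimately show ?thesis by simp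
qed

section \<open>Solving the eigenvalue equations of the star\<close>

lemma star_sum_center:
  assumes "\<And>i. i < k \<Longrightarrow> 2 \<le> p i"
  shows "(\<Sum>w\<in>star_vertices k p. if {Center, w} \<in> star_edges k p then F w else 0) =
    (\<Sum>i<k. F (Arm i 0) :: complex)"
proof -
  have "star_vertices k p \<inter> {w. {Center, w} \<in> star_edges k p} = (\<lambda>i. Arm i 0) ` {..<k}"
    using assms by (force simp: star_vertices_def star_edges_def doubleton_eq_iff)
  then have "(\<Sum>w\<in>star_vertices k p \<inter> {w. {Center, w} \<in> star_edges k p}. F w) = (\<Sum>i<k. F (Arm i 0))"
    by (simp add: sum.reindex inj_on_def)
  then show ?thesis by (simp add: sum.inter_restrict star_finite)
qed

lemma star_sum_arm:
  assumes "i < k" "j + 1 < p i"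
  shows "(\<Sum>w\<in>star_vertices k p. if {Arm i j, w} \<in> star_edges k p then F w else 0) =
    (if j = 0 then F Center else F (Arm i (j - 1))) + (if j + 2 < p i then F (Arm i (j + 1)) else (0 :: complex))"
proof -
  let ?A = "if j = 0 then {Center} else {Arm i (j - 1)}"
  let ?B = "if j + 2 < p i then {Arm i (j + 1)} else {}"
  have "star_vertices k p \<inter> {w. {Arm i j, w} \<in> star_edges k p} = ?A \<union> ?B"
  proof (cases j)
    case 0
    then show ?thesis using assms by (auto simp: star_vertices_def star_edges_def doubleton_eq_iff)
  next
    case (Suc j')
    then show ?thesis using assms by (auto simp: star_vertices_def star_edges_def doubleton_eq_iff)
  qed
  then have "(\<Sum>w\<in>star_vertices k p \<inter> {w. {Arm i j, w} \<in> star_edges k p}. F w) = sum F (?A \<union> ?B)" by simp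
  also have "\<dots> = sum F ?A + sum F ?B" by (rule sum.union_disjoint) auto
  finally show ?thesis using star_finite by (simp add: sum.inter_restrict split: if_splits)
qed

text \<open>After rescaling by powers of \<open>s\<close> this is the recursion along an arm, so the
  geometric sums are its solutions.\<close>

lemma geometric_three_term:
  fixes t :: complex
  shows "(1 + t) * (\<Sum>l<Suc n. t ^ l) = (\<Sum>l<Suc (Suc n). t ^ l) + t * (\<Sum>l<n. t ^ l)"
  by (simp add: algebra_simps)

lemma geometric_shift:
  fixes t :: complex
  assumes "0 < n"
  shows "t * (\<Sum>l<n - 1. t ^ l) = t * (\<Sum>l<n. t ^ l) - t ^ n"
proof -
  obtain j where "n = Suc j" using assms by (cases n) auto
  then show ?thesis by (simp add: algebra_simps)
qed

text \<open>The arm is solved inwards from a fictitious vertex with value 0 beyond its outer end.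
  The extra factor \<open>s\<close> on the left avoids the exponent \<open>j - 1\<close>.\<close>

lemma arm_solution:
  fixes s t :: complex and z :: "nat \<Rightarrow> complex"
  assumes s: "s \<noteq> 0" and t: "t = 1 / s\<^sup>2" and zn: "z n = 0"
    and rec: "\<And>j. 0 < j \<Longrightarrow> j < n \<Longrightarrow> (s + 1 / s) * z j = z (j - 1) + z (j + 1)"
  shows "j \<le> n \<Longrightarrow> z (n - j) * s = z (n - 1) * s ^ j * (\<Sum>l<j. t ^ l)"
proof (induction j rule: induct_nat_012)
  case (ge2 j)
  let ?G = "\<lambda>j. \<Sum>l<j. t ^ l"
  have "(s + 1 / s) * z (n - Suc j) = z (n - Suc (Suc j)) + z (n - j)"
    using rec[of "n - Suc j"] ge2(3) by (simp add: Suc_diff_Suc)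
  then have "z (n - Suc (Suc j)) * s = (s + 1 / s) * (z (n - Suc j) * s) - z (n - j) * s"
    by (simp add: algebra_simps)
  also have "\<dots> = z (n - 1) * ((s + 1 / s) * s ^ Suc j * ?G (Suc j) - s ^ j * ?G j)"
    using ge2 by (simp add: algebra_simps)
  also have "(s + 1 / s) * s ^ Suc j * ?G (Suc j) - s ^ j * ?G j =
      s ^ Suc (Suc j) * ((1 + t) * ?G (Suc j) - t * ?G j)"
    using s unfolding t by (simp add: field_simps power2_eq_square del: sum.lessThan_Suc)
  also have "(1 + t) * ?G (Suc j) - t * ?G j = ?G (Suc (Suc j))"
    unfolding geometric_three_term by simp
  finally show ?case by (simp only: mult.assoc)
qed (use zn in auto)

lemma star_eigenvector_denom:
  fixes s :: complex
  assumes p: "\<And>i. i < k \<Longrightarrow> 2 \<le> p i" and s: "norm s > 1"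
    and y: "u0 \<in> star_vertices k p" "y u0 \<noteq> 0"
    and eq: "\<And>u. u \<in> star_vertices k p \<Longrightarrow> (s + 1 / s) * y u =
      (\<Sum>w\<in>star_vertices k p. if {u, w} \<in> star_edges k p then y w else 0)"
  shows "denom k p (1 / s\<^sup>2) = 0"
proof -
  define t where "t = 1 / s\<^sup>2"
  let ?G = "\<lambda>j. \<Sum>l<j. t ^ l"
  \<comment> \<open>Position 0 is the centre and position \<open>p i\<close> the fictitious vertex,
    so that the three-term recursion holds at all vertices of the arm alike.\<close>
  define z where "z = (\<lambda>i j. if j = 0 then y Center else if j < p i then y (Arm i (j - 1)) else 0)"
  have s0: "s \<noteq> 0" using s by auto
  have ts: "t * s = 1 / s" unfolding t_def using s0 by (simp add: power2_eq_square)
  have "1 < (norm s)\<^sup>2" using s by (simp add: one_less_power)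
  then have "norm t < 1" unfolding t_def by (auto simp: norm_divide norm_power divide_less_eq)
  then have G0: "?G (p i) \<noteq> 0" if "i < k" for i using geometric_nonzero[of t "p i"] p[OF that] by simp
  have rec: "(s + 1 / s) * z i j = z i (j - 1) + z i (j + 1)" if "i < k" "0 < j" "j < p i" for i j
  proof -
    obtain j' where j': "j = Suc j'" using \<open>0 < j\<close> by (cases j) auto
    have "Arm i j' \<in> star_vertices k p" using that j' by (auto simp: star_vertices_def)
    from eq[OF this] show ?thesis
      using star_sum_arm[of i k j' p y] that j' unfolding z_def by (auto split: if_splits)
  qed
  have sol: "z i (p i - j) * s = z i (p i - 1) * s ^ j * ?G j" if "i < k" "j \<le> p i" for i j
    by (rule arm_solution[OF s0 t_def]) (use rec p[of i] that in \<open>auto simp: z_def\<close>)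
  \<comment> \<open>If the centre vanishes, so does every arm, because \<open>?G (p i)\<close> is
    nonzero inside the unit disc.\<close>
  have y0: "y Center \<noteq> 0"
  proof
    assume c: "y Center = 0"
    have "z i j = 0" if "i < k" "j \<le> p i" for i j
    proof -
      have "z i (p i - 1) * s ^ p i * ?G (p i) = 0" using sol[of i "p i"] that c by (simp add: z_def)
      then have "z i (p i - 1) = 0" using s0 G0[OF that(1)] by simp
      then show ?thesis using sol[of i "p i - j"] that s0 by simp
    qed
    then have "y u = 0" if "u \<in> star_vertices k p" for u
    proof (cases u)
      case (Arm i j)
      then have "i < k" "j + 1 < p i" using that by (auto simp: star_vertices_def)
      then show ?thesis using \<open>\<And>i j. i < k \<Longrightarrow> j \<le> p i \<Longrightarrow> z i j = 0\<close>[of i "j + 1"] Arm by (simp add: z_def)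
    qed (use c in simp)
    then show False using y by blast
  qed
  \<comment> \<open>Comparing the arm solution at positions 0 and 1 eliminates the value at the
    outer end.\<close>
  have z1: "y (Arm i 0) = s * (y Center * (t - t ^ p i * inverse (?G (p i))))" if i: "i < k" for i
  proof -
    let ?c = "z i (p i - 1)"
    have "s ^ p i = s ^ (p i - 1) * s" using p[OF i] by (cases "p i") auto
    then have "z i 0 * s = (?c * s ^ (p i - 1) * ?G (p i)) * s"
      using sol[OF i, of "p i"] by (simp add: ac_simps)
    then have "z i 0 = ?c * s ^ (p i - 1) * ?G (p i)" using s0 by (simp only: mult_cancel_right) simp
    moreover have "z i 1 * s = ?c * s ^ (p i - 1) * ?G (p i - 1)"
      using sol[OF i, of "p i - 1"] p[OF i] by simp
    ultimately have "z i 1 * s * ?G (p i) = z i 0 * ?G (p i - 1)" by (simp only: ac_simps)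
    then have "z i 1 * (t * s) * ?G (p i) = z i 0 * (t * ?G (p i - 1))" by (simp add: ac_simps)
    also have "t * ?G (p i - 1) = t * ?G (p i) - t ^ p i" by (rule geometric_shift) (use p[OF i] in simp)
    finally have "z i 1 * (t * s) = z i 0 * (t * ?G (p i) - t ^ p i) / ?G (p i)" using G0[OF i] by (simp add: field_simps)
    also have "\<dots> = z i 0 * (t - t ^ p i * inverse (?G (p i)))" using G0[OF i] by (simp add: field_simps)
    finally have "z i 1 / s = z i 0 * (t - t ^ p i * inverse (?G (p i)))" unfolding ts by simp
    moreover have "z i 1 = y (Arm i 0)" "z i 0 = y Center" using p[OF i] by (auto simp: z_def)
    ultimately show ?thesis using s0 by (simp add: divide_eq_eq ac_simps)
  qed
  have "(s + 1 / s) * y Center = (\<Sum>i<k. y (Arm i 0))"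
    using eq[of Center] star_sum_center[of k p y, OF p] by (simp add: star_vertices_def)
  also have "\<dots> = (\<Sum>i<k. s * (y Center * (t - t ^ p i * inverse (?G (p i)))))"
    by (rule sum.cong) (use z1 in auto)
  also have "\<dots> = s * (y Center * (of_nat k * t - (\<Sum>i<k. t ^ p i * inverse (?G (p i)))))"
    by (simp add: sum_distrib_left[symmetric] sum_subtractf)
  also have "(s + 1 / s) = s * (1 + t)" unfolding distrib_left using ts by (simp add: mult.commute)
  finally have "1 + t = of_nat k * t - (\<Sum>i<k. t ^ p i * inverse (?G (p i)))"
    using s0 y0 by (simp add: ac_simps)
  then show ?thesis unfolding denom_def t_def[symmetric] by simp
qed

lemma denom_star_eigenvector:
  fixes s :: complex
  assumes p: "\<And>i. i < k \<Longrightarrow> 2 \<le> p i" and s: "norm s > 1" and d: "denom k p (1 / s\<^sup>2) = 0"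
  shows "\<exists>y. y Center \<noteq> 0 \<and> (\<forall>u\<in>star_vertices k p. (s + 1 / s) * y u =
      (\<Sum>w\<in>star_vertices k p. if {u, w} \<in> star_edges k p then y w else 0))"
proof -
  define t where "t = 1 / s\<^sup>2"
  let ?G = "\<lambda>j. \<Sum>l<j. t ^ l"
  \<comment> \<open>The arm solution, normalised to 1 at the centre; only the equation at the centre
    then remains, and that is \<open>denom k p t = 0\<close>.\<close>
  define z where "z = (\<lambda>i j. ?G (p i - j) / (s ^ j * ?G (p i)))"
  define y where "y = (\<lambda>u. case u of Center \<Rightarrow> 1 | Arm i j \<Rightarrow> z i (Suc j))"
  have s0: "s \<noteq> 0" using s by auto
  have ts: "t * s = 1 / s" unfolding t_def using s0 by (simp add: power2_eq_square)
  have "1 < (norm s)\<^sup>2" using s by (simp add: one_less_power)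
  then have "norm t < 1" unfolding t_def by (auto simp: norm_divide norm_power divide_less_eq)
  then have G0: "?G (p i) \<noteq> 0" if "i < k" for i using geometric_nonzero[of t "p i"] p[OF that] by simp
  have z0: "z i 0 = 1" if "i < k" for i unfolding z_def using G0[OF that] by simp
  have rec: "(s + 1 / s) * z i (Suc j) = z i j + z i (Suc (Suc j))" if i: "i < k" "Suc j < p i" for i j
  proof -
    obtain n where n: "p i - Suc j = Suc n" using i by (cases "p i - Suc j") auto
    then have n': "p i - j = Suc (Suc n)" "p i - Suc (Suc j) = n" by auto
    define D where "D = s ^ j * ?G (p i)"
    have D: "D \<noteq> 0" using s0 G0[OF i(1)] by (simp add: D_def)
    have z: "z i (Suc j) = ?G (Suc n) / (s * D)" "z i j = ?G (Suc (Suc n)) / D"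
      "z i (Suc (Suc j)) = ?G n / (s * s * D)"
      unfolding z_def n n' D_def by (simp_all only: power_Suc mult.assoc)
    have "z i j = ((1 + t) * ?G (Suc n) - t * ?G n) / D" unfolding z geometric_three_term by simp
    also have "\<dots> = (s + 1 / s) * z i (Suc j) - z i (Suc (Suc j))"
      unfolding z t_def using s0 D by (simp add: field_simps power2_eq_square del: sum.lessThan_Suc)
    finally show ?thesis by simp
  qed
  have "(s + 1 / s) * y u = (\<Sum>w\<in>star_vertices k p. if {u, w} \<in> star_edges k p then y w else 0)"
    if u: "u \<in> star_vertices k p" for u
  proof (cases u)
    case Center
    have "1 + t = (\<Sum>i<k. t - t ^ p i * inverse (?G (p i)))"
      using d unfolding denom_def t_def[symmetric] by (simp add: sum_subtractf algebra_simps)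
    also have "\<dots> = (\<Sum>i<k. z i 1 * (t * s))"
    proof (rule sum.cong[OF refl])
      fix i assume "i \<in> {..<k}"
      then have i: "i < k" by simp
      have "t - t ^ p i * inverse (?G (p i)) = (t * ?G (p i) - t ^ p i) / ?G (p i)"
        using G0[OF i] by (simp add: field_simps)
      also have "t * ?G (p i) - t ^ p i = t * ?G (p i - 1)"
        by (rule geometric_shift[symmetric]) (use p[OF i] in simp)
      finally show "t - t ^ p i * inverse (?G (p i)) = z i 1 * (t * s)"
        unfolding z_def using s0 by (simp add: field_simps)
    qed
    finally have "s * (1 + t) = s * (\<Sum>i<k. z i 1 * (1 / s))" unfolding ts by simp
    also have "\<dots> = (\<Sum>i<k. y (Arm i 0))" unfolding sum_distrib_left y_def using s0 by simp
    finally show ?thesis using star_sum_center[of k p y, OF p] ts Center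
      by (simp add: y_def distrib_left mult.commute)
  next
    case (Arm i j)
    then have i: "i < k" "Suc j < p i" using u by (auto simp: star_vertices_def)
    have "z i (Suc (Suc j)) = 0" if "\<not> j + 2 < p i"
    proof -
      have "p i - Suc (Suc j) = 0" using that by simp
      then show ?thesis unfolding z_def by simp
    qed
    then show ?thesis using rec[OF i] star_sum_arm[of i k j p y] i z0[OF i(1)] unfolding Arm
      by (cases j) (auto simp: y_def)
  qed
  moreover have "y Center \<noteq> 0" by (simp add: y_def)
  ultimately show ?thesis by blast
qed

lemma denom_of_real: "denom k p (complex_of_real t) = of_real (denom k p t)"
  unfolding denom_def by simp

lemma star_spectral_radius:
  assumes ss: "distinct ss" "set ss = star_vertices k p" and p: "\<And>i. i < k \<Longrightarrow> 2 \<le> p i"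
    and R: "0 < R" "R < 1" "denom k p R = (0 :: real)" "\<And>t. 0 < t \<Longrightarrow> t < R \<Longrightarrow> denom k p t \<noteq> 0"
  shows "spectral_radius (map_mat complex_of_real
      (coxeter_transformation (simply_laced (star_edges k p)) ss)) = 1 / R"
proof -
  let ?C = "map_mat complex_of_real (coxeter_transformation (simply_laced (star_edges k p)) ss)"
  have C: "?C \<in> carrier_mat (length ss) (length ss)"
    using coxeter_fold_apply[of "[0..<length ss]" ss] unfolding coxeter_transformation_def
    by (auto simp: lessThan_atLeast0)
  have "Center \<in> set ss" unfolding ss(2) star_vertices_def by simp
  then have n: "length ss > 0" by (cases ss) auto
  have eig: "eigenvalue ?C (s\<^sup>2) \<longleftrightarrow> (\<exists>y. (\<exists>u\<in>star_vertices k p. y u \<noteq> 0) \<and>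
    (\<forall>u\<in>star_vertices k p. (s + 1 / s) * y u =
      (\<Sum>w\<in>star_vertices k p. if {u, w} \<in> star_edges k p then y w else 0)))" if "s \<noteq> 0" for s
    unfolding ss(2)[symmetric]
    by (rule graph_eigenvalue_potential[where h = "star_potential ss", OF ss(1) star_no_loop _ that])
      (rule star_potential_edge[OF ss(1)])
  have upper: "norm l \<le> 1 / R" if l: "eigenvalue ?C l" for l
  proof (cases "norm l \<le> 1")
    case True
    moreover have "1 \<le> 1 / R" using R by simp
    ultimately show ?thesis by linarith
  next
    case False
    define s where "s = csqrt l"
    have sl: "s\<^sup>2 = l" unfolding s_def by simp
    have ns: "norm s > 1" using False unfolding sl[symmetric] norm_power
      by (metis abs_norm_cancel abs_square_le_1 linorder_not_less)
    then have s0: "s \<noteq> 0" by auto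
    obtain y u0 where y: "u0 \<in> star_vertices k p" "y u0 \<noteq> 0" and
      eq: "\<And>u. u \<in> star_vertices k p \<Longrightarrow> (s + 1 / s) * y u =
        (\<Sum>w\<in>star_vertices k p. if {u, w} \<in> star_edges k p then y w else 0)"
      using l eig[OF s0] unfolding sl by blast
    have "s + 1 / s \<in> \<real>" by (rule adjacency_eigenvalue_real[OF star_finite y eq])
    then obtain \<sigma> where \<sigma>: "s = of_real \<sigma>" using add_inverse_real[OF s0] ns by (auto elim: Reals_cases)
    define t where "t = 1 / \<sigma>\<^sup>2"
    have "denom k p (1 / s\<^sup>2) = 0" by (rule star_eigenvector_denom[OF p ns y eq])
    moreover have "1 / s\<^sup>2 = of_real t" unfolding \<sigma> t_def by simp
    ultimately have "denom k p t = 0" by (simp add: denom_of_real)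
    moreover have "0 < t" unfolding t_def using s0 \<sigma> by simp
    ultimately have "R \<le> t" using R(4)[of t] by force
    moreover have "norm l = 1 / t" unfolding sl[symmetric] \<sigma> t_def by (simp add: norm_power)
    ultimately show ?thesis using R by (simp add: frac_le)
  qed
  have "eigenvalue ?C (of_real (1 / R))"
  proof -
    define s where "s = complex_of_real (sqrt (1 / R))"
    have sl: "s\<^sup>2 = of_real (1 / R)" unfolding s_def using R by (simp flip: of_real_power)
    have ns: "norm s > 1" unfolding s_def using R by simp
    then have s0: "s \<noteq> 0" by auto
    have "1 / s\<^sup>2 = of_real R" unfolding sl by simp
    then have "denom k p (1 / s\<^sup>2) = 0" using R(3) by (simp add: denom_of_real)
    from denom_star_eigenvector[OF p ns this] have "eigenvalue ?C (s\<^sup>2)"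
      unfolding eig[OF s0] by (auto simp: star_vertices_def)
    then show ?thesis unfolding sl .
  qed
  then have "norm (complex_of_real (1 / R)) \<in> norm ` spectrum ?C" unfolding spectrum_def by auto
  then have "1 / R \<in> norm ` spectrum ?C" using R by (simp add: norm_divide)
  then have "1 / R \<le> spectral_radius ?C" by (rule spectral_radius_mem_max(2)[OF C n])
  moreover obtain l where "eigenvalue ?C l" "spectral_radius ?C = norm l"
    using spectral_radius_mem_max(1)[OF C n] unfolding spectrum_def by auto
  ultimately show ?thesis using upper[of l] by simp
qed

theorem theorem2:
  fixes k :: nat and p :: "nat \<Rightarrow> nat"
    and v :: "nat \<Rightarrow> real ^ 3" and ss :: "star_vertex list"
  assumes "3 \<le> k"
    and "\<forall>i<k. 2 \<le> p i"
    and "(\<Sum>i<k. 1 / real (p i)) < real k - 2"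
    and "coxeter_polygon k p v"
    and "distinct ss"
    and "set ss = star_vertices k p"
  shows "growth_rate (polygon_group k v) (side_reflections k v) =
    ereal (spectral_radius (map_mat complex_of_real
      (coxeter_transformation (simply_laced (star_edges k p)) ss)))"
proof -
  have p: "2 \<le> p i" if "i < k" for i using assms(2) that by simp
  interpret cox_polygon k p v by unfold_locales (use assms(1,4) p in auto)
  obtain R where R: "0 < R" "R < 1" "denom k p R = (0 :: real)" "\<And>t. 0 < t \<Longrightarrow> t < R \<Longrightarrow> denom k p t \<noteq> 0"
    "limsup (\<lambda>n. ereal (root n (real (sphere_size (polygon_group k v) (side_reflections k v) n)))) = ereal (1 / R)"
    using polygon_growth_radius[OF assms(1) p assms(3) polygon_growth_series] by blast
  then show ?thesis
    unfolding growth_rate_def using star_spectral_radius[OF assms(5,6) p R(1-4)] by simp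
qed

end
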